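(* Let $d\in\mathbb{N}$ and let $\xi,\xi_1,\xi_2,\ldots$ be i.i.d. random variables in $\mathbb{R}^d$ with $\mathbb{E}\xi=0$ and $\mathbb{E}[\|\xi\|^2]<\infty$. Let $\Sigma:=\mathbb{E}[\xi\xi^{\top}]$, $S_0:=0$ and $S_n:=\sum_{i=1}^n\xi_i$. Then, as $n\to\infty$, in the sense of weak convergence of random elements of $(\mathfrak{C}_0^d,\rho_H)$, $$n^{-1/2}\operatorname{hull}\{S_0,\ldots,S_n\}\Rightarrow\Sigma^{1/2}h_d,$$ where $h_d:=\operatorname{hull}b_d[0,1]$.
   Context: $\operatorname{hull}A$ is the convex hull of $A\subseteq\mathbb{R}^d$. $\mathfrak{C}_0^d$ is the set of convex compact subsets of $\mathbb{R}^d$ containing $0$, and $\rho_H$ is the Hausdorff distance $\rho_H(A,B):=\max\{\sup_{x\in A}\inf_{y\in B}\|x-y\|,\ \sup_{y\in B}\inf_{x\in A}\|x-y\|\}$. $b_d$ is standard $d$-dimensional Brownian motion started at $0$ with continuous paths and $b_d[0,1]:=\{b_d(t):t\in[0,1]\}$. $\Sigma^{1/2}$ is the nonnegative-definite symmetric square root of $\Sigma$, and $\Sigma^{1/2}B:=\{\Sigma^{1/2}x:x\in B\}$. Weak convergence $X_n\Rightarrow X$ in a metric space $S$ (with its Borel $\sigma$-algebra) means $\mathbb{E}f(X_n)\to\mathbb{E}f(X)$ for all bounded continuous $f:S\to\mathbb{R}$. *)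

theory Defs
  imports "HOL-Probability.Probability"
begin

definition hausdorff_dist :: "'a::real_normed_vector set \<Rightarrow> 'a set \<Rightarrow> real" where
  "hausdorff_dist A B =
     max (SUP x\<in>A. INF y\<in>B. norm (x - y)) (SUP y\<in>B. INF x\<in>A. norm (x - y))"

lemma hausdorff_dist_le_iff:
  assumes "A \<noteq> {}" "bounded A" "B \<noteq> {}" "bounded B"
  shows "hausdorff_dist A B \<le> e \<longleftrightarrow> (\<forall>x\<in>A. infdist x B \<le> e) \<and> (\<forall>y\<in>B. infdist y A \<le> e)"
proof -
  have bdd: "bdd_above ((\<lambda>x. infdist x D) ` C)" if C: "bounded C" and D: "D \<noteq> {}" for C D :: "'a set"
  proof -
    obtain d where d: "d \<in> D" using D by blast
    obtain r where "\<forall>x\<in>C. dist d x \<le> r" using C bounded_any_center[of C d] by blast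
    then show ?thesis
      by (intro bdd_aboveI2[of _ _ r]) (use d in \<open>auto intro: infdist_le2 simp: dist_commute\<close>)
  qed
  have *: "(INF y\<in>B. norm (x - y)) = infdist x B" for x
    using assms by (simp add: infdist_notempty dist_norm)
  have **: "(INF x\<in>A. norm (x - y)) = infdist y A" for y
    using assms by (simp add: infdist_notempty dist_norm norm_minus_commute)
  show ?thesis
    unfolding hausdorff_dist_def * ** using assms bdd by (simp add: cSUP_le_iff)
qed

typedef (overloaded) ('n::finite) body0 =
  "{A :: (real ^ 'n) set. convex A \<and> compact A \<and> 0 \<in> A}"
  by (rule exI[of _ "{0}"]) simp

setup_lifting type_definition_body0

lemma Rep_body0_props:
  "convex (Rep_body0 K)" "compact (Rep_body0 K)" "closed (Rep_body0 K)" "bounded (Rep_body0 K)"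
  "0 \<in> Rep_body0 K" "Rep_body0 K \<noteq> {}"
  using Rep_body0[of K] by (auto simp: compact_imp_closed compact_imp_bounded)

instantiation body0 :: (finite) metric_space
begin

definition dist_body0_def: "dist K L = hausdorff_dist (Rep_body0 K) (Rep_body0 L)"

definition uniformity_body0_def:
  "(uniformity :: ('a body0 \<times> 'a body0) filter) = (INF e\<in>{0<..}. principal {(K, L). dist K L < e})"

definition open_body0_def:
  "open (U :: 'a body0 set) \<longleftrightarrow> (\<forall>K\<in>U. \<forall>\<^sub>F (K', L) in uniformity. K' = K \<longrightarrow> L \<in> U)"

lemma dist_body0_le_iff:
  "dist K L \<le> e \<longleftrightarrow>
     (\<forall>x\<in>Rep_body0 K. infdist x (Rep_body0 L) \<le> e) \<and> (\<forall>y\<in>Rep_body0 L. infdist y (Rep_body0 K) \<le> e)"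
  for K L :: "'a body0"
  unfolding dist_body0_def by (rule hausdorff_dist_le_iff) (simp_all add: Rep_body0_props)

instance
proof
  fix K L P :: "'a body0"
  have nonneg: "0 \<le> dist K L" for K L :: "'a body0"
    using dist_body0_le_iff[of K L "dist K L"] Rep_body0_props(5)[of K] infdist_nonneg order_trans
    by blast
  show "dist K L = 0 \<longleftrightarrow> K = L"
  proof
    assume "dist K L = 0"
    then have "\<forall>x\<in>Rep_body0 K. infdist x (Rep_body0 L) = 0" "\<forall>y\<in>Rep_body0 L. infdist y (Rep_body0 K) = 0"
      using dist_body0_le_iff[of K L 0] by (auto intro: antisym infdist_nonneg)
    then have "Rep_body0 K = Rep_body0 L"
      by (auto simp: in_closed_iff_infdist_zero Rep_body0_props)
    then show "K = L" by (simp add: Rep_body0_inject)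
  next
    assume "K = L"
    then show "dist K L = 0" using nonneg[of K L] dist_body0_le_iff[of K L 0] by auto
  qed
  have tri: "infdist x (Rep_body0 L) \<le> infdist x (Rep_body0 P) + e"
    if e: "\<forall>c\<in>Rep_body0 P. infdist c (Rep_body0 L) \<le> e" for x e and L P :: "'a body0"
  proof -
    obtain c where c: "c \<in> Rep_body0 P" "infdist x (Rep_body0 P) = dist x c"
      using infdist_attains_inf[of "Rep_body0 P" x] by (auto simp: Rep_body0_props)
    show ?thesis
      using infdist_triangle[of x "Rep_body0 L" c] e c by fastforce
  qed
  have KP: "\<forall>x\<in>Rep_body0 K. infdist x (Rep_body0 P) \<le> dist K P"
    "\<forall>y\<in>Rep_body0 P. infdist y (Rep_body0 K) \<le> dist K P"
    using dist_body0_le_iff[of K P "dist K P"] by auto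
  have LP: "\<forall>x\<in>Rep_body0 L. infdist x (Rep_body0 P) \<le> dist L P"
    "\<forall>y\<in>Rep_body0 P. infdist y (Rep_body0 L) \<le> dist L P"
    using dist_body0_le_iff[of L P "dist L P"] by auto
  show "dist K L \<le> dist K P + dist L P"
    unfolding dist_body0_le_iff
    using tri[OF LP(2)] tri[OF KP(2)] KP(1) LP(1) by (smt (verit))
qed (simp_all add: uniformity_body0_def open_body0_def)

end

text \<open>Meaningful for compact \<open>A\<close> containing the origin, see \<open>Rep_hull_body\<close>.\<close>
definition hull_body :: "(real ^ 'n) set \<Rightarrow> 'n::finite body0" where
  "hull_body A = Abs_body0 (convex hull A)"

lemma Rep_hull_body:
  "compact A \<Longrightarrow> 0 \<in> A \<Longrightarrow> Rep_body0 (hull_body A) = convex hull A"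
  unfolding hull_body_def
  by (rule Abs_body0_inverse) (simp add: convex_convex_hull compact_convex_hull hull_inc)

lift_definition scale_body :: "real \<Rightarrow> 'n::finite body0 \<Rightarrow> 'n body0"
  is "\<lambda>c K. (\<lambda>x. c *\<^sub>R x) ` K"
  by (auto simp: convex_scaling compact_scaling)

lift_definition matrix_image_body :: "real ^ 'n ^ 'n \<Rightarrow> 'n::finite body0 \<Rightarrow> 'n body0"
  is "\<lambda>A K. (\<lambda>x. A *v x) ` K"
  by (auto simp: convex_linear_image matrix_vector_mul_linear image_iff
      intro!: compact_continuous_image matrix_vector_mult_linear_continuous_on bexI[of _ 0])

definition psd_sqrt :: "real ^ 'n ^ 'n \<Rightarrow> real ^ 'n ^ 'n" where
  "psd_sqrt A = (THE B. transpose B = B \<and> (\<forall>x. 0 \<le> x \<bullet> (B *v x)) \<and> B ** B = A)"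

definition second_moment_matrix :: "'a measure \<Rightarrow> ('a \<Rightarrow> real ^ 'n) \<Rightarrow> real ^ 'n ^ 'n" where
  "second_moment_matrix M X = (\<chi> i j. \<integral>\<omega>. X \<omega> $ i * X \<omega> $ j \<partial>M)"

text \<open>The index set is \<open>[0, \<infinity>)\<close>; values \<open>b t\<close> at negative \<open>t\<close> are irrelevant.
  The density is that of the normal law with mean \<open>0\<close> and covariance \<open>(t - s)\<close> times the identity.\<close>
definition standard_brownian_motion :: "'b measure \<Rightarrow> (real \<Rightarrow> 'b \<Rightarrow> real ^ 'n::finite) \<Rightarrow> bool" where
  "standard_brownian_motion N b \<longleftrightarrow>
     prob_space N \<and>
     (\<forall>t\<ge>0. b t \<in> borel_measurable N) \<and>
     (\<forall>\<omega>\<in>space N. b 0 \<omega> = 0 \<and> continuous_on {0..} (\<lambda>t. b t \<omega>)) \<and>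
     (\<forall>t :: nat \<Rightarrow> real. 0 \<le> t 0 \<and> mono t \<longrightarrow>
        (\<forall>k. prob_space.indep_vars N (\<lambda>_. borel) (\<lambda>i \<omega>. b (t (Suc i)) \<omega> - b (t i) \<omega>) {..<k})) \<and>
     (\<forall>s t. 0 \<le> s \<and> s < t \<longrightarrow>
        distributed N lborel (\<lambda>\<omega>. b t \<omega> - b s \<omega>)
          (\<lambda>x. ennreal (\<Prod>i\<in>UNIV. normal_density 0 (sqrt (t - s)) (x $ i))))"

text \<open>The random elements may live on different probability spaces. Borel measurability is part of
  the notion, since the integral of a non-measurable function is \<open>0\<close> by convention.\<close>
definition weakly_converges ::
  "'a measure \<Rightarrow> (nat \<Rightarrow> 'a \<Rightarrow> 's::metric_space) \<Rightarrow> 'b measure \<Rightarrow> ('b \<Rightarrow> 's) \<Rightarrow> bool" where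
  "weakly_converges M X N Y \<longleftrightarrow>
     (\<forall>n. X n \<in> borel_measurable M) \<and> Y \<in> borel_measurable N \<and>
     (\<forall>f :: 's \<Rightarrow> real. continuous_on UNIV f \<and> bounded (range f) \<longrightarrow>
        (\<lambda>n. \<integral>\<omega>. f (X n \<omega>) \<partial>M) \<longlonglongrightarrow> (\<integral>\<omega>. f (Y \<omega>) \<partial>N))"

end

theory Submission
  imports Defs "HOL-Library.Log_Nat"
begin

text \<open>The convex hull of finitely many points is a Lipschitz function of the points, so the walk is
  replaced by its skeleton at the times \<open>\<lfloor>n j / m\<rfloor>\<close>, \<open>j \<le> m\<close>. The skeleton is compared directly with
  the Brownian motion sampled at \<open>k / n\<close> by Lindeberg's replacement of the increments one at a time,
  which needs neither characteristic functions nor a multivariate central limit theorem. The smooth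
  test functions are the polynomials in \<open>tanh\<close> of the coordinates: by Stone-Weierstrass on the cube
  they approximate every continuous function composed with a coordinatewise truncation, uniformly
  on the whole space.
  The distance between walk and skeleton is controlled by Ottaviani's maximal inequality on each
  block and a second application of Lindeberg's bound: the fourth moments of the Brownian increments
  give \<open>O(1 / m\<^sup>2)\<close> for each of the \<open>m\<close> blocks. On the Brownian side, continuity of paths suffices.
  Lipschitz test functions on the space of bodies extend to continuous ones by inf-convolution.\<close>

section \<open>Hulls of finitely many points\<close>

text \<open>Only second moments of the increments are assumed, and this shapes the argument.
  Chebyshev's inequality bounds the probability of a large oscillation in one of \<open>m\<close>
  blocks by \<open>O(1 / m)\<close>, so the sum over all blocks would not tend to zero. The faster
  decay available for Gaussian blocks is carried over to the walk by the bounded smooth function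
  \<open>tanh_quartic\<close>, which is bounded below where the block sum is large and is of fourth
  order at the origin. The Lindeberg error is made small by letting \<open>n\<close> grow while
  \<open>m\<close> stays fixed; only then does \<open>m\<close> grow. The function tanh is chosen
  because its derivatives are polynomials in tanh: expansions are uniform in the base point, such
  functions are stable under products, and bounded values turn the noncompact path space into a
  compact cube. What truncation loses is paid for by second moments alone. Walk and Brownian motion
  are both cut into \<open>n\<close> increments with equal means and covariances, so the replacement
  runs over one index set.\<close>

lemma convex_infdist_le:
  fixes K :: "'a::euclidean_space set"
  assumes "convex K" "compact K" "K \<noteq> {}"
  shows "convex {x. infdist x K \<le> e}"
proof (cases "e < 0")
  case True
  then have "{x. infdist x K \<le> e} = {}"
    using infdist_nonneg[of _ K] by (smt (verit) Collect_empty_eq)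
  then show ?thesis by simp
next
  case False
  \<comment> \<open>The infimum over the compact \<open>K\<close> is attained, so this neighbourhood
    is the Minkowski sum of \<open>K\<close> and a closed ball, and such sums are convex.\<close>
  have "{x. infdist x K \<le> e} = (\<Union>x\<in>K. \<Union>y\<in>cball 0 e. {x + y})"
  proof (intro set_eqI iffI)
    fix x assume "x \<in> {x. infdist x K \<le> e}"
    moreover obtain k where "k \<in> K" "infdist x K = dist x k"
      using infdist_attains_inf[of K x] assms compact_imp_closed by blast
    ultimately show "x \<in> (\<Union>x\<in>K. \<Union>y\<in>cball 0 e. {x + y})"
      by (intro UN_I[of k] UN_I[of "x - k"]) (auto simp: dist_norm norm_minus_commute)
  next
    fix x assume "x \<in> (\<Union>x\<in>K. \<Union>y\<in>cball 0 e. {x + y})"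
    then show "x \<in> {x. infdist x K \<le> e}"
      by (auto intro!: infdist_le2 simp: dist_norm)
  qed
  then show ?thesis
    using convex_sums[OF assms(1) convex_cball[of 0 e]] by simp
qed

text \<open>Neighbourhoods of convex bodies are convex: once the \<open>e\<close>-neighbourhood of
  one hull contains the generators of the other, it contains their hull. Hence taking hulls does not
  increase the distance.\<close>

lemma dist_hull_body_le:
  fixes A B :: "(real ^ 'n) set"
  assumes "compact A" "0 \<in> A" "compact B" "0 \<in> B"
    and AB: "\<And>x. x \<in> A \<Longrightarrow> \<exists>y\<in>B. dist x y \<le> e"
    and BA: "\<And>y. y \<in> B \<Longrightarrow> \<exists>x\<in>A. dist y x \<le> e"
  shows "dist (hull_body A) (hull_body B) \<le> e"
proof -
  have *: "convex hull C \<subseteq> {x. infdist x (convex hull D) \<le> e}"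
    if "compact D" "0 \<in> D" "\<And>x. x \<in> C \<Longrightarrow> \<exists>y\<in>D. dist x y \<le> e" for C D :: "(real ^ 'n) set"
  proof (rule hull_minimal)
    show "convex {x. infdist x (convex hull D) \<le> e}"
      using that by (intro convex_infdist_le) (auto simp: compact_convex_hull)
    show "C \<subseteq> {x. infdist x (convex hull D) \<le> e}"
      using that(3) by (blast intro: infdist_le2 hull_inc)
  qed
  show ?thesis
    unfolding dist_body0_le_iff Rep_hull_body[OF assms(1,2)] Rep_hull_body[OF assms(3,4)]
    using *[of B A] *[of A B] assms by blast
qed

lemma scale_hull_body:
  assumes "compact A" "0 \<in> A"
  shows "scale_body c (hull_body A) = hull_body ((\<lambda>x. c *\<^sub>R x) ` A)"
proof -
  have "Rep_body0 (scale_body c (hull_body A)) = convex hull ((\<lambda>x. c *\<^sub>R x) ` A)"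
    by (simp add: scale_body.rep_eq Rep_hull_body assms convex_hull_scaling)
  also have "\<dots> = Rep_body0 (hull_body ((\<lambda>x. c *\<^sub>R x) ` A))"
    using assms by (subst Rep_hull_body) (auto simp: compact_scaling image_iff intro: bexI[of _ 0])
  finally show ?thesis by (simp add: Rep_body0_inject)
qed

lemma matrix_image_hull_body:
  assumes "compact A" "0 \<in> A"
  shows "matrix_image_body B (hull_body A) = hull_body ((\<lambda>x. B *v x) ` A)"
proof -
  have "Rep_body0 (matrix_image_body B (hull_body A)) = convex hull ((\<lambda>x. B *v x) ` A)"
    by (simp add: matrix_image_body.rep_eq Rep_hull_body assms convex_hull_linear_image)
  also have "\<dots> = Rep_body0 (hull_body ((\<lambda>x. B *v x) ` A))"
    using assms
    by (subst Rep_hull_body)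
      (auto intro!: compact_continuous_image matrix_vector_mult_linear_continuous_on bexI[of _ 0] simp: image_iff)
  finally show ?thesis by (simp add: Rep_body0_inject)
qed

text \<open>The origin is inserted because a body must contain it, whatever the points are. Points
  are indexed by all of \<open>nat\<close>, so that paths of different lengths share one type
  carrying the product topology; values beyond \<open>m\<close> are ignored.\<close>

definition vertex_hull :: "nat \<Rightarrow> (nat \<Rightarrow> real ^ 'n::finite) \<Rightarrow> 'n body0" where
  "vertex_hull m x = hull_body (insert 0 (x ` {..m}))"

lemma dist_vertex_hull_le:
  assumes "\<And>j. j \<le> m \<Longrightarrow> dist (x j) (y j) \<le> e"
  shows "dist (vertex_hull m x) (vertex_hull m y) \<le> e"
proof -
  have e: "0 \<le> e" using assms[of 0] zero_le_dist order_trans by blast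
  have *: "\<exists>b\<in>insert 0 (v ` {..m}). dist a b \<le> e"
    if "a \<in> insert 0 (u ` {..m})" "\<And>j. j \<le> m \<Longrightarrow> dist (u j) (v j) \<le> e"
    for a and u v :: "nat \<Rightarrow> real ^ 'n"
    using that e by (auto intro: bexI[of _ "0::real ^ 'n"])
  show ?thesis
    unfolding vertex_hull_def
    by (intro dist_hull_body_le *) (auto simp: finite_imp_compact dist_commute intro: assms)
qed

text \<open>Only finitely many coordinates matter, so a cylinder over balls around
  \<open>x 0\<close>, ..., \<open>x m\<close> is a neighbourhood in the product topology on which
  \<open>dist_vertex_hull_le\<close> applies.\<close>

lemma continuous_vertex_hull: "continuous_on UNIV (vertex_hull m :: (nat \<Rightarrow> real ^ 'n) \<Rightarrow> 'n::finite body0)"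
proof (rule continuous_on_topological[THEN iffD2], safe)
  fix x :: "nat \<Rightarrow> real ^ 'n" and U assume U: "open U" "vertex_hull m x \<in> U"
  then obtain e where e: "e > 0" "\<And>K. dist K (vertex_hull m x) < e \<Longrightarrow> K \<in> U"
    unfolding open_dist by blast
  let ?V = "PiE UNIV (\<lambda>j. if j \<le> m then ball (x j) (e/2) else UNIV)"
  have "{j. (if j \<le> m then ball (x j) (e/2) else UNIV) \<noteq> UNIV} \<subseteq> {..m}" by (auto split: if_splits)
  then have "open ?V" by (intro open_PiE) (auto intro: finite_subset)
  moreover have "x \<in> ?V" using e by auto
  moreover have "vertex_hull m y \<in> U" if "y \<in> ?V" for y
  proof (rule e(2))
    have "dist (vertex_hull m y) (vertex_hull m x) \<le> e/2"
      using that by (intro dist_vertex_hull_le) (force simp: PiE_iff dist_commute less_imp_le split: if_splits)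
    then show "dist (vertex_hull m y) (vertex_hull m x) < e" using e by simp
  qed
  ultimately show "\<exists>A. open A \<and> x \<in> A \<and> (\<forall>y\<in>UNIV. y \<in> A \<longrightarrow> vertex_hull m y \<in> U)" by blast
qed

lemma vertex_hull_cong: "(\<And>j. j \<le> m \<Longrightarrow> x j = y j) \<Longrightarrow> vertex_hull m x = vertex_hull m y"
  unfolding vertex_hull_def by (rule arg_cong[where f = hull_body]) auto

lemma borel_measurable_vertex_hull:
  fixes x :: "nat \<Rightarrow> 'a \<Rightarrow> real ^ 'n::finite"
  assumes "\<And>j. j \<le> m \<Longrightarrow> x j \<in> borel_measurable M"
  shows "(\<lambda>\<omega>. vertex_hull m (\<lambda>j. x j \<omega>)) \<in> borel_measurable M"
proof -
  \<comment> \<open>Coordinates beyond \<open>m\<close> may fail to be measurable; setting them to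
    \<open>0\<close> leaves the hull unchanged.\<close>
  have "(\<lambda>\<omega> j. if j \<le> m then x j \<omega> else 0) \<in> borel_measurable M"
  proof (rule measurable_coordinatewise_then_product)
    show "(\<lambda>\<omega>. if j \<le> m then x j \<omega> else 0) \<in> borel_measurable M" for j
      using assms by (cases "j \<le> m") auto
  qed
  then have "(\<lambda>\<omega>. vertex_hull m (\<lambda>j. if j \<le> m then x j \<omega> else 0)) \<in> borel_measurable M"
    using borel_measurable_continuous_on[OF continuous_vertex_hull] by blast
  then show ?thesis by (rule measurable_cong[THEN iffD1, rotated]) (rule vertex_hull_cong, simp)
qed

section \<open>The positive semidefinite square root\<close>

lemma symmetric_matrix_inner:
  fixes A :: "real ^ 'n ^ 'n"
  assumes "transpose A = A"
  shows "x \<bullet> (A *v y) = (A *v x) \<bullet> y"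
  by (metis assms dot_lmul_matrix vector_transpose_matrix)

lemma continuous_on_quadratic_form: "continuous_on S (\<lambda>x. x \<bullet> (A *v x))"
  for A :: "real ^ 'n ^ 'n"
  by (intro continuous_intros matrix_vector_mult_linear_continuous_on)

text \<open>\<open>x\<close> minimises a nonnegative form, so the gradient vanishes there: moving
  from \<open>x\<close> by \<open>- t *\<^sub>R w\<close> with \<open>w = P *v x\<close> lowers the
  form by \<open>2 * t * (w \<bullet> w)\<close> to first order, and the quadratic term cannot make
  up for this when \<open>t\<close> is small.\<close>

lemma psd_matrix_null:
  fixes P :: "real ^ 'n ^ 'n"
  assumes sym: "transpose P = P" and psd: "\<And>y. 0 \<le> y \<bullet> (P *v y)" and x: "x \<bullet> (P *v x) = 0"
  shows "P *v x = 0"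
proof (rule ccontr)
  assume ne: "P *v x \<noteq> 0"
  define w where "w = P *v x"
  define c where "c = w \<bullet> (P *v w)"
  have ww: "w \<bullet> w > 0" using ne w_def by simp
  have c: "c \<ge> 0" using psd c_def by blast
  have *: "0 \<le> - 2 * t * (w \<bullet> w) + t\<^sup>2 * c" for t
  proof -
    have "0 \<le> (x - t *\<^sub>R w) \<bullet> (P *v (x - t *\<^sub>R w))" by (rule psd)
    also have "\<dots> = - 2 * t * (w \<bullet> w) + t\<^sup>2 * c"
      using x symmetric_matrix_inner[OF sym, of x w]
      by (simp add: algebra_simps matrix_vector_mult_diff_distrib matrix_vector_mult_scaleR inner_diff
          w_def[symmetric] c_def power2_eq_square inner_commute)
    finally show ?thesis .
  qed
  \<comment> \<open>Small enough that \<open>t * c < w \<bullet> w\<close>; the summand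
    \<open>1\<close> covers \<open>c = 0\<close>.\<close>
  define t where "t = (w \<bullet> w) / (c + 1)"
  have t: "t > 0" "t * c < w \<bullet> w" using ww c by (auto simp: t_def field_simps)
  have "t * (t * c) < t * (w \<bullet> w)" using t mult_less_cancel_left_pos by blast
  moreover have "0 \<le> t * (t * c - 2 * (w \<bullet> w))" using *[of t] by (simp add: power2_eq_square algebra_simps)
  then have "0 \<le> t * c - 2 * (w \<bullet> w)" using t by (simp add: zero_le_mult_iff)
  ultimately show False using t ww by (simp add: algebra_simps)
qed

text \<open>A maximiser \<open>v\<close> of the form on the unit sphere exists by compactness. With
  \<open>l\<close> the maximum, \<open>l *\<^sub>R mat 1 - A\<close> is positive semidefinite and
  its form vanishes at \<open>v\<close>, so \<open>psd_matrix_null\<close> takes the place of a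
  Lagrange multiplier.\<close>

lemma symmetric_matrix_top_eigenvector:
  fixes A :: "real ^ 'n ^ 'n"
  assumes sym: "transpose A = A"
  obtains v l where "norm v = 1" "A *v v = l *\<^sub>R v" "\<And>x. x \<bullet> (A *v x) \<le> l * (x \<bullet> x)"
proof -
  have "sphere (0::real^'n) 1 \<noteq> {}" by simp
  then obtain v where v: "v \<in> sphere 0 1" and max: "\<And>y. y \<in> sphere 0 1 \<Longrightarrow> y \<bullet> (A *v y) \<le> v \<bullet> (A *v v)"
    using continuous_attains_sup[OF compact_sphere _ continuous_on_quadratic_form[of _ A]] by blast
  define l where "l = v \<bullet> (A *v v)"
  have vv: "v \<bullet> v = 1" using v by (simp add: norm_eq_1)
  have le: "x \<bullet> (A *v x) \<le> l * (x \<bullet> x)" for x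
  proof (cases "x = 0")
    case False
    have "sgn x \<bullet> (A *v sgn x) \<le> l" unfolding l_def using False by (intro max) (simp add: norm_sgn)
    also have "sgn x \<bullet> (A *v sgn x) = (x \<bullet> (A *v x)) / (x \<bullet> x)"
      by (simp add: sgn_div_norm matrix_vector_mult_scaleR divide_simps power2_norm_eq_inner[symmetric] power2_eq_square)
    finally show ?thesis using False by (simp add: divide_le_eq)
  qed simp
  define D where "D = l *\<^sub>R mat 1 - A"
  have mlv: "D *v x = l *\<^sub>R x - A *v x" for x
    unfolding D_def matrix_vector_mult_diff_rdistrib scaleR_matrix_vector_assoc[symmetric] by simp
  have "D *v v = 0"
  proof (rule psd_matrix_null)
    have "A $ i $ j = A $ j $ i" for i j using sym by (metis transpose_def vec_lambda_beta)
    then show "transpose D = D"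
      unfolding vec_eq_iff by (auto simp: D_def transpose_def mat_def)
    show "0 \<le> y \<bullet> (D *v y)" for y unfolding mlv using le[of y] by (simp add: inner_diff)
    show "v \<bullet> (D *v v) = 0" unfolding mlv using vv by (simp add: inner_diff l_def)
  qed
  then have "A *v v = l *\<^sub>R v" unfolding mlv by simp
  then show thesis using that v le by auto
qed

text \<open>The extreme values of the form of \<open>D\<close> on the sphere are eigenvalues, found
  from the top eigenvectors of \<open>D\<close> and of \<open>- D\<close>. If both vanish, so does
  the form, and then \<open>D\<close> itself.\<close>

lemma symmetric_eq_0:
  fixes D :: "real ^ 'n ^ 'n"
  assumes sym: "transpose D = D"
    and ev: "\<And>v l. norm v = 1 \<Longrightarrow> D *v v = l *\<^sub>R v \<Longrightarrow> l = 0"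
  shows "D = 0"
proof -
  obtain v l where 1: "norm v = 1" "D *v v = l *\<^sub>R v" "\<And>x. x \<bullet> (D *v x) \<le> l * (x \<bullet> x)"
    using symmetric_matrix_top_eigenvector[OF sym] by blast
  have neg: "(- D) *v x = - (D *v x)" for x
    by (simp add: vec_eq_iff matrix_vector_mult_def sum_negf)
  have "transpose (- D) = - D" using sym by (simp add: vec_eq_iff transpose_def)
  then obtain w k where 2: "norm w = 1" "(- D) *v w = k *\<^sub>R w" "\<And>x. x \<bullet> ((- D) *v x) \<le> k * (x \<bullet> x)"
    using symmetric_matrix_top_eigenvector by blast
  have "l = 0" using ev[OF 1(1,2)] .
  moreover have "D *v w = (- k) *\<^sub>R w" using arg_cong[OF 2(2), of uminus] unfolding neg by simp
  then have "- k = 0" by (rule ev[OF 2(1)])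
  ultimately have "x \<bullet> (D *v x) = 0" for x using 1(3)[of x] 2(3)[of x] unfolding neg by simp
  then have "D *v x = 0" for x using psd_matrix_null[OF sym, of x] by simp
  then show ?thesis by (simp add: matrix_eq)
qed

lemma psd_sqrt_unique:
  fixes B C :: "real ^ 'n ^ 'n"
  assumes B: "transpose B = B" "\<And>x. 0 \<le> x \<bullet> (B *v x)"
    and C: "transpose C = C" "\<And>x. 0 \<le> x \<bullet> (C *v x)"
    and eq: "B ** B = C ** C"
  shows "B = C"
proof -
  \<comment> \<open>An eigenvector \<open>v\<close> of \<open>B - C\<close> with eigenvalue \<open>l\<close> gives
    \<open>0 = v \<bullet> (B\<^sup>2 - C\<^sup>2) v = l (v \<bullet> B v + v \<bullet> C v)\<close>; no commutation of \<open>B\<close> and \<open>C\<close> is needed.\<close>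
  have "B - C = 0"
  proof (rule symmetric_eq_0)
    show "transpose (B - C) = B - C" using B C by (simp add: vec_eq_iff transpose_def)
    fix v l assume v: "norm v = 1" "(B - C) *v v = l *\<^sub>R v"
    then have Bv: "B *v v = C *v v + l *\<^sub>R v" by (simp add: matrix_vector_mult_diff_rdistrib algebra_simps)
    have vv: "v \<bullet> v = 1" using v by (simp add: norm_eq_1)
    have "(B *v v) \<bullet> (B *v v) = (C *v v) \<bullet> (C *v v)"
      using symmetric_matrix_inner[OF B(1), of v "B *v v"] symmetric_matrix_inner[OF C(1), of v "C *v v"]
      by (simp add: matrix_vector_mul_assoc eq)
    then have "l = 0 \<or> 2 * (v \<bullet> (C *v v)) + l = 0"
      unfolding Bv using vv by (simp add: inner_add_left inner_add_right inner_commute distrib_left[symmetric])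
    moreover have "v \<bullet> (B *v v) = v \<bullet> (C *v v) + l"
      unfolding Bv using vv by (simp add: inner_add_right)
    ultimately show "l = 0" using B(2)[of v] C(2)[of v] by linarith
  qed
  then show ?thesis by simp
qed

lemma psd_sqrt_exists:
  fixes A :: "real ^ 'n ^ 'n"
  assumes "transpose A = A" "\<And>x. 0 \<le> x \<bullet> (A *v x)"
  shows "\<exists>B. transpose B = B \<and> (\<forall>x. 0 \<le> x \<bullet> (B *v x)) \<and> B ** B = A"
  using assms
proof (induction "dim (range (\<lambda>x. A *v x))" arbitrary: A rule: less_induct)
  case less
  show ?case
  proof (cases "A = 0")
    case True
    then show ?thesis by (intro exI[of _ 0]) (simp add: vec_eq_iff transpose_def matrix_matrix_mult_def)
  next
    case False
    obtain v l where v: "norm v = 1" "A *v v = l *\<^sub>R v" and max: "\<And>x. x \<bullet> (A *v x) \<le> l * (x \<bullet> x)"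
      using symmetric_matrix_top_eigenvector[OF less.prems(1)] by blast
    have vv: "v \<bullet> v = 1" using v by (simp add: norm_eq_1)
    have l: "l > 0"
    proof (rule ccontr)
      assume "\<not> l > 0"
      then have "x \<bullet> (A *v x) = 0" for x
        using max[of x] less.prems(2)[of x] by (smt (verit) inner_ge_zero mult_nonneg_nonneg mult_minus_left)
      then have "A *v x = 0" for x using psd_matrix_null[OF less.prems] by blast
      then show False using False by (simp add: matrix_eq)
    qed
    \<comment> \<open>Splitting off the top eigenvector lowers the rank.\<close>
    define W :: "real ^ 'n ^ 'n" where "W = (\<chi> i j. v $ i * v $ j)"
    have W: "W *v x = (v \<bullet> x) *\<^sub>R v" for x
      by (simp add: W_def vec_eq_iff matrix_vector_mult_def inner_vec_def sum_distrib_left mult_ac)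
    have WT: "transpose W = W" by (simp add: W_def vec_eq_iff transpose_def mult.commute)
    define A' where "A' = A - l *\<^sub>R W"
    have sW: "(c *\<^sub>R W) *v x = (c * (v \<bullet> x)) *\<^sub>R v" for c x
      unfolding scaleR_matrix_vector_assoc[symmetric] W by simp
    have A': "A' *v x = A *v x - (l * (v \<bullet> x)) *\<^sub>R v" for x
      by (simp add: A'_def matrix_vector_mult_diff_rdistrib sW)
    have sym': "transpose A' = A'" using less.prems(1) WT by (simp add: A'_def vec_eq_iff transpose_def)
    have A'v: "A' *v v = 0" using v vv by (simp add: A')
    \<comment> \<open>Since \<open>A'\<close> is symmetric and kills \<open>v\<close>, the component
      along \<open>v\<close> drops out; on the orthogonal complement of \<open>v\<close> the forms
      of \<open>A'\<close> and \<open>A\<close> agree.\<close>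
    have psd': "0 \<le> x \<bullet> (A' *v x)" for x
    proof -
      define y where "y = x - (v \<bullet> x) *\<^sub>R v"
      have "x \<bullet> (A' *v x) = y \<bullet> (A' *v y)"
        using A'v symmetric_matrix_inner[OF sym', of v x]
        by (simp add: y_def matrix_vector_mult_diff_distrib matrix_vector_mult_scaleR inner_diff)
      also have "v \<bullet> y = 0" using vv by (simp add: y_def inner_diff)
      then have "y \<bullet> (A' *v y) = y \<bullet> (A *v y)" by (simp add: A')
      finally show ?thesis using less.prems(2) by simp
    qed
    have vr: "v \<in> range (\<lambda>x. A *v x)"
      using v l by (intro image_eqI[of _ _ "(1 / l) *\<^sub>R v"]) (simp_all add: matrix_vector_mult_scaleR)
    have lin: "subspace (range (\<lambda>x. M *v x))" for M :: "real ^ 'n ^ 'n"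
      by (intro linear_subspace_image subspace_UNIV matrix_vector_mul_linear)
    have sub: "range (\<lambda>x. A' *v x) \<subseteq> range (\<lambda>x. A *v x)"
    proof safe
      fix x
      have "A' *v x = A *v (x - ((v \<bullet> x)) *\<^sub>R v)"
        by (simp add: A' matrix_vector_mult_diff_distrib matrix_vector_mult_scaleR v mult.commute)
      then show "A' *v x \<in> range (\<lambda>x. A *v x)" by blast
    qed
    \<comment> \<open>The range of the symmetric \<open>A'\<close> is orthogonal to its kernel,
      which contains \<open>v\<close>; the range of \<open>A\<close> contains \<open>v\<close>, so
      the inclusion of ranges is strict.\<close>
    have "v \<notin> range (\<lambda>x. A' *v x)"
    proof
      assume "v \<in> range (\<lambda>x. A' *v x)"
      then obtain x where "v = A' *v x" by blast
      then have "v \<bullet> v = 0" using symmetric_matrix_inner[OF sym', of v x] A'v by simp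
      then show False using vv by simp
    qed
    then have "range (\<lambda>x. A' *v x) \<subset> range (\<lambda>x. A *v x)" using sub vr by blast
    then have "dim (range (\<lambda>x. A' *v x)) < dim (range (\<lambda>x. A *v x))"
      by (intro dim_psubset) (simp add: span_eq_iff[THEN iffD2, OF lin])
    then obtain B where B: "transpose B = B" "\<And>x. 0 \<le> x \<bullet> (B *v x)" "B ** B = A'"
      using less.hyps[OF _ sym' psd'] by blast
    \<comment> \<open>From \<open>B ** B = A'\<close> and \<open>A' *v v = 0\<close>. With
      \<open>B *v v = 0\<close> all cross terms vanish when \<open>B + sqrt l *\<^sub>R W\<close> is
      squared.\<close>
    have "(B *v v) \<bullet> (B *v v) = 0"
      using symmetric_matrix_inner[OF B(1), of v "B *v v"] A'v by (simp add: matrix_vector_mul_assoc B)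
    then have Bv: "B *v v = 0" by simp
    show ?thesis
    proof (intro exI[of _ "B + sqrt l *\<^sub>R W"] conjI allI)
      show "transpose (B + sqrt l *\<^sub>R W) = B + sqrt l *\<^sub>R W"
        using B(1) WT by (simp add: vec_eq_iff transpose_def)
      have BW: "(B + sqrt l *\<^sub>R W) *v x = B *v x + (sqrt l * (v \<bullet> x)) *\<^sub>R v" for x
        by (simp add: matrix_vector_mult_add_rdistrib sW)
      show "0 \<le> x \<bullet> ((B + sqrt l *\<^sub>R W) *v x)" for x
        unfolding BW using B(2)[of x] l by (simp add: inner_add inner_commute mult.assoc)
      have "(B + sqrt l *\<^sub>R W) *v ((B + sqrt l *\<^sub>R W) *v x) = A *v x" for x
      proof -
        have "v \<bullet> (B *v x) = 0" using symmetric_matrix_inner[OF B(1), of v x] Bv by simp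
        then have "(B + sqrt l *\<^sub>R W) *v ((B + sqrt l *\<^sub>R W) *v x)
            = B *v (B *v x) + (l * (v \<bullet> x)) *\<^sub>R v"
          unfolding BW using Bv vv l
          by (simp add: matrix_vector_right_distrib matrix_vector_mult_scaleR inner_add mult.assoc[symmetric])
        also have "\<dots> = A *v x" by (simp add: matrix_vector_mul_assoc B A')
        finally show ?thesis .
      qed
      then show "(B + sqrt l *\<^sub>R W) ** (B + sqrt l *\<^sub>R W) = A"
        by (simp add: matrix_eq matrix_vector_mul_assoc)
    qed
  qed
qed

lemma psd_sqrt:
  fixes A :: "real ^ 'n ^ 'n"
  assumes "transpose A = A" "\<And>x. 0 \<le> x \<bullet> (A *v x)"
  shows "transpose (psd_sqrt A) = psd_sqrt A" and "psd_sqrt A ** psd_sqrt A = A"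
proof -
  have "\<exists>!B. transpose B = B \<and> (\<forall>x. 0 \<le> x \<bullet> (B *v x)) \<and> B ** B = A"
    using psd_sqrt_exists[OF assms] psd_sqrt_unique by metis
  from theI'[OF this]
  show "transpose (psd_sqrt A) = psd_sqrt A" "psd_sqrt A ** psd_sqrt A = A"
    unfolding psd_sqrt_def by blast+
qed

section \<open>Smooth test functions\<close>

text \<open>A quadratic form kept as a double sum with coefficients, so that integrating it against
  a law gives a linear combination of the mixed second moments.\<close>

definition quadratic_on :: "(real ^ 'n \<Rightarrow> real) \<Rightarrow> bool" where
  "quadratic_on p \<longleftrightarrow> (\<exists>q. \<forall>h. p h = (\<Sum>i\<in>UNIV. \<Sum>j\<in>UNIV. q i j * (h $ i * h $ j)))"

text \<open>Expansion at \<open>0\<close> only, and with the cubic error required for \<open>norm h \<le> 1\<close> only: for longer \<open>h\<close>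
  it follows from the other bounds, and this form is stable under products.\<close>
definition taylor2 :: "real \<Rightarrow> (real ^ 'n \<Rightarrow> real) \<Rightarrow> bool" where
  "taylor2 C G \<longleftrightarrow> (\<forall>h. \<bar>G h\<bar> \<le> C) \<and>
     (\<exists>a p. quadratic_on p \<and> norm a \<le> C \<and> (\<forall>h. \<bar>p h\<bar> \<le> C * (norm h)\<^sup>2) \<and>
       (\<forall>h. norm h \<le> 1 \<longrightarrow> \<bar>G h - (G 0 + a \<bullet> h + p h)\<bar> \<le> C * norm h ^ 3))"

lemma quadratic_on_add: "quadratic_on p \<Longrightarrow> quadratic_on q \<Longrightarrow> quadratic_on (\<lambda>h. p h + q h)"
proof -
  assume "quadratic_on p" "quadratic_on q"
  then obtain r s where "p = (\<lambda>h. \<Sum>i\<in>UNIV. \<Sum>j\<in>UNIV. r i j * (h $ i * h $ j))"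
    "q = (\<lambda>h. \<Sum>i\<in>UNIV. \<Sum>j\<in>UNIV. s i j * (h $ i * h $ j))"
    unfolding quadratic_on_def fun_eq_iff by blast
  then show ?thesis unfolding quadratic_on_def
    by (intro exI[of _ "\<lambda>i j. r i j + s i j"]) (simp add: sum.distrib distrib_right)
qed

lemma quadratic_on_cmult: "quadratic_on p \<Longrightarrow> quadratic_on (\<lambda>h. c * p h)"
proof -
  assume "quadratic_on p"
  then obtain r where "p = (\<lambda>h. \<Sum>i\<in>UNIV. \<Sum>j\<in>UNIV. r i j * (h $ i * h $ j))"
    unfolding quadratic_on_def fun_eq_iff by blast
  then show ?thesis unfolding quadratic_on_def
    by (intro exI[of _ "\<lambda>i j. c * r i j"]) (simp add: sum_distrib_left mult_ac)
qed

lemma quadratic_on_inner_mult: "quadratic_on (\<lambda>h. (a \<bullet> h) * (b \<bullet> h))"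
  unfolding quadratic_on_def
  by (intro exI[of _ "\<lambda>i j. a $ i * b $ j"]) (simp add: inner_vec_def sum_product mult_ac)

lemma taylor2_nonneg: "taylor2 C G \<Longrightarrow> 0 \<le> C"
  unfolding taylor2_def using abs_ge_zero order_trans by blast

lemma taylor2_const: "taylor2 \<bar>c\<bar> (\<lambda>_. c)"
  unfolding taylor2_def quadratic_on_def
  by (auto intro!: exI[of _ 0] exI[of _ "\<lambda>_ _. 0"] exI[of _ "\<lambda>_. 0"])

lemma taylor2_add:
  fixes F G :: "real ^ 'n \<Rightarrow> real"
  assumes "taylor2 C F" "taylor2 D G"
  shows "taylor2 (C + D) (\<lambda>h. F h + G h)"
proof -
  obtain a p where F: "\<And>h. \<bar>F h\<bar> \<le> C" "quadratic_on p" "norm a \<le> C" "\<And>h. \<bar>p h\<bar> \<le> C * (norm h)\<^sup>2"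
    "\<And>h. norm h \<le> 1 \<Longrightarrow> \<bar>F h - (F 0 + a \<bullet> h + p h)\<bar> \<le> C * norm h ^ 3"
    using assms(1) unfolding taylor2_def by blast
  obtain b q where G: "\<And>h. \<bar>G h\<bar> \<le> D" "quadratic_on q" "norm b \<le> D" "\<And>h. \<bar>q h\<bar> \<le> D * (norm h)\<^sup>2"
    "\<And>h. norm h \<le> 1 \<Longrightarrow> \<bar>G h - (G 0 + b \<bullet> h + q h)\<bar> \<le> D * norm h ^ 3"
    using assms(2) unfolding taylor2_def by blast
  show ?thesis unfolding taylor2_def
  proof (intro conjI exI[of _ "a + b"] exI[of _ "\<lambda>h. p h + q h"] allI impI)
    fix h :: "real ^ 'n"
    show "\<bar>F h + G h\<bar> \<le> C + D" using F(1)[of h] G(1)[of h] by linarith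
    show "\<bar>p h + q h\<bar> \<le> (C + D) * (norm h)\<^sup>2"
      using F(4)[of h] G(4)[of h] by (simp add: distrib_right)
    show "\<bar>F h + G h - (F 0 + G 0 + (a + b) \<bullet> h + (p h + q h))\<bar> \<le> (C + D) * norm h ^ 3" if "norm h \<le> 1"
      using F(5)[OF that] G(5)[OF that] by (simp add: inner_add_left distrib_right abs_le_iff)
  qed (use F G in \<open>auto intro: quadratic_on_add norm_triangle_le\<close>)
qed

text \<open>The constant \<open>7\<close> counts the error terms of the identity \<open>id\<close>,
  each at most \<open>C * D * norm h ^ 3\<close> on the unit ball, where higher powers of
  \<open>norm h\<close> reduce to the cube. The linear and quadratic parts get by with the factors
  \<open>2\<close> and \<open>3\<close>.\<close>

lemma taylor2_mult:
  fixes F G :: "real ^ 'n \<Rightarrow> real"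
  assumes "taylor2 C F" "taylor2 D G"
  shows "taylor2 (7 * (C * D)) (\<lambda>h. F h * G h)"
proof -
  obtain a p where F: "\<And>h. \<bar>F h\<bar> \<le> C" "quadratic_on p" "norm a \<le> C" "\<And>h. \<bar>p h\<bar> \<le> C * (norm h)\<^sup>2"
    "\<And>h. norm h \<le> 1 \<Longrightarrow> \<bar>F h - (F 0 + a \<bullet> h + p h)\<bar> \<le> C * norm h ^ 3"
    using assms(1) unfolding taylor2_def by blast
  obtain b q where G: "\<And>h. \<bar>G h\<bar> \<le> D" "quadratic_on q" "norm b \<le> D" "\<And>h. \<bar>q h\<bar> \<le> D * (norm h)\<^sup>2"
    "\<And>h. norm h \<le> 1 \<Longrightarrow> \<bar>G h - (G 0 + b \<bullet> h + q h)\<bar> \<le> D * norm h ^ 3"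
    using assms(2) unfolding taylor2_def by blast
  have C: "0 \<le> C" and D: "0 \<le> D" using assms by (auto dest: taylor2_nonneg)
  note CD = mult_nonneg_nonneg[OF C D]
  \<comment> \<open>With \<open>u\<close>, \<open>v\<close> the linear and \<open>r\<close>,
    \<open>s\<close> the quadratic parts, the bracket on the left keeps all products of order at
    most two; the right side is the rest.\<close>
  have id: "f * g - (f0 * g0 + (f0 * v + g0 * u) + (f0 * s + g0 * r + u * v)) =
      f * (g - (g0 + v + s)) + (f - (f0 + u + r)) * g0 + (f - (f0 + u + r)) * v + (f - (f0 + u + r)) * s
      + u * s + r * v + r * s" for f g f0 g0 u v r s :: real
    by algebra
  have a: "\<bar>a \<bullet> h\<bar> \<le> C * norm h" for h
    using Cauchy_Schwarz_ineq2[of a h] F(3) by (meson mult_right_mono norm_ge_zero order_trans)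
  have b: "\<bar>b \<bullet> h\<bar> \<le> D * norm h" for h
    using Cauchy_Schwarz_ineq2[of b h] G(3) by (meson mult_right_mono norm_ge_zero order_trans)
  have prod: "\<bar>x * y\<bar> \<le> (C * D) * t" if "\<bar>x\<bar> \<le> C * u" "\<bar>y\<bar> \<le> D * v" "0 \<le> u" "u * v = t" for x y u v t
  proof -
    have "\<bar>x * y\<bar> \<le> (C * u) * (D * v)"
      unfolding abs_mult using that C by (intro mult_mono) auto
    then show ?thesis using that(4) by (simp add: mult_ac)
  qed
  show ?thesis unfolding taylor2_def
  proof (intro conjI exI[of _ "F 0 *\<^sub>R b + G 0 *\<^sub>R a"]
      exI[of _ "\<lambda>h. (F 0 * q h + G 0 * p h) + (a \<bullet> h) * (b \<bullet> h)"] allI impI)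
    fix h :: "real ^ 'n"
    let ?n = "norm h"
    show "\<bar>F h * G h\<bar> \<le> 7 * (C * D)"
      using prod[of "F h" 1 "G h" 1 1] F(1)[of h] G(1)[of h] CD by simp
    have "\<bar>F 0 * q h\<bar> \<le> (C * D) * ?n\<^sup>2" "\<bar>p h * G 0\<bar> \<le> (C * D) * ?n\<^sup>2" "\<bar>(a \<bullet> h) * (b \<bullet> h)\<bar> \<le> (C * D) * ?n\<^sup>2"
      using prod[of "F 0" 1 "q h" "?n\<^sup>2"] prod[of "p h" "?n\<^sup>2" "G 0" 1] prod[of "a \<bullet> h" ?n "b \<bullet> h" ?n]
        F(1)[of 0] G(1)[of 0] F(4)[of h] G(4)[of h] a[of h] b[of h]
      by (auto simp: power2_eq_square)
    then have "\<bar>F 0 * q h + G 0 * p h + (a \<bullet> h) * (b \<bullet> h)\<bar> \<le> 3 * ((C * D) * ?n\<^sup>2)"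
      by (simp add: mult.commute)
    also have "\<dots> \<le> 7 * ((C * D) * ?n\<^sup>2)" using mult_nonneg_nonneg[OF CD zero_le_power2[of ?n]] by linarith
    finally show "\<bar>F 0 * q h + G 0 * p h + (a \<bullet> h) * (b \<bullet> h)\<bar> \<le> 7 * (C * D) * ?n\<^sup>2" by (simp add: mult_ac)
    assume h: "?n \<le> 1"
    define R where "R = F h - (F 0 + a \<bullet> h + p h)"
    define S where "S = G h - (G 0 + b \<bullet> h + q h)"
    have R: "\<bar>R\<bar> \<le> C * ?n ^ 3" and S: "\<bar>S\<bar> \<le> D * ?n ^ 3" unfolding R_def S_def using F(5) G(5) h by auto
    have n: "?n ^ 4 \<le> ?n ^ 3" "?n ^ 5 \<le> ?n ^ 3" "?n\<^sup>2 \<le> 1" using h by (auto intro!: power_decreasing power_le_one)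
    have g1: "\<bar>b \<bullet> h\<bar> \<le> D * 1" using b[of h] h D by (meson mult_left_mono order_trans)
    have g2: "\<bar>q h\<bar> \<le> D * 1" using G(4)[of h] n(3) D by (meson mult_left_mono order_trans)
    have "\<bar>F h * S\<bar> \<le> (C * D) * ?n ^ 3" using prod[of "F h" 1 S "?n ^ 3"] F(1) S by simp
    moreover have "\<bar>R * G 0\<bar> \<le> (C * D) * ?n ^ 3" using prod[of R "?n ^ 3" "G 0" 1] G(1) R by simp
    moreover have "\<bar>R * (b \<bullet> h)\<bar> \<le> (C * D) * ?n ^ 3" using prod[of R "?n ^ 3" "b \<bullet> h" 1] g1 R by simp
    moreover have "\<bar>R * q h\<bar> \<le> (C * D) * ?n ^ 3" using prod[of R "?n ^ 3" "q h" 1] g2 R by simp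
    moreover have "\<bar>(a \<bullet> h) * q h\<bar> \<le> (C * D) * ?n ^ 3"
      using prod[of "a \<bullet> h" ?n "q h" "?n\<^sup>2"] a G(4) by (simp add: power3_eq_cube power2_eq_square)
    moreover have "\<bar>p h * (b \<bullet> h)\<bar> \<le> (C * D) * ?n ^ 3"
      using prod[of "p h" "?n\<^sup>2" "b \<bullet> h" ?n] b F(4) by (simp add: power3_eq_cube power2_eq_square)
    moreover have "\<bar>p h * q h\<bar> \<le> (C * D) * ?n ^ 3"
    proof -
      have "\<bar>p h * q h\<bar> \<le> (C * D) * ?n ^ 4"
        using prod[of "p h" "?n\<^sup>2" "q h" "?n\<^sup>2"] F(4) G(4) by (simp flip: power_add)
      then show ?thesis using n(1) CD by (meson mult_left_mono order_trans)
    qed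
    moreover have "F h * G h - (F 0 * G 0 + (F 0 *\<^sub>R b + G 0 *\<^sub>R a) \<bullet> h + (F 0 * q h + G 0 * p h + (a \<bullet> h) * (b \<bullet> h)))
       = F h * S + R * G 0 + R * (b \<bullet> h) + R * q h + (a \<bullet> h) * q h + p h * (b \<bullet> h) + p h * q h"
      unfolding R_def S_def inner_add_left inner_scaleR_left by (rule id)
    moreover have "\<bar>e1 + e2 + e3 + e4 + e5 + e6 + e7\<bar> \<le> 7 * t"
      if "\<bar>e1\<bar> \<le> t" "\<bar>e2\<bar> \<le> t" "\<bar>e3\<bar> \<le> t" "\<bar>e4\<bar> \<le> t" "\<bar>e5\<bar> \<le> t" "\<bar>e6\<bar> \<le> t" "\<bar>e7\<bar> \<le> t"
      for e1 e2 e3 e4 e5 e6 e7 t :: real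
      using that unfolding abs_le_iff by linarith
    ultimately show "\<bar>F h * G h - (F 0 * G 0 + (F 0 *\<^sub>R b + G 0 *\<^sub>R a) \<bullet> h + (F 0 * q h + G 0 * p h + (a \<bullet> h) * (b \<bullet> h)))\<bar>
       \<le> 7 * (C * D) * ?n ^ 3"
      unfolding mult.assoc[of 7] by presburger
  next
    show "norm (F 0 *\<^sub>R b + G 0 *\<^sub>R a) \<le> 7 * (C * D)"
    proof -
      have "norm (F 0 *\<^sub>R b) \<le> C * D" "norm (G 0 *\<^sub>R a) \<le> D * C"
        using F(1,3) G(1,3) C D by (auto intro!: mult_mono)
      then show ?thesis using norm_triangle_ineq[of "F 0 *\<^sub>R b" "G 0 *\<^sub>R a"] CD by (simp add: mult.commute)
    qed
  qed (use F G in \<open>auto intro!: quadratic_on_add quadratic_on_cmult quadratic_on_inner_mult\<close>)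
qed

text \<open>The derivatives of tanh are polynomials in tanh, so the remainder is bounded
  independently of \<open>z\<close>: with \<open>w = (tanh (z + t))\<^sup>2\<close> in the unit
  interval, the coefficient of the cube is, up to sign, \<open>(1 - w) * (1 - 3 * w) / 3\<close>, at
  most \<open>2 / 3\<close> in modulus.\<close>

lemma tanh_taylor:
  fixes z u :: real
  shows "\<bar>tanh (z + u) - (tanh z + (1 - (tanh z)\<^sup>2) * u - tanh z * (1 - (tanh z)\<^sup>2) * u\<^sup>2)\<bar> \<le> \<bar>u\<bar> ^ 3"
proof -
  \<comment> \<open>The derivatives in \<open>u\<close> of \<open>tanh (z + u)\<close> up to the
    third; Maclaurin's formula is used at this order, so larger indices are never consulted.\<close>
  define T where "T = (\<lambda>n::nat. if n = 0 then (\<lambda>u. tanh (z + u)) else if n = 1 then (\<lambda>u. 1 - (tanh (z + u))\<^sup>2)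
     else if n = 2 then (\<lambda>u. - 2 * tanh (z + u) * (1 - (tanh (z + u))\<^sup>2))
     else (\<lambda>u. - 2 * (1 - (tanh (z + u))\<^sup>2) * (1 - 3 * (tanh (z + u))\<^sup>2)))"
  have D: "DERIV (T m) t :> T (Suc m) t" if "m < 3" for m t
  proof -
    have "m = 0 \<or> m = 1 \<or> m = 2" using that by auto
    then show ?thesis
      unfolding T_def
      by (elim disjE; simp; auto intro!: derivative_eq_intros simp: algebra_simps power2_eq_square)
  qed
  have "\<exists>t. \<bar>t\<bar> \<le> \<bar>u\<bar> \<and> T 0 u = (\<Sum>m<3. T m 0 / fact m * u ^ m) + T 3 t / fact 3 * u ^ 3"
  proof -
    consider "u = 0" | "u < 0" | "u > 0" by linarith
    then show ?thesis
    proof cases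
      case 1
      then show ?thesis by (auto simp: numeral_3_eq_3)
    next
      case 2
      then show ?thesis using Maclaurin_minus[of u 3 T "T 0"] D by force
    next
      case 3
      then show ?thesis using Maclaurin[of u 3 T "T 0"] D by force
    qed
  qed
  then obtain t where t: "T 0 u = (\<Sum>m<3. T m 0 / fact m * u ^ m) + T 3 t / fact 3 * u ^ 3" by blast
  have sq: "0 \<le> (tanh x)\<^sup>2" "(tanh x)\<^sup>2 \<le> 1" for x :: real
    using tanh_real_bounds[of x] by (auto simp: abs_square_le_1)
  define w where "w = (tanh (z + t))\<^sup>2"
  have w: "0 \<le> w" "w \<le> 1" unfolding w_def using sq by auto
  have "\<bar>(1 - w) * (1 - 3 * w)\<bar> \<le> 1 * 2" unfolding abs_mult using w by (intro mult_mono) auto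
  moreover have "T 3 t / fact 3 = - ((1 - w) * (1 - 3 * w)) / 3"
    unfolding T_def w_def[symmetric] by (simp add: fact_numeral field_simps w_def)
  ultimately have "\<bar>T 3 t / fact 3\<bar> \<le> 1" by simp
  then have "\<bar>T 3 t / fact 3 * u ^ 3\<bar> \<le> 1 * \<bar>u\<bar> ^ 3" unfolding abs_mult power_abs by (intro mult_right_mono) auto
  moreover define r where "r = T 3 t / fact 3 * u ^ 3"
  moreover have "tanh (z + u) - (tanh z + (1 - (tanh z)\<^sup>2) * u - tanh z * (1 - (tanh z)\<^sup>2) * u\<^sup>2) = r"
  proof -
    have "T 0 u = (T 0 0 + T 1 0 * u + T 2 0 / 2 * u\<^sup>2) + r"
      using t unfolding r_def[symmetric] by (simp add: lessThan_Suc eval_nat_numeral)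
    then show ?thesis by (simp add: T_def)
  qed
  ultimately show ?thesis by simp
qed

text \<open>The slope \<open>c = 0\<close> is included for positions that an increment leaves in
  place. The assumption \<open>1 \<le> K\<close> lets \<open>K ^ 3\<close> dominate the bounds of
  all orders.\<close>

lemma taylor2_tanh:
  fixes i :: "'n::finite"
  assumes K: "\<bar>c\<bar> \<le> K" "1 \<le> K"
  shows "taylor2 (K ^ 3) (\<lambda>h::real ^ 'n. tanh (z + c * h $ i))"
proof -
  have sq: "0 \<le> (tanh z)\<^sup>2" "(tanh z)\<^sup>2 \<le> 1" "\<bar>tanh z\<bar> \<le> 1" "\<bar>1 - (tanh z)\<^sup>2\<bar> \<le> 1"
    using tanh_real_bounds[of z] by (auto simp: abs_square_le_1)
  have K1: "1 \<le> K ^ 3" "K \<le> K ^ 3" "K\<^sup>2 \<le> K ^ 3"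
    using K power_increasing[of 1 3 K] power_increasing[of 2 3 K] by (auto simp: one_le_power)
  show ?thesis unfolding taylor2_def
  proof (intro conjI exI[of _ "(c * (1 - (tanh z)\<^sup>2)) *\<^sub>R axis i 1"]
      exI[of _ "\<lambda>h. (- tanh z * (1 - (tanh z)\<^sup>2) * c\<^sup>2) * ((axis i 1 \<bullet> h) * (axis i 1 \<bullet> h))"] allI impI)
    fix h :: "real ^ 'n"
    show "\<bar>tanh (z + c * h $ i)\<bar> \<le> K ^ 3" using tanh_real_bounds[of "z + c * h $ i"] K1 by auto
    have hi: "\<bar>h $ i\<bar> \<le> norm h" by (rule component_le_norm_cart)
    have "\<bar>(- tanh z * (1 - (tanh z)\<^sup>2) * c\<^sup>2)\<bar> \<le> (1 * 1) * K\<^sup>2"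
      unfolding abs_mult abs_minus using sq K by (intro mult_mono) (auto simp: abs_le_square_iff[symmetric])
    then have "\<bar>(- tanh z * (1 - (tanh z)\<^sup>2) * c\<^sup>2)\<bar> * \<bar>(h $ i)\<^sup>2\<bar> \<le> K ^ 3 * (norm h)\<^sup>2"
      using K1 K hi by (intro mult_mono) (auto simp: abs_le_square_iff[symmetric])
    then show "\<bar>(- tanh z * (1 - (tanh z)\<^sup>2) * c\<^sup>2) * ((axis i 1 \<bullet> h) * (axis i 1 \<bullet> h))\<bar> \<le> K ^ 3 * (norm h)\<^sup>2"
      by (simp add: inner_axis' abs_mult power2_eq_square)
    have "\<bar>c * h $ i\<bar> ^ 3 \<le> (K * norm h) ^ 3"
      unfolding abs_mult using hi K by (intro power_mono mult_mono) auto
    then show "\<bar>tanh (z + c * h $ i) - (tanh (z + c * 0 $ i) + (c * (1 - (tanh z)\<^sup>2)) *\<^sub>R axis i 1 \<bullet> h +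
       (- tanh z * (1 - (tanh z)\<^sup>2) * c\<^sup>2) * ((axis i 1 \<bullet> h) * (axis i 1 \<bullet> h)))\<bar> \<le> K ^ 3 * norm h ^ 3"
      using tanh_taylor[of z "c * h $ i"]
      by (simp add: inner_axis' power_mult_distrib power2_eq_square algebra_simps)
  next
    have "\<bar>c * (1 - (tanh z)\<^sup>2)\<bar> \<le> K * 1" unfolding abs_mult using sq K by (intro mult_mono) auto
    then show "norm ((c * (1 - (tanh z)\<^sup>2)) *\<^sub>R axis i 1 :: real ^ 'n) \<le> K ^ 3" using K1 by simp
  qed (intro quadratic_on_cmult quadratic_on_inner_mult)
qed

text \<open>A path is the sequence of its positions at finitely many times, and \<open>J\<close> is the set of those
  positions which contain a given increment: replacing the increment moves all of them by \<open>h\<close>.\<close>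
definition smooth_test :: "((nat \<Rightarrow> real ^ 'n) \<Rightarrow> real) \<Rightarrow> bool" where
  "smooth_test F \<longleftrightarrow> continuous_on UNIV F \<and>
     (\<exists>C. \<forall>x J. taylor2 C (\<lambda>h. F (\<lambda>j. x j + (if j \<in> J then h else 0))))"

lemma smooth_test_const: "smooth_test (\<lambda>_. c)"
  unfolding smooth_test_def using taylor2_const by auto

lemma smooth_test_add:
  assumes "smooth_test F" "smooth_test G"
  shows "smooth_test (\<lambda>x. F x + G x)"
proof -
  obtain C D where "continuous_on UNIV F" "\<And>x J. taylor2 C (\<lambda>h. F (\<lambda>j. x j + (if j \<in> J then h else 0)))"
    "continuous_on UNIV G" "\<And>x J. taylor2 D (\<lambda>h. G (\<lambda>j. x j + (if j \<in> J then h else 0)))"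
    using assms unfolding smooth_test_def by blast
  then show ?thesis
    unfolding smooth_test_def by (intro conjI exI[of _ "C + D"] allI taylor2_add continuous_on_add)
qed

lemma smooth_test_mult:
  assumes "smooth_test F" "smooth_test G"
  shows "smooth_test (\<lambda>x. F x * G x)"
proof -
  obtain C D where "continuous_on UNIV F" "\<And>x J. taylor2 C (\<lambda>h. F (\<lambda>j. x j + (if j \<in> J then h else 0)))"
    "continuous_on UNIV G" "\<And>x J. taylor2 D (\<lambda>h. G (\<lambda>j. x j + (if j \<in> J then h else 0)))"
    using assms unfolding smooth_test_def by blast
  then show ?thesis
    unfolding smooth_test_def by (intro conjI exI[of _ "7 * (C * D)"] allI taylor2_mult continuous_on_mult)
qed

lemma smooth_test_sum: "(\<And>i. i \<in> I \<Longrightarrow> smooth_test (F i)) \<Longrightarrow> smooth_test (\<lambda>x. \<Sum>i\<in>I. F i x)"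
  by (induction I rule: infinite_finite_induct) (auto intro: smooth_test_add smooth_test_const)

lemma smooth_test_power: "smooth_test F \<Longrightarrow> smooth_test (\<lambda>x. F x ^ k)"
  by (induction k) (auto intro: smooth_test_mult smooth_test_const)

lemma smooth_test_tanh: "smooth_test (\<lambda>x :: nat \<Rightarrow> real ^ 'n. tanh (c * x j $ i))"
  unfolding smooth_test_def
proof (intro conjI exI allI)
  show "continuous_on UNIV (\<lambda>x :: nat \<Rightarrow> real ^ 'n. tanh (c * x j $ i))"
    by (intro continuous_intros bounded_linear.continuous_on[OF bounded_linear_vec_nth]
        continuous_on_product_coordinates) auto
  fix x :: "nat \<Rightarrow> real ^ 'n" and J
  \<comment> \<open>A position outside \<open>J\<close> has slope \<open>0\<close>. The bound is the
    same for all \<open>x\<close> and \<open>J\<close>; adding \<open>1\<close> ensures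
    \<open>1 \<le> K\<close>.\<close>
  have "taylor2 ((\<bar>c\<bar> + 1) ^ 3) (\<lambda>h::real ^ 'n. tanh (c * x j $ i + (if j \<in> J then c else 0) * h $ i))"
    by (rule taylor2_tanh) auto
  moreover have "(\<lambda>h::real ^ 'n. tanh (c * x j $ i + (if j \<in> J then c else 0) * h $ i))
      = (\<lambda>h. tanh (c * (x j + (if j \<in> J then h else 0)) $ i))"
    by (auto simp: fun_eq_iff distrib_left)
  ultimately show "taylor2 ((\<bar>c\<bar> + 1) ^ 3) (\<lambda>h. tanh (c * (x j + (if j \<in> J then h else 0)) $ i))" by simp
qed

section \<open>Lindeberg's replacement argument\<close>

lemma PiM_replace_factors:
  fixes F :: "(nat \<Rightarrow> 'b) \<Rightarrow> real"
  assumes P: "\<And>i. prob_space (\<mu> i)" "\<And>i. prob_space (\<nu> i)"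
    and sets: "\<And>i. sets (\<mu> i) = sets S" "\<And>i. sets (\<nu> i) = sets S"
    and F: "F \<in> borel_measurable (Pi\<^sub>M {..<K} (\<lambda>_. S))" and B: "\<And>x. \<bar>F x\<bar> \<le> B"
    and swap: "\<And>k x. k < K \<Longrightarrow> x \<in> space (Pi\<^sub>M ({..<K} - {k}) (\<lambda>_. S)) \<Longrightarrow>
      \<bar>(\<integral>y. F (x(k := y)) \<partial>\<mu> k) - (\<integral>y. F (x(k := y)) \<partial>\<nu> k)\<bar> \<le> \<delta> k"
  shows "\<bar>(\<integral>x. F x \<partial>Pi\<^sub>M {..<K} \<mu>) - (\<integral>x. F x \<partial>Pi\<^sub>M {..<K} \<nu>)\<bar> \<le> (\<Sum>k<K. \<delta> k)"
proof -
  \<comment> \<open>hybrid families: the first \<open>k\<close> factors are already replaced\<close>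
  define \<rho> where "\<rho> k i = (if i < k then \<nu> i else \<mu> i)" for k i :: nat
  have \<rho>P: "prob_space (\<rho> k i)" and \<rho>S: "sets (\<rho> k i) = sets S" for k i
    using P sets by (auto simp: \<rho>_def)
  have prod: "product_prob_space (\<rho> k)" for k
    by (simp add: product_prob_space_def product_prob_space_axioms_def product_sigma_finite_def \<rho>P prob_space_imp_sigma_finite)
  define I where "I k = (\<integral>x. F x \<partial>Pi\<^sub>M {..<K} (\<rho> k))" for k
  have Isuc: "\<bar>I k - I (Suc k)\<bar> \<le> \<delta> k" if "k < K" for k
  proof -
    let ?J = "{..<K} - {k}"
    have K: "insert k ?J = {..<K}" using that by auto
    have setsJ: "sets (Pi\<^sub>M J (\<rho> l)) = sets (Pi\<^sub>M J (\<lambda>_. S))" for J l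
      by (rule sets_PiM_cong) (simp_all add: \<rho>S)
    have fubini: "I l = (\<integral>x. (\<integral>y. F (x(k := y)) \<partial>\<rho> l k) \<partial>Pi\<^sub>M ?J (\<rho> l))" for l
    proof -
      interpret product_prob_space "\<rho> l" by (rule prod)
      interpret Q: prob_space "Pi\<^sub>M {..<K} (\<rho> l)" by (rule prob_space_PiM) (rule \<rho>P)
      have "F \<in> borel_measurable (Pi\<^sub>M {..<K} (\<rho> l))"
        using F measurable_cong_sets[OF setsJ refl] by blast
      then have "integrable (Pi\<^sub>M {..<K} (\<rho> l)) F"
        by (intro Q.integrable_const_bound[of _ B]) (use B in auto)
      then show ?thesis
        unfolding I_def using product_integral_insert[of ?J k F] K by auto
    qed
    have J: "Pi\<^sub>M ?J (\<rho> (Suc k)) = Pi\<^sub>M ?J (\<rho> k)"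
      by (rule PiM_cong) (auto simp: \<rho>_def)
    interpret Q: prob_space "Pi\<^sub>M ?J (\<rho> k)" by (rule prob_space_PiM) (rule \<rho>P)
    have spJ: "space (Pi\<^sub>M ?J (\<rho> k)) = space (Pi\<^sub>M ?J (\<lambda>_. S))"
      using sets_eq_imp_space_eq[OF setsJ] .
    \<comment> \<open>An arbitrary law \<kappa> covers both the old and the new \<open>k\<close>-th
      factor, integrated against the same remaining product.\<close>
    have int: "integrable (Pi\<^sub>M ?J (\<rho> k)) (\<lambda>x. \<integral>y. F (x(k := y)) \<partial>\<kappa>)"
      if \<kappa>: "prob_space \<kappa>" "sets \<kappa> = sets S" for \<kappa>
    proof (rule Q.integrable_const_bound[of _ B])
      interpret \<kappa>: prob_space \<kappa> by fact
      have "(\<lambda>p. (fst p)(k := snd p)) \<in> Pi\<^sub>M ?J (\<rho> k) \<Otimes>\<^sub>M \<kappa> \<rightarrow>\<^sub>M Pi\<^sub>M {..<K} (\<lambda>_. S)"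
      proof -
        have "(\<lambda>(f, y). f(k := y)) \<in> Pi\<^sub>M ?J (\<lambda>_. S) \<Otimes>\<^sub>M S \<rightarrow>\<^sub>M Pi\<^sub>M (insert k ?J) (\<lambda>_. S)"
          by (rule measurable_add_dim)
        then show ?thesis unfolding K
          by (subst measurable_cong_sets[OF sets_pair_measure_cong[OF setsJ \<kappa>(2)] refl])
            (simp add: case_prod_beta')
      qed
      from measurable_compose[OF this F]
      have "(\<lambda>(x, y). F (x(k := y))) \<in> borel_measurable (Pi\<^sub>M ?J (\<rho> k) \<Otimes>\<^sub>M \<kappa>)"
        by (simp add: case_prod_beta')
      then show "(\<lambda>x. \<integral>y. F (x(k := y)) \<partial>\<kappa>) \<in> borel_measurable (Pi\<^sub>M ?J (\<rho> k))"
        by (rule \<kappa>.borel_measurable_lebesgue_integral)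
      have "norm (\<integral>y. F (x(k := y)) \<partial>\<kappa>) \<le> B" for x
      proof (cases "integrable \<kappa> (\<lambda>y. F (x(k := y)))")
        case True
        have "norm (\<integral>y. F (x(k := y)) \<partial>\<kappa>) \<le> (\<integral>y. norm (F (x(k := y))) \<partial>\<kappa>)"
          by (rule integral_norm_bound)
        also have "\<dots> \<le> (\<integral>y. B \<partial>\<kappa>)"
          using True B by (intro integral_mono) auto
        finally show ?thesis by (simp add: \<kappa>.prob_space)
      next
        \<comment> \<open>The Bochner integral is then \<open>0\<close> by convention, and
          \<open>0 \<le> B\<close>.\<close>
        case False
        then show ?thesis using B[of undefined] abs_ge_zero order_trans
          by (simp add: not_integrable_integral_eq)
      qed
      then show "AE x in Pi\<^sub>M ?J (\<rho> k). norm (\<integral>y. F (x(k := y)) \<partial>\<kappa>) \<le> B" by simp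
    qed
    have "I k - I (Suc k) = (\<integral>x. ((\<integral>y. F (x(k := y)) \<partial>\<mu> k) - (\<integral>y. F (x(k := y)) \<partial>\<nu> k)) \<partial>Pi\<^sub>M ?J (\<rho> k))"
      unfolding fubini J using P sets
      by (subst Bochner_Integration.integral_diff) (auto intro!: int simp: \<rho>_def[of _ k])
    also have "\<bar>\<dots>\<bar> \<le> (\<integral>x. \<delta> k \<partial>Pi\<^sub>M ?J (\<rho> k))"
      by (intro order_trans[OF integral_abs_bound] integral_mono integrable_abs Bochner_Integration.integrable_diff int P sets)
        (use swap[OF that] spJ in auto)
    finally show ?thesis by (simp add: Q.prob_space)
  qed
  have "I 0 = (\<integral>x. F x \<partial>Pi\<^sub>M {..<K} \<mu>)" 
    unfolding I_def by (intro arg_cong2[where f = "integral\<^sup>L"] PiM_cong refl) (auto simp: \<rho>_def)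
  moreover have "I K = (\<integral>x. F x \<partial>Pi\<^sub>M {..<K} \<nu>)"
    unfolding I_def by (intro arg_cong2[where f = "integral\<^sup>L"] PiM_cong refl) (auto simp: \<rho>_def)
  moreover have "I 0 - I K = (\<Sum>k<K. I k - I (Suc k))" by (simp add: sum_lessThan_telescope')
  ultimately show ?thesis
    using order_trans[OF sum_abs[of "\<lambda>k. I k - I (Suc k)" "{..<K}"] sum_mono[of "{..<K}" "\<lambda>k. \<bar>I k - I (Suc k)\<bar>" \<delta>]] Isuc
    by simp
qed

text \<open>The minimum with the square keeps this finite when only second moments exist; the cube
  makes it \<open>o(1 / n)\<close> for increments scaled by \<open>1 / sqrt n\<close>.\<close>

definition third_moment_bound :: "(real ^ 'n) measure \<Rightarrow> real" where
  "third_moment_bound \<mu> = (\<integral>y. min ((norm y)\<^sup>2) (norm y ^ 3) \<partial>\<mu>)"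

text \<open>For \<open>norm h > 1\<close> the terms \<open>G h\<close>, \<open>G 0\<close>,
  \<open>a \<bullet> h\<close> and \<open>p h\<close> are each at most
  \<open>C * (norm h)\<^sup>2\<close> in modulus, whence the factor \<open>4\<close>; for shorter
  \<open>h\<close> the cubic bound applies.\<close>

lemma taylor2_remainder:
  assumes "taylor2 C G"
  obtains a p where "quadratic_on p"
    "\<And>h. \<bar>G h - (G 0 + a \<bullet> h + p h)\<bar> \<le> 4 * C * min ((norm h)\<^sup>2) (norm h ^ 3)"
proof -
  obtain a p where G: "\<And>h. \<bar>G h\<bar> \<le> C" "quadratic_on p" "norm a \<le> C" "\<And>h. \<bar>p h\<bar> \<le> C * (norm h)\<^sup>2"
    "\<And>h. norm h \<le> 1 \<Longrightarrow> \<bar>G h - (G 0 + a \<bullet> h + p h)\<bar> \<le> C * norm h ^ 3"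
    using assms unfolding taylor2_def by blast
  have C: "0 \<le> C" using assms by (rule taylor2_nonneg)
  have "\<bar>G h - (G 0 + a \<bullet> h + p h)\<bar> \<le> 4 * C * min ((norm h)\<^sup>2) (norm h ^ 3)" for h
  proof (cases "norm h \<le> 1")
    case True
    have "norm h ^ 3 \<le> (norm h)\<^sup>2" using True by (intro power_decreasing) auto
    then have "min ((norm h)\<^sup>2) (norm h ^ 3) = norm h ^ 3" by simp
    moreover have "C * norm h ^ 3 \<le> 4 * (C * norm h ^ 3)" using C by simp
    ultimately show ?thesis using G(5)[OF True] by simp
  next
    case False
    then have n: "1 \<le> (norm h)\<^sup>2" "norm h \<le> (norm h)\<^sup>2" "(norm h)\<^sup>2 \<le> norm h ^ 3"
      using power_increasing[of 1 2 "norm h"] power_increasing[of 2 3 "norm h"] by (auto simp: one_le_power)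
    have "\<bar>a \<bullet> h\<bar> \<le> C * (norm h)\<^sup>2"
      using Cauchy_Schwarz_ineq2[of a h] mult_mono[OF G(3) n(2) C] by simp
    moreover have "C \<le> C * (norm h)\<^sup>2" using n(1) C by (simp add: mult_le_cancel_left1)
    ultimately have "\<bar>G h - (G 0 + a \<bullet> h + p h)\<bar> \<le> 4 * (C * (norm h)\<^sup>2)"
      using G(1)[of h] G(1)[of 0] G(4)[of h] by linarith
    then show ?thesis using n by simp
  qed
  then show thesis using that G(2) by blast
qed

lemma le_one_plus_square: "t \<le> 1 + t\<^sup>2" for t :: real
  using zero_le_power2[of "t - 1/2"] by (simp add: power2_eq_square algebra_simps)

lemma integrable_component_products:
  fixes \<mu> :: "(real ^ 'n) measure"
  assumes "finite_measure \<mu>" and S[measurable_cong]: "sets \<mu> = sets borel"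
    and int: "integrable \<mu> (\<lambda>y. (norm y)\<^sup>2)"
  shows "integrable \<mu> (\<lambda>y. y $ i)" "integrable \<mu> (\<lambda>y. y $ i * y $ j)"
    "integrable \<mu> (\<lambda>y. min ((norm y)\<^sup>2) (norm y ^ 3))" "integrable \<mu> (\<lambda>y. y)"
proof -
  interpret finite_measure \<mu> by fact
  have [measurable]: "(\<lambda>y. y $ k) \<in> borel_measurable \<mu>" for k
    using borel_measurable_continuous_onI[OF continuous_on_component[OF continuous_on_id]] measurable_cong_sets[OF S refl] by blast
  have c: "\<bar>y $ k\<bar> \<le> norm y" for y :: "real ^ 'n" and k by (rule component_le_norm_cart)
  show "integrable \<mu> (\<lambda>y. y)"
    by (rule Bochner_Integration.integrable_bound[of _ "\<lambda>y. 1 + (norm y)\<^sup>2"]) (use int le_one_plus_square in auto)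
  then show "integrable \<mu> (\<lambda>y. y $ i)"
    by (rule Bochner_Integration.integrable_bound) (use c in auto)
  show "integrable \<mu> (\<lambda>y. y $ i * y $ j)"
    by (rule Bochner_Integration.integrable_bound[OF int])
      (auto simp: abs_mult power2_eq_square intro!: mult_mono c)
  show "integrable \<mu> (\<lambda>y. min ((norm y)\<^sup>2) (norm y ^ 3))"
    by (rule Bochner_Integration.integrable_bound[OF int]) (auto simp: min_def)
qed

text \<open>The second-order polynomial \<open>E\<close> has the same integral under both laws,
  since it involves only the constant, the first moments and the mixed second moments. Only the two
  remainders are left.\<close>

lemma taylor2_swap_bound:
  fixes \<mu> \<nu> :: "(real ^ 'n) measure"
  assumes "taylor2 C G" and G: "G \<in> borel_measurable borel"
    and P: "prob_space \<mu>" "prob_space \<nu>" and S: "sets \<mu> = sets borel" "sets \<nu> = sets borel"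
    and int: "integrable \<mu> (\<lambda>y. (norm y)\<^sup>2)" "integrable \<nu> (\<lambda>y. (norm y)\<^sup>2)"
    and mean: "\<And>i. (\<integral>y. y $ i \<partial>\<mu>) = (\<integral>y. y $ i \<partial>\<nu>)"
    and cov: "\<And>i j. (\<integral>y. y $ i * y $ j \<partial>\<mu>) = (\<integral>y. y $ i * y $ j \<partial>\<nu>)"
  shows "\<bar>(\<integral>y. G y \<partial>\<mu>) - (\<integral>y. G y \<partial>\<nu>)\<bar> \<le> 4 * C * (third_moment_bound \<mu> + third_moment_bound \<nu>)"
proof -
  obtain a p where p: "quadratic_on p"
    and rem: "\<And>h. \<bar>G h - (G 0 + a \<bullet> h + p h)\<bar> \<le> 4 * C * min ((norm h)\<^sup>2) (norm h ^ 3)"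
    using taylor2_remainder[OF assms(1)] by blast
  obtain q where q: "p = (\<lambda>h. \<Sum>i\<in>UNIV. \<Sum>j\<in>UNIV. q i j * (h $ i * h $ j))"
    using p unfolding quadratic_on_def fun_eq_iff by blast
  define E where "E h = G 0 + (\<Sum>i\<in>UNIV. a $ i * h $ i) + (\<Sum>i\<in>UNIV. \<Sum>j\<in>UNIV. q i j * (h $ i * h $ j))" for h
  have rem: "\<bar>G h - E h\<bar> \<le> 4 * C * min ((norm h)\<^sup>2) (norm h ^ 3)" for h
    using rem[of h] unfolding E_def q by (simp add: inner_vec_def)
  have main: "integrable \<kappa> E \<and> \<bar>(\<integral>y. G y \<partial>\<kappa>) - (\<integral>y. E y \<partial>\<kappa>)\<bar> \<le> 4 * C * third_moment_bound \<kappa> \<and>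
     (\<integral>y. E y \<partial>\<kappa>) = G 0 + (\<Sum>i\<in>UNIV. a $ i * (\<integral>y. y $ i \<partial>\<kappa>)) + (\<Sum>i\<in>UNIV. \<Sum>j\<in>UNIV. q i j * (\<integral>y. y $ i * y $ j \<partial>\<kappa>))"
    if \<kappa>: "prob_space \<kappa>" "sets \<kappa> = sets borel" "integrable \<kappa> (\<lambda>y. (norm y)\<^sup>2)" for \<kappa>
  proof -
    interpret prob_space \<kappa> by fact
    note int = integrable_component_products[OF finite_measure_axioms \<kappa>(2,3)]
    have E: "integrable \<kappa> E" unfolding E_def by (intro Bochner_Integration.integrable_add Bochner_Integration.integrable_sum integrable_mult_right int) simp
    have G': "integrable \<kappa> G"
    proof (rule integrable_const_bound[of _ C])
      show "G \<in> borel_measurable \<kappa>" using G measurable_cong_sets[OF \<kappa>(2) refl] by blast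
    qed (use assms(1) in \<open>auto simp: taylor2_def\<close>)
    have "\<bar>(\<integral>y. G y \<partial>\<kappa>) - (\<integral>y. E y \<partial>\<kappa>)\<bar> \<le> (\<integral>y. \<bar>G y - E y\<bar> \<partial>\<kappa>)"
      using E G' integral_abs_bound[of \<kappa> "\<lambda>y. G y - E y"] by simp
    also have "\<dots> \<le> (\<integral>y. 4 * C * min ((norm y)\<^sup>2) (norm y ^ 3) \<partial>\<kappa>)"
      using rem E G' int by (intro integral_mono) auto
    finally have "\<bar>(\<integral>y. G y \<partial>\<kappa>) - (\<integral>y. E y \<partial>\<kappa>)\<bar> \<le> 4 * C * third_moment_bound \<kappa>"
      by (simp add: third_moment_bound_def)
    moreover have "(\<integral>y. E y \<partial>\<kappa>) = G 0 + (\<Sum>i\<in>UNIV. a $ i * (\<integral>y. y $ i \<partial>\<kappa>)) + (\<Sum>i\<in>UNIV. \<Sum>j\<in>UNIV. q i j * (\<integral>y. y $ i * y $ j \<partial>\<kappa>))"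
      unfolding E_def using int by (simp add: prob_space)
    ultimately show ?thesis using E by blast
  qed
  show ?thesis
    using main[OF P(1) S(1) int(1)] main[OF P(2) S(2) int(2)]
    unfolding mean cov distrib_left by linarith
qed

text \<open>Passes from independent variables to the product of their laws. Only the factors below
  \<open>K\<close> are prescribed, so that the family \<kappa> can be continued by any law.\<close>

lemma (in prob_space) indep_vars_integral_PiM:
  fixes X :: "nat \<Rightarrow> 'a \<Rightarrow> 'b" and F :: "(nat \<Rightarrow> 'b) \<Rightarrow> real"
  assumes indep: "indep_vars (\<lambda>_. S) X {..<K}" and K: "K > 0"
    and F: "F \<in> borel_measurable (Pi\<^sub>M {..<K} (\<lambda>_. S))"
    and \<kappa>: "\<And>k. k < K \<Longrightarrow> \<kappa> k = distr M S (X k)"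
  shows "(\<integral>\<omega>. F (restrict (\<lambda>i. X i \<omega>) {..<K}) \<partial>M) = (\<integral>x. F x \<partial>Pi\<^sub>M {..<K} \<kappa>)"
proof -
  have X: "X k \<in> M \<rightarrow>\<^sub>M S" if "k < K" for k using indep that by (auto simp: indep_vars_def)
  have "(\<integral>\<omega>. F (restrict (\<lambda>i. X i \<omega>) {..<K}) \<partial>M) = (\<integral>x. F x \<partial>distr M (Pi\<^sub>M {..<K} (\<lambda>_. S)) (\<lambda>\<omega>. restrict (\<lambda>i. X i \<omega>) {..<K}))"
    by (intro integral_distr[symmetric] measurable_restrict) (use F X in auto)
  also have "distr M (Pi\<^sub>M {..<K} (\<lambda>_. S)) (\<lambda>\<omega>. restrict (\<lambda>i. X i \<omega>) {..<K}) = Pi\<^sub>M {..<K} (\<lambda>k. distr M S (X k))"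
    using indep_vars_iff_distr_eq_PiM'[of "{..<K}" X "\<lambda>_. S"] X indep K by auto
  also have "\<dots> = Pi\<^sub>M {..<K} \<kappa>" by (rule PiM_cong) (auto simp: \<kappa>)
  finally show ?thesis .
qed

text \<open>\<open>A j\<close> lists the increments summed at position \<open>j\<close>. Exchanging
  increment \<open>k\<close> therefore shifts exactly the positions with \<open>k \<in> A j\<close>,
  all by the same vector, which is the kind of move in the hypothesis on \<open>F\<close>.\<close>

lemma lindeberg_swap:
  fixes V :: "nat \<Rightarrow> 'a \<Rightarrow> real ^ 'n" and W :: "nat \<Rightarrow> 'b \<Rightarrow> real ^ 'n"
    and F :: "(nat \<Rightarrow> real ^ 'n) \<Rightarrow> real" and A :: "nat \<Rightarrow> nat set"
  assumes P: "prob_space M" "prob_space N"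
    and indep: "prob_space.indep_vars M (\<lambda>_. borel) V {..<K}" "prob_space.indep_vars N (\<lambda>_. borel) W {..<K}"
    and int: "\<And>k. k < K \<Longrightarrow> integrable M (\<lambda>\<omega>. (norm (V k \<omega>))\<^sup>2)" "\<And>k. k < K \<Longrightarrow> integrable N (\<lambda>\<omega>. (norm (W k \<omega>))\<^sup>2)"
    and mean: "\<And>k i. k < K \<Longrightarrow> (\<integral>\<omega>. V k \<omega> $ i \<partial>M) = (\<integral>\<omega>. W k \<omega> $ i \<partial>N)"
    and cov: "\<And>k i j. k < K \<Longrightarrow> (\<integral>\<omega>. V k \<omega> $ i * V k \<omega> $ j \<partial>M) = (\<integral>\<omega>. W k \<omega> $ i * W k \<omega> $ j \<partial>N)"
    and F: "continuous_on UNIV F" "\<And>x J. taylor2 C (\<lambda>h. F (\<lambda>j. x j + (if j \<in> J then h else 0)))"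
    and A: "\<And>j. A j \<subseteq> {..<K}"
  shows "\<bar>(\<integral>\<omega>. F (\<lambda>j. \<Sum>i\<in>A j. V i \<omega>) \<partial>M) - (\<integral>\<omega>. F (\<lambda>j. \<Sum>i\<in>A j. W i \<omega>) \<partial>N)\<bar>
    \<le> (\<Sum>k<K. 4 * C * ((\<integral>\<omega>. min ((norm (V k \<omega>))\<^sup>2) (norm (V k \<omega>) ^ 3) \<partial>M)
        + (\<integral>\<omega>. min ((norm (W k \<omega>))\<^sup>2) (norm (W k \<omega>) ^ 3) \<partial>N)))"
proof (cases "K = 0")
  case True
  then have "A j = {}" for j using A[of j] by auto
  then show ?thesis using True P by (simp add: prob_space.prob_space)
next
  case False
  define F' where "F' x = F (\<lambda>j. \<Sum>i\<in>A j. x i)" for x :: "nat \<Rightarrow> real ^ 'n"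
  have "(\<lambda>(x :: nat \<Rightarrow> real ^ 'n) (j :: nat). \<Sum>i\<in>A j. x i) \<in> Pi\<^sub>M {..<K} (\<lambda>_. borel) \<rightarrow>\<^sub>M (borel :: (nat \<Rightarrow> real ^ 'n) measure)"
    using A by (intro measurable_coordinatewise_then_product borel_measurable_sum measurable_component_singleton) auto
  then have F'm: "F' \<in> borel_measurable (Pi\<^sub>M {..<K} (\<lambda>_. borel))"
    unfolding F'_def using borel_measurable_continuous_on[OF F(1)] by blast
  \<comment> \<open>From \<open>K\<close> on the law of increment \<open>0\<close> is repeated, so
    that every factor is a probability measure.\<close>
  define \<mu> where "\<mu> k = distr M borel (V (if k < K then k else 0))" for k
  define \<nu> where "\<nu> k = distr N borel (W (if k < K then k else 0))" for k
  have VW: "V k \<in> borel_measurable M" "W k \<in> borel_measurable N" if "k < K" for k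
    using indep P that by (auto simp: prob_space.indep_vars_def)
  have F'r: "F' (restrict x {..<K}) = F (\<lambda>j. \<Sum>i\<in>A j. x i)" for x
    unfolding F'_def using A by (intro arg_cong[of _ _ F] ext sum.cong) auto
  have PP: "prob_space (\<mu> k)" "prob_space (\<nu> k)" for k
    unfolding \<mu>_def \<nu>_def using P VW False by (auto intro!: prob_space.prob_space_distr)
  have S: "sets (\<mu> k) = sets borel" "sets (\<nu> k) = sets borel" for k by (auto simp: \<mu>_def \<nu>_def)
  have Fb: "\<bar>F x\<bar> \<le> C" for x using F(2)[of x "{}"] by (auto simp: taylor2_def)
  have "\<bar>(\<integral>x. F' x \<partial>Pi\<^sub>M {..<K} \<mu>) - (\<integral>x. F' x \<partial>Pi\<^sub>M {..<K} \<nu>)\<bar>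
     \<le> (\<Sum>k<K. 4 * C * (third_moment_bound (\<mu> k) + third_moment_bound (\<nu> k)))"
  proof (rule PiM_replace_factors[where S = borel and B = C])
    fix k and x :: "nat \<Rightarrow> real ^ 'n" assume k: "k < K"
    \<comment> \<open>The path with increment \<open>k\<close> removed; adding \<open>y\<close> at
      the positions that contain \<open>k\<close> gives the path with \<open>y\<close> as its
      \<open>k\<close>-th increment.\<close>
    define z where "z j = (\<Sum>i\<in>A j - {k}. x i)" for j
    have z: "F' (x(k := y)) = F (\<lambda>j. z j + (if j \<in> {j. k \<in> A j} then y else 0))" for y
      unfolding F'_def z_def
    proof (intro arg_cong[of _ _ F] ext)
      fix j
      have "finite (A j)" using A finite_subset by blast
      moreover have "(\<Sum>i\<in>A j - {k}. (x(k := y)) i) = (\<Sum>i\<in>A j - {k}. x i)" by (rule sum.cong) auto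
      ultimately show "(\<Sum>i\<in>A j. (x(k := y)) i) = (\<Sum>i\<in>A j - {k}. x i) + (if j \<in> {j. k \<in> A j} then y else 0)"
        by (cases "k \<in> A j") (simp_all add: sum.remove add.commute)
    qed
    have "(\<lambda>y j. z j + (if j \<in> {j. k \<in> A j} then y else 0)) \<in> borel \<rightarrow>\<^sub>M (borel :: (nat \<Rightarrow> real ^ 'n) measure)"
      by (rule measurable_coordinatewise_then_product) simp
    then have meas: "(\<lambda>y. F (\<lambda>j. z j + (if j \<in> {j. k \<in> A j} then y else 0))) \<in> borel_measurable borel"
      using borel_measurable_continuous_on[OF F(1)] by blast
    show "\<bar>(\<integral>y. F' (x(k := y)) \<partial>\<mu> k) - (\<integral>y. F' (x(k := y)) \<partial>\<nu> k)\<bar> \<le> 4 * C * (third_moment_bound (\<mu> k) + third_moment_bound (\<nu> k))"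
      unfolding z using k VW[OF k]
      by (intro taylor2_swap_bound[OF F(2) meas PP S])
        (auto simp: \<mu>_def \<nu>_def integrable_distr_eq integral_distr int mean cov)
  next
    show "\<bar>F' x\<bar> \<le> C" for x using Fb by (simp add: F'_def)
  qed (use PP S F'm in auto)
  also have "(\<Sum>k<K. 4 * C * (third_moment_bound (\<mu> k) + third_moment_bound (\<nu> k))) =
     (\<Sum>k<K. 4 * C * ((\<integral>\<omega>. min ((norm (V k \<omega>))\<^sup>2) (norm (V k \<omega>) ^ 3) \<partial>M)
        + (\<integral>\<omega>. min ((norm (W k \<omega>))\<^sup>2) (norm (W k \<omega>) ^ 3) \<partial>N)))"
    using VW by (intro sum.cong refl) (simp add: third_moment_bound_def \<mu>_def \<nu>_def integral_distr)
  finally show ?thesis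
    using prob_space.indep_vars_integral_PiM[OF P(1) indep(1) _ F'm, of \<mu>]
      prob_space.indep_vars_integral_PiM[OF P(2) indep(2) _ F'm, of \<nu>] False
    unfolding F'r by (simp add: \<mu>_def \<nu>_def)
qed

section \<open>Moments of Gaussian vectors\<close>

text \<open>\<open>lborel\<close> is a product over \<open>Basis\<close>; the bijection sending
  \<open>i\<close> to \<open>axis i 1\<close> turns it into a product over coordinates, to which
  Fubini's theorem for finite products applies.\<close>

lemma lborel_prod_vec:
  fixes \<phi> :: "'n::finite \<Rightarrow> real \<Rightarrow> real"
  assumes int: "\<And>i. integrable lborel (\<phi> i)"
  shows "integrable lborel (\<lambda>x :: real ^ 'n. \<Prod>i\<in>UNIV. \<phi> i (x $ i))"
    and "(\<integral>x. (\<Prod>i\<in>UNIV. \<phi> i ((x :: real ^ 'n) $ i)) \<partial>lborel) = (\<Prod>i\<in>UNIV. \<integral>x. \<phi> i x \<partial>lborel)"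
proof -
  interpret product_sigma_finite "\<lambda>_ :: real ^ 'n. lborel :: real measure" ..
  define T where "T f = (\<Sum>b\<in>Basis. f b *\<^sub>R b)" for f :: "real ^ 'n \<Rightarrow> real"
  have bij: "bij_betw (\<lambda>i. axis i 1 :: real ^ 'n) UNIV Basis"
    by (auto simp: bij_betw_def Basis_vec_def inj_on_def axis_eq_axis)
  have idx: "axis_index (axis i 1 :: real ^ 'n) = i" for i :: 'n
    by (simp add: axis_index_def axis_eq_axis)
  have comp: "T f $ i = f (axis i 1)" for f and i :: 'n
    by (simp add: T_def cart_eq_inner_axis inner_sum_left_Basis axis_in_Basis_iff)
  have eq: "(\<Prod>i\<in>UNIV. \<phi> i (T f $ i)) = (\<Prod>b\<in>Basis. \<phi> (axis_index b) (f b))" for f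
    using prod.reindex_bij_betw[OF bij, of "\<lambda>b. \<phi> (axis_index b) (f b)"] by (simp add: comp idx)
  have T: "T \<in> (\<Pi>\<^sub>M b\<in>Basis. lborel) \<rightarrow>\<^sub>M borel" unfolding T_def by measurable
  have [measurable]: "\<phi> i \<in> borel_measurable borel" for i
    using borel_measurable_integrable[OF int[of i]] by simp
  have m: "(\<lambda>x :: real ^ 'n. \<Prod>i\<in>UNIV. \<phi> i (x $ i)) \<in> borel_measurable borel" by measurable
  have lb: "(lborel :: (real ^ 'n) measure) = distr (\<Pi>\<^sub>M b\<in>Basis. lborel) borel T"
    unfolding T_def by (rule lborel_eq)
  show "integrable lborel (\<lambda>x :: real ^ 'n. \<Prod>i\<in>UNIV. \<phi> i (x $ i))"
    unfolding lb integrable_distr_eq[OF T m] eq by (intro product_integrable_prod int) auto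
  have "(\<integral>x. (\<Prod>i\<in>UNIV. \<phi> i ((x :: real ^ 'n) $ i)) \<partial>lborel) = (\<Prod>b\<in>Basis. \<integral>x. \<phi> (axis_index (b :: real ^ 'n)) x \<partial>lborel)"
    unfolding lb integral_distr[OF T m] eq by (intro product_integral_prod int) auto
  also have "\<dots> = (\<Prod>i\<in>UNIV. \<integral>x. \<phi> i x \<partial>lborel)"
    using prod.reindex_bij_betw[OF bij, of "\<lambda>b. \<integral>x. \<phi> (axis_index b) x \<partial>lborel"] by (simp add: idx)
  finally show "(\<integral>x. (\<Prod>i\<in>UNIV. \<phi> i ((x :: real ^ 'n) $ i)) \<partial>lborel) = (\<Prod>i\<in>UNIV. \<integral>x. \<phi> i x \<partial>lborel)" .
qed

lemma gaussian_mixed_moment: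
  fixes X :: "'b \<Rightarrow> real ^ 'n::finite"
  assumes X: "distributed N lborel X (\<lambda>x. ennreal (\<Prod>i\<in>UNIV. normal_density 0 s (x $ i)))" and s: "s > 0"
  shows "integrable N (\<lambda>\<omega>. \<Prod>i\<in>UNIV. X \<omega> $ i ^ e i)"
    and "(\<integral>\<omega>. (\<Prod>i\<in>UNIV. X \<omega> $ i ^ e i) \<partial>N) = (\<Prod>i\<in>UNIV. \<integral>x. normal_density 0 s x * x ^ e i \<partial>lborel)"
proof -
  let ?\<phi> = "\<lambda>i x. normal_density 0 s x * x ^ e i"
  have int: "integrable lborel (?\<phi> i)" for i
    using integrable_normal_moment[OF s, of 0 "e i"] by simp
  have m: "(\<lambda>x :: real ^ 'n. \<Prod>i\<in>UNIV. x $ i ^ e i) \<in> borel_measurable lborel" by measurable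
  have nn: "0 \<le> (\<Prod>i\<in>UNIV. normal_density 0 s (x $ i))" for x :: "real ^ 'n" by (intro prod_nonneg) simp
  have eq: "(\<Prod>i\<in>UNIV. normal_density 0 s (x $ i)) * (\<Prod>i\<in>UNIV. x $ i ^ e i) = (\<Prod>i\<in>UNIV. ?\<phi> i (x $ i))" for x :: "real ^ 'n"
    by (simp add: prod.distrib)
  show "integrable N (\<lambda>\<omega>. \<Prod>i\<in>UNIV. X \<omega> $ i ^ e i)"
    using distributed_integrable[OF X m nn] lborel_prod_vec(1)[of ?\<phi>, OF int] unfolding eq by blast
  show "(\<integral>\<omega>. (\<Prod>i\<in>UNIV. X \<omega> $ i ^ e i) \<partial>N) = (\<Prod>i\<in>UNIV. \<integral>x. normal_density 0 s x * x ^ e i \<partial>lborel)"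
    using distributed_integral[OF X m nn] lborel_prod_vec(2)[of ?\<phi>, OF int] unfolding eq by (rule trans[OF sym])
qed

text \<open>Mixed moments with one exponent \<open>p\<close>, or with exponent \<open>1\<close> at
  two coordinates. A coordinate with exponent \<open>0\<close> contributes total mass one, and one
  with exponent \<open>1\<close> contributes the vanishing mean.\<close>

lemma gaussian_moments:
  fixes X :: "'b \<Rightarrow> real ^ 'n::finite"
  assumes X: "distributed N lborel X (\<lambda>x. ennreal (\<Prod>i\<in>UNIV. normal_density 0 (sqrt t) (x $ i)))" and t: "t > 0"
  shows "integrable N (\<lambda>\<omega>. X \<omega> $ i)" "(\<integral>\<omega>. X \<omega> $ i \<partial>N) = 0"
    and "integrable N (\<lambda>\<omega>. X \<omega> $ i * X \<omega> $ j)" "(\<integral>\<omega>. X \<omega> $ i * X \<omega> $ j \<partial>N) = (if i = j then t else 0)"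
    and "integrable N (\<lambda>\<omega>. X \<omega> $ i ^ 4)" "(\<integral>\<omega>. X \<omega> $ i ^ 4 \<partial>N) = 3 * t\<^sup>2"
proof -
  have one: "(\<Prod>k\<in>UNIV. x $ k ^ (if k = i then p else 0)) = x $ i ^ p" for x :: "real ^ 'n" and p i
  proof -
    have "(\<Prod>k\<in>UNIV. x $ k ^ (if k = i then p else 0)) = (\<Prod>k\<in>UNIV. if k = i then x $ k ^ p else 1)"
      by (rule prod.cong) auto
    then show ?thesis by simp
  qed
  have onei: "(\<Prod>k\<in>UNIV. \<integral>x. normal_density 0 (sqrt t) x * x ^ (if k = i then p else 0) \<partial>lborel)
      = (\<integral>x. normal_density 0 (sqrt t) x * x ^ p \<partial>lborel)" for p and i :: 'n
  proof -
    have "(\<Prod>k\<in>UNIV. \<integral>x. normal_density 0 (sqrt t) x * x ^ (if k = i then p else 0) \<partial>lborel)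
      = (\<Prod>k\<in>UNIV. if k = i then (\<integral>x. normal_density 0 (sqrt t) x * x ^ p \<partial>lborel) else 1)"
      using t by (intro prod.cong) auto
    then show ?thesis by simp
  qed
  have s: "sqrt t > 0" using t by simp
  note single = gaussian_mixed_moment[OF X s, of "\<lambda>k. if k = _ then _ else 0", unfolded one onei]
  have m1: "(\<integral>x. normal_density 0 (sqrt t) x * x ^ 1 \<partial>lborel) = 0"
    using integral_normal_moment_nz_1[OF s, of 0] by simp
  have m2: "(\<integral>x. normal_density 0 (sqrt t) x * x ^ 2 \<partial>lborel) = t"
    using integral_normal_moment_even[OF s, of 0 1] t by (simp add: ac_simps power2_eq_square)
  have m4: "(\<integral>x. normal_density 0 (sqrt t) x * x ^ 4 \<partial>lborel) = 3 * t\<^sup>2"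
    using integral_normal_moment_even[OF s, of 0 2] t by (simp add: field_simps fact_numeral)
  show "integrable N (\<lambda>\<omega>. X \<omega> $ i)" "(\<integral>\<omega>. X \<omega> $ i \<partial>N) = 0"
    using single[of i 1] m1 by simp_all
  show "integrable N (\<lambda>\<omega>. X \<omega> $ i ^ 4)" "(\<integral>\<omega>. X \<omega> $ i ^ 4 \<partial>N) = 3 * t\<^sup>2"
    using single[of i 4] m4 by simp_all
  show "integrable N (\<lambda>\<omega>. X \<omega> $ i * X \<omega> $ j)" "(\<integral>\<omega>. X \<omega> $ i * X \<omega> $ j \<partial>N) = (if i = j then t else 0)"
  proof -
    have "integrable N (\<lambda>\<omega>. X \<omega> $ i * X \<omega> $ j) \<and> (\<integral>\<omega>. X \<omega> $ i * X \<omega> $ j \<partial>N) = (if i = j then t else 0)"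
    proof (cases "i = j")
      case True
      then show ?thesis using single[of i 2] m2 by (simp add: power2_eq_square)
    next
      case False
      let ?e = "\<lambda>k. if k = i \<or> k = j then 1 else (0::nat)"
      have two: "(\<Prod>k\<in>UNIV. x $ k ^ ?e k) = x $ i * x $ j" for x :: "real ^ 'n"
      proof -
        have "(\<Prod>k\<in>UNIV. x $ k ^ ?e k) = (\<Prod>k\<in>{i, j}. x $ k)"
          by (rule prod.mono_neutral_cong_right) auto
        then show ?thesis using False by simp
      qed
      have "(\<Prod>k\<in>UNIV. \<integral>x. normal_density 0 (sqrt t) x * x ^ ?e k \<partial>lborel) = 0"
        using m1 by (intro prod_zero bexI[of _ i]) auto
      then show ?thesis using gaussian_mixed_moment[OF X s, of ?e] False unfolding two by simp
    qed
    then show "integrable N (\<lambda>\<omega>. X \<omega> $ i * X \<omega> $ j)" "(\<integral>\<omega>. X \<omega> $ i * X \<omega> $ j \<partial>N) = (if i = j then t else 0)"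
      by auto
  qed
qed

lemma norm_eq_sum_power: "(norm x)\<^sup>2 = (\<Sum>i\<in>UNIV. (x $ i)\<^sup>2)" for x :: "real ^ 'n"
  unfolding power2_norm_eq_inner by (simp add: inner_vec_def power2_eq_square)

lemma norm_power4_le: "norm x ^ 4 \<le> real CARD('n) * (\<Sum>i\<in>UNIV. x $ i ^ 4)" for x :: "real ^ 'n::finite"
proof -
  have "norm x ^ 4 = (\<Sum>i\<in>UNIV. (x $ i)\<^sup>2)\<^sup>2" by (simp add: norm_eq_sum_power[symmetric] flip: power_mult)
  also have "\<dots> \<le> (\<Sum>i\<in>UNIV. ((x $ i)\<^sup>2)\<^sup>2) * real CARD('n)"
    by (rule sum_squared_le_sum_of_squares)
  finally show ?thesis by (simp add: mult.commute flip: power_mult)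
qed

text \<open>\<beta> bounds the operator norm, so norm moments of \<open>B *v X\<close> follow from
  those of \<open>X\<close>. In the fourth moment one factor \<open>CARD('n)\<close> comes from
  \<open>norm_power4_le\<close>; the other, and \<open>3 * t\<^sup>2\<close>, come from summing the
  Gaussian fourth moments.\<close>

lemma gaussian_image_moments:
  fixes X :: "'b \<Rightarrow> real ^ 'n::finite" and B :: "real ^ 'n ^ 'n"
  assumes X: "distributed N lborel X (\<lambda>x. ennreal (\<Prod>i\<in>UNIV. normal_density 0 (sqrt t) (x $ i)))" and t: "t > 0"
    and \<beta>: "\<And>x. norm (B *v x) \<le> \<beta> * norm x"
  defines "Y \<equiv> \<lambda>\<omega>. B *v X \<omega>"
  shows "(\<integral>\<omega>. Y \<omega> $ i \<partial>N) = 0"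
    and "(\<integral>\<omega>. Y \<omega> $ i * Y \<omega> $ j \<partial>N) = t * (B ** transpose B) $ i $ j"
    and "integrable N (\<lambda>\<omega>. (norm (Y \<omega>))\<^sup>2)" "(\<integral>\<omega>. (norm (Y \<omega>))\<^sup>2 \<partial>N) \<le> \<beta>\<^sup>2 * CARD('n) * t"
    and "integrable N (\<lambda>\<omega>. norm (Y \<omega>) ^ 4)" "(\<integral>\<omega>. norm (Y \<omega>) ^ 4 \<partial>N) \<le> 3 * \<beta> ^ 4 * (CARD('n))\<^sup>2 * t\<^sup>2"
proof -
  note G = gaussian_moments[OF X t]
  have [measurable]: "X \<in> borel_measurable N" using X by (simp add: distributed_def)
  have Ym: "Y \<in> borel_measurable N"
    unfolding Y_def by (rule borel_measurable_continuous_on[OF matrix_vector_mult_linear_continuous_on]) simp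
  have \<beta>0: "\<beta> \<ge> 0"
    using order_trans[OF norm_ge_zero \<beta>[of "axis i 1"]] by simp
  show "(\<integral>\<omega>. Y \<omega> $ i \<partial>N) = 0"
    unfolding Y_def matrix_vector_mult_def using G by simp
  have "(\<integral>\<omega>. Y \<omega> $ i * Y \<omega> $ j \<partial>N) = (\<integral>\<omega>. (\<Sum>k\<in>UNIV. \<Sum>l\<in>UNIV. B $ i $ k * B $ j $ l * (X \<omega> $ k * X \<omega> $ l)) \<partial>N)"
    unfolding Y_def matrix_vector_mult_def by (simp add: sum_product mult_ac)
  also have "\<dots> = (\<Sum>k\<in>UNIV. \<Sum>l\<in>UNIV. B $ i $ k * B $ j $ l * (if k = l then t else 0))"
    using G by simp
  also have "\<dots> = t * (B ** transpose B) $ i $ j"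
    by (simp add: matrix_matrix_mult_def transpose_def if_distrib sum_distrib_left mult_ac cong: if_cong)
  finally show "(\<integral>\<omega>. Y \<omega> $ i * Y \<omega> $ j \<partial>N) = t * (B ** transpose B) $ i $ j" .
  have int2: "integrable N (\<lambda>\<omega>. (norm (X \<omega>))\<^sup>2)"
    unfolding norm_eq_sum_power using G(3) by (intro Bochner_Integration.integrable_sum) (simp add: power2_eq_square)
  have le2: "(norm (Y \<omega>))\<^sup>2 \<le> \<beta>\<^sup>2 * (norm (X \<omega>))\<^sup>2" for \<omega>
    unfolding Y_def power_mult_distrib[symmetric] by (intro power_mono \<beta>) simp
  show i2: "integrable N (\<lambda>\<omega>. (norm (Y \<omega>))\<^sup>2)"
    by (rule Bochner_Integration.integrable_bound[of _ "\<lambda>\<omega>. \<beta>\<^sup>2 * (norm (X \<omega>))\<^sup>2"])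
      (use int2 le2 Ym in auto)
  have "(\<integral>\<omega>. (norm (Y \<omega>))\<^sup>2 \<partial>N) \<le> (\<integral>\<omega>. \<beta>\<^sup>2 * (norm (X \<omega>))\<^sup>2 \<partial>N)"
    using i2 int2 le2 by (intro integral_mono) auto
  also have "\<dots> = \<beta>\<^sup>2 * CARD('n) * t"
    unfolding norm_eq_sum_power using G(3,4)[of _ _] by (simp add: power2_eq_square)
  finally show "(\<integral>\<omega>. (norm (Y \<omega>))\<^sup>2 \<partial>N) \<le> \<beta>\<^sup>2 * CARD('n) * t" .
  have le4: "norm (Y \<omega>) ^ 4 \<le> \<beta> ^ 4 * (real CARD('n) * (\<Sum>i\<in>UNIV. X \<omega> $ i ^ 4))" for \<omega>
  proof -
    have "norm (Y \<omega>) ^ 4 \<le> \<beta> ^ 4 * norm (X \<omega>) ^ 4"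
      unfolding Y_def power_mult_distrib[symmetric] by (intro power_mono \<beta>) simp
    also have "\<dots> \<le> \<beta> ^ 4 * (real CARD('n) * (\<Sum>i\<in>UNIV. X \<omega> $ i ^ 4))"
      using norm_power4_le by (intro mult_left_mono) auto
    finally show ?thesis .
  qed
  have int4: "integrable N (\<lambda>\<omega>. \<beta> ^ 4 * (real CARD('n) * (\<Sum>i\<in>UNIV. X \<omega> $ i ^ 4)))"
    using G(5) by (intro integrable_mult_right Bochner_Integration.integrable_sum)
  show i4: "integrable N (\<lambda>\<omega>. norm (Y \<omega>) ^ 4)"
  proof (rule Bochner_Integration.integrable_bound[OF int4])
    show "AE \<omega> in N. norm (norm (Y \<omega>) ^ 4) \<le> norm (\<beta> ^ 4 * (real CARD('n) * (\<Sum>i\<in>UNIV. X \<omega> $ i ^ 4)))"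
    proof (rule AE_I2)
      show "norm (norm (Y \<omega>) ^ 4) \<le> norm (\<beta> ^ 4 * (real CARD('n) * (\<Sum>i\<in>UNIV. X \<omega> $ i ^ 4)))" for \<omega>
        using order_trans[OF le4[of \<omega>] abs_ge_self] by (simp only: real_norm_def abs_of_nonneg norm_ge_zero zero_le_power)
    qed
  qed (use Ym in auto)
  have "(\<integral>\<omega>. norm (Y \<omega>) ^ 4 \<partial>N) \<le> (\<integral>\<omega>. \<beta> ^ 4 * (real CARD('n) * (\<Sum>i\<in>UNIV. X \<omega> $ i ^ 4)) \<partial>N)"
    using i4 int4 le4 by (intro integral_mono) auto
  also have "\<dots> = \<beta> ^ 4 * (real CARD('n) * (\<Sum>i\<in>(UNIV::'n set). 3 * t\<^sup>2))"
    using G(5,6) by simp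
  finally show "(\<integral>\<omega>. norm (Y \<omega>) ^ 4 \<partial>N) \<le> 3 * \<beta> ^ 4 * (CARD('n))\<^sup>2 * t\<^sup>2"
    by (simp add: power2_eq_square mult_ac)
qed

section \<open>Maximal inequality and tail bounds\<close>

lemma (in prob_space) prob_le_expectation:
  fixes f :: "'a \<Rightarrow> real"
  assumes "integrable M f" "A \<in> events" "\<And>\<omega>. \<omega> \<in> space M \<Longrightarrow> 0 \<le> f \<omega>" "\<And>\<omega>. \<omega> \<in> A \<Longrightarrow> 1 \<le> f \<omega>"
  shows "prob A \<le> expectation f"
proof -
  have "prob A = (\<integral>\<omega>. indicator A \<omega> \<partial>M)" using assms(2) by simp
  also have "\<dots> \<le> expectation f"
    using assms by (intro integral_mono integrable_const_bound[of "indicator A" 1]) (auto split: split_indicator)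
  finally show ?thesis .
qed

text \<open>Distinct summands are orthogonal: the expected inner product is a sum over coordinates
  of expectations of products of independent centred variables.\<close>

lemma (in prob_space) indep_sum_second_moment:
  fixes V :: "'i \<Rightarrow> 'a \<Rightarrow> real ^ 'n"
  assumes indep: "indep_vars (\<lambda>_. borel) V I" and A: "finite A" "A \<subseteq> I"
    and int: "\<And>i. i \<in> A \<Longrightarrow> integrable M (\<lambda>\<omega>. (norm (V i \<omega>))\<^sup>2)"
    and mean: "\<And>i p. i \<in> A \<Longrightarrow> (\<integral>\<omega>. V i \<omega> $ p \<partial>M) = 0"
  shows "integrable M (\<lambda>\<omega>. (norm (\<Sum>i\<in>A. V i \<omega>))\<^sup>2)"
    and "(\<integral>\<omega>. (norm (\<Sum>i\<in>A. V i \<omega>))\<^sup>2 \<partial>M) = (\<Sum>i\<in>A. \<integral>\<omega>. (norm (V i \<omega>))\<^sup>2 \<partial>M)"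
proof -
  have V[measurable]: "V i \<in> borel_measurable M" if "i \<in> A" for i using indep that A by (auto simp: indep_vars_def)
  have int1: "integrable M (\<lambda>\<omega>. V i \<omega> $ p)" if "i \<in> A" for i p
  proof (rule Bochner_Integration.integrable_bound[of _ "\<lambda>\<omega>. 1 + (norm (V i \<omega>))\<^sup>2"])
    have "\<bar>V i \<omega> $ p\<bar> \<le> 1 + (norm (V i \<omega>))\<^sup>2" for \<omega>
      using component_le_norm_cart[of "V i \<omega>" p] le_one_plus_square[of "norm (V i \<omega>)"] by linarith
    then show "AE \<omega> in M. norm (V i \<omega> $ p) \<le> norm (1 + (norm (V i \<omega>))\<^sup>2)" by simp
    show "(\<lambda>\<omega>. V i \<omega> $ p) \<in> borel_measurable M"
      by (rule measurable_compose[OF V[OF that] borel_measurable_nth])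
  qed (use int that in auto)
  have pair: "integrable M (\<lambda>\<omega>. V i \<omega> \<bullet> V j \<omega>) \<and> (\<integral>\<omega>. V i \<omega> \<bullet> V j \<omega> \<partial>M) = (if i = j then (\<integral>\<omega>. (norm (V i \<omega>))\<^sup>2 \<partial>M) else 0)"
    if ij: "i \<in> A" "j \<in> A" for i j
  proof (cases "i = j")
    case True
    then show ?thesis using int ij by (simp add: power2_norm_eq_inner)
  next
    case False
    have "integrable M (\<lambda>\<omega>. V i \<omega> $ p * V j \<omega> $ p) \<and> (\<integral>\<omega>. V i \<omega> $ p * V j \<omega> $ p \<partial>M) = 0" for p
    proof -
      have "indep_vars (\<lambda>_. borel) V {i, j}" by (rule indep_vars_subset[OF indep]) (use ij A in auto)
      from indep_vars_compose2[OF this, of "\<lambda>_ x. x $ p" "\<lambda>_. borel"]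
      have *: "indep_vars (\<lambda>_. borel) (\<lambda>k \<omega>. V k \<omega> $ p) {i, j}" by simp
      have "integrable M (\<lambda>\<omega>. V k \<omega> $ p)" if "k \<in> {i, j}" for k using int1 that ij by blast
      then show ?thesis
        using indep_vars_lebesgue_integral[OF _ *] indep_vars_integrable[OF _ *] ij False mean
        by simp
    qed
    then show ?thesis using False by (simp add: inner_vec_def)
  qed
  have eq: "(norm (\<Sum>i\<in>A. V i \<omega>))\<^sup>2 = (\<Sum>i\<in>A. \<Sum>j\<in>A. V i \<omega> \<bullet> V j \<omega>)" for \<omega>
    by (simp add: power2_norm_eq_inner inner_sum_left inner_sum_right inner_commute)
  show "integrable M (\<lambda>\<omega>. (norm (\<Sum>i\<in>A. V i \<omega>))\<^sup>2)" unfolding eq using pair by simp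
  show "(\<integral>\<omega>. (norm (\<Sum>i\<in>A. V i \<omega>))\<^sup>2 \<partial>M) = (\<Sum>i\<in>A. \<integral>\<omega>. (norm (V i \<omega>))\<^sup>2 \<partial>M)"
    unfolding eq using pair A by simp
qed

text \<open>The event is split by the first \<open>k\<close> at which a partial sum reaches
  \<open>2 * \<alpha>\<close>. The rest of the sum is independent of that and stays below \<alpha>
  with probability at least one half; when it does, the full sum is at least \<alpha> by the
  triangle inequality.\<close>

lemma (in prob_space) ottaviani:
  fixes V :: "nat \<Rightarrow> 'a \<Rightarrow> real ^ 'n"
  assumes indep: "indep_vars (\<lambda>_. borel) V {a..<b}"
    and half: "\<And>k. k \<in> {a..b} \<Longrightarrow> prob {\<omega>\<in>space M. \<alpha> \<le> norm (\<Sum>i\<in>{k..<b}. V i \<omega>)} \<le> 1/2"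
  shows "prob {\<omega>\<in>space M. \<exists>k\<in>{a..b}. 2 * \<alpha> \<le> norm (\<Sum>i\<in>{a..<k}. V i \<omega>)}
    \<le> 2 * prob {\<omega>\<in>space M. \<alpha> \<le> norm (\<Sum>i\<in>{a..<b}. V i \<omega>)}"
proof -
  have V[measurable]: "V i \<in> borel_measurable M" if "i \<in> {a..<b}" for i using indep that by (auto simp: indep_vars_def)
  have sums[measurable]: "(\<lambda>\<omega>. \<Sum>i\<in>{c..<d}. V i \<omega>) \<in> borel_measurable M" if "a \<le> c" "d \<le> b" for c d
    by (rule borel_measurable_sum) (use V that in auto)
  \<comment> \<open>\<open>E k\<close> is first passage at \<open>k\<close>, read off the increments
    before \<open>k\<close>; \<open>C k\<close> depends only on those from \<open>k\<close>
    on.\<close>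
  define E where "E k = {\<omega>\<in>space M. 2 * \<alpha> \<le> norm (\<Sum>i\<in>{a..<k}. V i \<omega>) \<and> (\<forall>j\<in>{a..<k}. norm (\<Sum>i\<in>{a..<j}. V i \<omega>) < 2 * \<alpha>)}" for k
  define C where "C k = {\<omega>\<in>space M. norm (\<Sum>i\<in>{k..<b}. V i \<omega>) < \<alpha>}" for k
  define R where "R = {\<omega>\<in>space M. \<alpha> \<le> norm (\<Sum>i\<in>{a..<b}. V i \<omega>)}"
  have Em: "E k \<in> events" if "k \<in> {a..b}" for k
  proof -
    have "(\<lambda>\<omega>. \<Sum>i\<in>{a..<j}. V i \<omega>) \<in> borel_measurable M" if "j \<in> {a..k}" for j
      using that \<open>k \<in> {a..b}\<close> by (intro sums) auto
    then show ?thesis unfolding E_def using that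
      by (intro sets.sets_Collect_conj sets.sets_Collect_finite_All) auto
  qed
  have Cm: "C k \<in> events" if "k \<in> {a..b}" for k
    unfolding C_def using sums[of k b] that by auto
  have Rm: "R \<in> events" unfolding R_def using sums[of a b] by auto
  have CE: "prob (E k) \<le> 2 * prob (E k \<inter> C k)" if k: "k \<in> {a..b}" for k
  proof -
    let ?A = "{a..<k}" and ?B = "{k..<b}"
    have iv: "indep_var (Pi\<^sub>M ?A (\<lambda>_. borel)) (\<lambda>\<omega>. restrict (\<lambda>i. V i \<omega>) ?A) (Pi\<^sub>M ?B (\<lambda>_. borel)) (\<lambda>\<omega>. restrict (\<lambda>i. V i \<omega>) ?B)"
      using k by (intro indep_var_restrict[OF indep]) auto
    define E' where "E' = {x \<in> space (Pi\<^sub>M ?A (\<lambda>_. borel :: (real ^ 'n) measure)). 2 * \<alpha> \<le> norm (\<Sum>i\<in>{a..<k}. x i) \<and> (\<forall>j\<in>{a..<k}. norm (\<Sum>i\<in>{a..<j}. x i) < 2 * \<alpha>)}"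
    define C' where "C' = {x \<in> space (Pi\<^sub>M ?B (\<lambda>_. borel :: (real ^ 'n) measure)). norm (\<Sum>i\<in>{k..<b}. x i) < \<alpha>}"
    have sm: "(\<lambda>x. \<Sum>i\<in>J. x i) \<in> borel_measurable (Pi\<^sub>M I (\<lambda>_. borel :: (real ^ 'n) measure))" if "J \<subseteq> I" for I J :: "nat set"
      using that by (intro borel_measurable_sum measurable_component_singleton) auto
    have E's: "E' \<in> sets (Pi\<^sub>M ?A (\<lambda>_. borel))"
    proof -
      have "(\<lambda>x. \<Sum>i\<in>{a..<j}. x i) \<in> borel_measurable (Pi\<^sub>M ?A (\<lambda>_. borel :: (real ^ 'n) measure))" if "j \<le> k" for j
        using that by (intro sm) auto
      then show ?thesis unfolding E'_def
        by (intro sets.sets_Collect_conj sets.sets_Collect_finite_All) auto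
    qed
    have C's: "C' \<in> sets (Pi\<^sub>M ?B (\<lambda>_. borel))"
      unfolding C'_def using sm[of ?B ?B] by auto
    have rs: "restrict (\<lambda>i. V i \<omega>) J \<in> space (Pi\<^sub>M J (\<lambda>_. borel))" for \<omega> J by (simp add: space_PiM)
    have cut: "(\<Sum>i\<in>{a..<j}. restrict (\<lambda>i. V i \<omega>) ?A i) = (\<Sum>i\<in>{a..<j}. V i \<omega>)" if "j \<le> k" for j \<omega>
      using that by (intro sum.cong) auto
    have cut': "(\<Sum>i\<in>?B. restrict (\<lambda>i. V i \<omega>) ?B i) = (\<Sum>i\<in>?B. V i \<omega>)" for \<omega>
      by (intro sum.cong) auto
    have Ek: "E k = (\<lambda>\<omega>. restrict (\<lambda>i. V i \<omega>) ?A) -` E' \<inter> space M"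
      using rs[of _ ?A] cut by (auto simp: E_def E'_def simp del: restrict_apply)
    have Ck: "C k = (\<lambda>\<omega>. restrict (\<lambda>i. V i \<omega>) ?B) -` C' \<inter> space M"
      using rs[of _ ?B] cut' by (auto simp: C_def C'_def simp del: restrict_apply)
    have EC: "E k \<inter> C k = (\<lambda>\<omega>. (restrict (\<lambda>i. V i \<omega>) ?A, restrict (\<lambda>i. V i \<omega>) ?B)) -` (E' \<times> C') \<inter> space M"
      unfolding Ek Ck by blast
    have "prob (E k \<inter> C k) = prob (E k) * prob (C k)"
      unfolding EC using indep_varD[OF iv E's C's] by (simp only: Ek Ck)
    moreover have "prob (C k) = 1 - prob {\<omega>\<in>space M. \<alpha> \<le> norm (\<Sum>i\<in>{k..<b}. V i \<omega>)}"
    proof -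
      have "{\<omega>\<in>space M. \<alpha> \<le> norm (\<Sum>i\<in>{k..<b}. V i \<omega>)} = space M - C k" by (auto simp: C_def)
      then show ?thesis using prob_compl[OF Cm[OF k]] by simp
    qed
    then have "prob (C k) \<ge> 1/2" using half[OF k] by simp
    ultimately show ?thesis using mult_left_mono[of "1/2" "prob (C k)" "prob (E k)"] by simp
  qed
  have disj: "disjoint_family_on E {a..b}"
  proof -
    have "\<omega> \<notin> E l" if "k \<in> {a..b}" "k < l" "\<omega> \<in> E k" for k l \<omega>
    proof
      assume "\<omega> \<in> E l"
      then have "norm (\<Sum>i\<in>{a..<k}. V i \<omega>) < 2 * \<alpha>" using that by (simp add: E_def)
      then show False using that by (simp add: E_def)
    qed
    then show ?thesis unfolding disjoint_family_on_def by (metis disjoint_iff linorder_neqE_nat)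
  qed
  have "{\<omega>\<in>space M. \<exists>k\<in>{a..b}. 2 * \<alpha> \<le> norm (\<Sum>i\<in>{a..<k}. V i \<omega>)} = (\<Union>k\<in>{a..b}. E k)"
  proof (intro set_eqI iffI)
    fix \<omega> assume "\<omega> \<in> {\<omega>\<in>space M. \<exists>k\<in>{a..b}. 2 * \<alpha> \<le> norm (\<Sum>i\<in>{a..<k}. V i \<omega>)}"
    then obtain k where k: "\<omega> \<in> space M" "k \<in> {a..b} \<and> 2 * \<alpha> \<le> norm (\<Sum>i\<in>{a..<k}. V i \<omega>)" by blast
    define l where "l = (LEAST k. k \<in> {a..b} \<and> 2 * \<alpha> \<le> norm (\<Sum>i\<in>{a..<k}. V i \<omega>))"
    have l: "l \<in> {a..b} \<and> 2 * \<alpha> \<le> norm (\<Sum>i\<in>{a..<l}. V i \<omega>)" unfolding l_def using k(2) by (rule LeastI)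
    have "norm (\<Sum>i\<in>{a..<j}. V i \<omega>) < 2 * \<alpha>" if "j \<in> {a..<l}" for j
    proof -
      have "\<not> (j \<in> {a..b} \<and> 2 * \<alpha> \<le> norm (\<Sum>i\<in>{a..<j}. V i \<omega>))"
        using that unfolding l_def by (intro not_less_Least) simp
      then show ?thesis using that l by auto
    qed
    then show "\<omega> \<in> (\<Union>k\<in>{a..b}. E k)" using l k(1) by (auto simp: E_def)
  qed (auto simp: E_def)
  then have "prob {\<omega>\<in>space M. \<exists>k\<in>{a..b}. 2 * \<alpha> \<le> norm (\<Sum>i\<in>{a..<k}. V i \<omega>)} = (\<Sum>k\<in>{a..b}. prob (E k))"
    using Em disj by (simp add: finite_measure_finite_Union image_subset_iff)
  also have "\<dots> \<le> (\<Sum>k\<in>{a..b}. 2 * prob (E k \<inter> C k))" by (intro sum_mono CE)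
  also have "\<dots> = 2 * prob (\<Union>k\<in>{a..b}. E k \<inter> C k)"
  proof -
    have "disjoint_family_on (\<lambda>k. E k \<inter> C k) {a..b}"
      using disj unfolding disjoint_family_on_def by blast
    then show ?thesis
      using Em Cm by (subst finite_measure_finite_Union) (auto simp: sum_distrib_left)
  qed
  also have "\<dots> \<le> 2 * prob R"
  proof -
    have "(\<Union>k\<in>{a..b}. E k \<inter> C k) \<subseteq> R"
    proof safe
      fix k \<omega> assume k: "k \<in> {a..b}" and \<omega>: "\<omega> \<in> E k" "\<omega> \<in> C k"
      have "(\<Sum>i\<in>{a..<b}. V i \<omega>) = (\<Sum>i\<in>{a..<k}. V i \<omega>) + (\<Sum>i\<in>{k..<b}. V i \<omega>)"
        using k by (simp add: sum.atLeastLessThan_concat)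
      then have "norm (\<Sum>i\<in>{a..<k}. V i \<omega>) - norm (\<Sum>i\<in>{k..<b}. V i \<omega>) \<le> norm (\<Sum>i\<in>{a..<b}. V i \<omega>)"
        by (simp add: norm_diff_ineq)
      then show "\<omega> \<in> R" using \<omega> by (auto simp: R_def E_def C_def)
    qed
    then show ?thesis using Rm finite_measure_mono by simp
  qed
  finally show ?thesis unfolding R_def .
qed

section \<open>Bounded smooth substitutes for tail indicators\<close>

lemma abs_tanh_le: "\<bar>tanh x\<bar> \<le> \<bar>x\<bar>" for x :: real
proof -
  have nonneg: "tanh y \<le> y" if "0 \<le> y" for y :: real
  proof -
    have "0 - tanh 0 \<le> y - tanh y"
    proof (rule DERIV_nonneg_imp_nondecreasing[OF that])
      fix x :: real
      have "((\<lambda>x. x - tanh x) has_real_derivative (tanh x)\<^sup>2) (at x)"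
        by (auto intro!: derivative_eq_intros)
      then show "\<exists>y. ((\<lambda>x. x - tanh x) has_real_derivative y) (at x) \<and> 0 \<le> y" by fastforce
    qed
    then show ?thesis by simp
  qed
  then show ?thesis using nonneg[of "\<bar>x\<bar>"] by simp
qed

text \<open>A smooth substitute for the indicator of \<open>norm x \<ge> 1 / c\<close>: bounded below there by a positive
  constant, and everywhere at most of order \<open>(c * norm x) ^ 4\<close>.\<close>
definition tanh_quartic :: "real \<Rightarrow> real ^ 'n \<Rightarrow> real" where
  "tanh_quartic c x = (\<Sum>i\<in>UNIV. tanh (c * x $ i) ^ 4)"

lemma tanh_quartic_le: "tanh_quartic c x \<le> c ^ 4 * real CARD('n) * norm x ^ 4" for x :: "real ^ 'n::finite"
proof -
  have "tanh (c * x $ i) ^ 4 \<le> c ^ 4 * norm x ^ 4" for i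
  proof -
    have "\<bar>tanh (c * x $ i)\<bar> \<le> \<bar>c\<bar> * norm x"
      using abs_tanh_le[of "c * x $ i"] mult_left_mono[OF component_le_norm_cart[of x i], of "\<bar>c\<bar>"]
      by (simp add: abs_mult)
    then have "\<bar>tanh (c * x $ i)\<bar> ^ 4 \<le> (\<bar>c\<bar> * norm x) ^ 4" by (rule power_mono) simp
    then show ?thesis by (simp add: power_mult_distrib power_even_abs)
  qed
  then have "tanh_quartic c x \<le> (\<Sum>i\<in>(UNIV::'n set). c ^ 4 * norm x ^ 4)"
    unfolding tanh_quartic_def by (intro sum_mono) auto
  then show ?thesis by (simp add: mult_ac)
qed

text \<open>Some coordinate of \<open>c *\<^sub>R x\<close> has modulus at least
  \<open>1 / CARD('n)\<close>, since otherwise the l1 norm, which dominates the Euclidean norm,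
  would be below one.\<close>

lemma tanh_quartic_ge:
  fixes x :: "real ^ 'n::finite"
  assumes "1 \<le> c * norm x" "0 \<le> c"
  shows "tanh (1 / real CARD('n)) ^ 4 \<le> tanh_quartic c x"
proof -
  have "\<exists>i. 1 / real CARD('n) \<le> \<bar>c * x $ i\<bar>"
  proof (rule ccontr)
    assume "\<nexists>i. 1 / real CARD('n) \<le> \<bar>c * x $ i\<bar>"
    then have "(\<Sum>i\<in>UNIV. \<bar>c * x $ i\<bar>) < (\<Sum>i\<in>(UNIV::'n set). 1 / real CARD('n))"
      by (intro sum_strict_mono) (auto simp: not_le)
    also have "\<dots> = 1" by simp
    finally have "c * (\<Sum>i\<in>UNIV. \<bar>x $ i\<bar>) < 1" using assms(2) by (simp add: abs_mult sum_distrib_left)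
    moreover have "c * norm x \<le> c * (\<Sum>i\<in>UNIV. \<bar>x $ i\<bar>)" by (intro mult_left_mono norm_le_l1_cart assms)
    ultimately show False using assms by simp
  qed
  then obtain i where i: "1 / real CARD('n) \<le> \<bar>c * x $ i\<bar>" by blast
  have "tanh (1 / real CARD('n)) ^ 4 \<le> tanh \<bar>c * x $ i\<bar> ^ 4" 
    by (intro power_mono tanh_real_le_iff[THEN iffD2] i) simp
  also have "\<dots> = tanh (c * x $ i) ^ 4" by (simp only: tanh_real_abs power_even_abs even_numeral)
  also have "\<dots> \<le> tanh_quartic c x" unfolding tanh_quartic_def by (rule member_le_sum) auto
  finally show ?thesis .
qed

lemma smooth_test_tanh_quartic: "smooth_test (\<lambda>x :: nat \<Rightarrow> real ^ 'n. tanh_quartic c (x j))"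
  unfolding tanh_quartic_def by (intro smooth_test_sum smooth_test_power smooth_test_tanh)

lemma continuous_tanh_quartic: "continuous_on UNIV (tanh_quartic c)"
  unfolding tanh_quartic_def by (intro continuous_intros) auto

lemma tanh_quartic_bounds: "0 \<le> tanh_quartic c x" "tanh_quartic c x \<le> real CARD('n)" for x :: "real ^ 'n"
proof -
  have "tanh (c * x $ i) ^ 4 \<le> 1" for i
  proof -
    have "\<bar>tanh (c * x $ i)\<bar> ^ 4 \<le> 1 ^ 4"
      using tanh_real_bounds[of "c * x $ i"] by (intro power_mono) auto
    then show ?thesis by (simp add: power_even_abs)
  qed
  then show "tanh_quartic c x \<le> real CARD('n)"
    unfolding tanh_quartic_def using sum_bounded_above[of UNIV "\<lambda>i. tanh (c * x $ i) ^ 4" 1] by simp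
  show "0 \<le> tanh_quartic c x" unfolding tanh_quartic_def by (intro sum_nonneg) auto
qed

section \<open>From smooth to continuous functions of finitely many positions\<close>

definition clamp_real :: "real \<Rightarrow> real \<Rightarrow> real" where
  "clamp_real L y = max (- L) (min L y)"

lemma smooth_test_approx_clamped:
  fixes G :: "(nat \<Rightarrow> real ^ 'n::finite) \<Rightarrow> real"
  assumes G: "continuous_on UNIV G" and L: "L > 0" and e: "e > 0"
  obtains F where "smooth_test F" "\<And>x. \<bar>F x - G (\<lambda>j. \<chi> i. clamp_real L (x j $ i))\<bar> \<le> e"
proof -
  \<comment> \<open>Clamping at \<open>tanh L < 1\<close> keeps \<open>artanh\<close> away from its
    poles, so \<open>a\<close> is continuous on the whole line; on values of tanh it returns the
    truncation at \<open>L\<close>.\<close>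
  define a where "a y = artanh (clamp_real (tanh L) y)" for y
  have tL: "0 < tanh L" "tanh L < 1" "- 1 < tanh L" using L tanh_real_bounds[of L] by auto
  have a: "a (tanh z) = clamp_real L z" for z
  proof -
    have "clamp_real (tanh L) (tanh z) = tanh (clamp_real L z)"
      using L tL by (auto simp: clamp_real_def max_def min_def tanh_real_le_iff simp flip: tanh_minus)
    then show ?thesis by (simp add: a_def artanh_tanh_real)
  qed
  have "continuous_on UNIV a"
    unfolding a_def clamp_real_def
    by (rule continuous_on_artanh') (use tL in \<open>auto intro!: continuous_intros\<close>)
  then have ac: "continuous_on UNIV (\<lambda>y :: nat \<Rightarrow> real ^ 'n. a (y j $ i))" for j i
    by (rule continuous_on_compose2)
      (auto intro!: bounded_linear.continuous_on[OF bounded_linear_vec_nth] continuous_on_product_coordinates)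
  have tanhc: "continuous_on UNIV (\<lambda>x :: nat \<Rightarrow> real ^ 'n. (\<lambda>j. \<chi> i. tanh (x j $ i)) :: nat \<Rightarrow> real ^ 'n)"
    by (intro continuous_on_coordinatewise_then_product continuous_on_vec_lambda continuous_intros
      bounded_linear.continuous_on[OF bounded_linear_vec_nth] continuous_on_product_coordinates) auto
  define H where "H y = G (\<lambda>j. \<chi> i. a (y j $ i))" for y :: "nat \<Rightarrow> real ^ 'n"
  have H: "continuous_on UNIV H"
    unfolding H_def
    by (rule continuous_on_compose2[OF G])
      (auto intro!: continuous_on_coordinatewise_then_product continuous_on_vec_lambda ac)
  define S where "S = (PiE UNIV (\<lambda>_. cbox (-1) 1) :: (nat \<Rightarrow> real ^ 'n) set)"
  have S: "compact S"
    using compactin_PiE[of "\<lambda>_. euclidean" UNIV "\<lambda>_ :: nat. cbox (-1) 1 :: (real ^ 'n) set"]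
    unfolding S_def by (simp add: euclidean_product_topology compact_cbox)
  \<comment> \<open>The algebra for Stone-Weierstrass consists of the \<open>p\<close> that become
    smooth tests after substituting tanh into each coordinate; the coordinate functions belong to it
    and separate points.\<close>
  define P where "P p \<longleftrightarrow> continuous_on UNIV p \<and> smooth_test (\<lambda>x :: nat \<Rightarrow> real ^ 'n. p ((\<lambda>j. \<chi> i. tanh (x j $ i)) :: nat \<Rightarrow> real ^ 'n) :: real)" for p
  have "\<exists>p. P p \<and> (\<forall>y\<in>S. \<bar>H y - p y\<bar> < e)"
  proof (rule Stone_Weierstrass_HOL[OF S])
    show "P (\<lambda>_. c)" for c unfolding P_def by (simp add: smooth_test_const)
    show "continuous_on S p" if "P p" for p using that continuous_on_subset unfolding P_def by blast
    show "P (\<lambda>x. p x + q x)" if "P p \<and> P q" for p q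
      using that unfolding P_def by (auto intro: continuous_on_add smooth_test_add)
    show "P (\<lambda>x. p x * q x)" if "P p \<and> P q" for p q
      using that unfolding P_def by (auto intro: continuous_on_mult smooth_test_mult)
    show "\<exists>p. P p \<and> p x \<noteq> p y" if xy: "x \<in> S \<and> y \<in> S \<and> x \<noteq> y" for x y
    proof -
      obtain j where "x j \<noteq> y j" using xy by (auto simp: fun_eq_iff)
      then obtain i where "x j $ i \<noteq> y j $ i" by (auto simp: vec_eq_iff)
      moreover have "P (\<lambda>x. x j $ i)"
        unfolding P_def using smooth_test_tanh[of 1 j i]
        by (auto intro!: bounded_linear.continuous_on[OF bounded_linear_vec_nth] continuous_on_product_coordinates)
      ultimately show ?thesis by blast
    qed
    show "continuous_on S H" using H continuous_on_subset by blast
  qed (use e in auto)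
  then obtain p where p: "P p" "\<And>y. y \<in> S \<Longrightarrow> \<bar>H y - p y\<bar> < e" by blast
  show thesis
  proof (rule that)
    show "smooth_test (\<lambda>x. p (\<lambda>j. \<chi> i. tanh (x j $ i)))" using p(1) by (simp add: P_def)
    fix x :: "nat \<Rightarrow> real ^ 'n"
    have "(\<lambda>j. \<chi> i. tanh (x j $ i)) \<in> S"
      unfolding S_def using tanh_real_bounds by (auto simp: mem_box_cart less_imp_le)
    from p(2)[OF this] show "\<bar>p (\<lambda>j. \<chi> i. tanh (x j $ i)) - G (\<lambda>j. \<chi> i. clamp_real L (x j $ i))\<bar> \<le> e"
      by (simp add: H_def a abs_minus_commute)
  qed
qed

lemma smooth_test_bounded: "smooth_test F \<Longrightarrow> \<exists>C. \<forall>x. \<bar>F x\<bar> \<le> C"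
proof -
  assume "smooth_test F"
  then obtain C where C: "\<And>x J. taylor2 C (\<lambda>h. F (\<lambda>j. x j + (if j \<in> J then h else 0)))"
    unfolding smooth_test_def by blast
  have "\<bar>F x\<bar> \<le> C" for x using C[of x "{}"] by (auto simp: taylor2_def)
  then show ?thesis by blast
qed

lemma bounded_continuous_path_functional_integrable:
  fixes X :: "nat \<Rightarrow> 'a \<Rightarrow> real ^ 'n" and G :: "(nat \<Rightarrow> real ^ 'n) \<Rightarrow> real"
  assumes "finite_measure M" "\<And>j. X j \<in> borel_measurable M" "continuous_on UNIV G" "\<And>x. \<bar>G x\<bar> \<le> C"
  shows "integrable M (\<lambda>\<omega>. G (\<lambda>j. X j \<omega>))"
proof -
  interpret finite_measure M by fact
  have "(\<lambda>\<omega> j. X j \<omega>) \<in> borel_measurable M"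
    by (rule measurable_coordinatewise_then_product) (rule assms(2))
  then have "(\<lambda>\<omega>. G (\<lambda>j. X j \<omega>)) \<in> borel_measurable M"
    by (rule borel_measurable_continuous_on[OF assms(3)])
  then show ?thesis by (rule integrable_const_bound[rotated]) (use assms(4) in auto)
qed

text \<open>Two moving sequences are compared, neither assumed to converge; the second moment bound
  \<open>D\<close>, uniform in \<open>n\<close>, supplies the tightness that controls the
  truncation.\<close>

lemma smooth_test_convergence_extend:
  fixes X :: "nat \<Rightarrow> nat \<Rightarrow> 'a \<Rightarrow> real ^ 'n::finite" and Y :: "nat \<Rightarrow> nat \<Rightarrow> 'b \<Rightarrow> real ^ 'n"
    and G :: "(nat \<Rightarrow> real ^ 'n) \<Rightarrow> real"
  assumes P: "prob_space M" "prob_space N"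
    and meas: "\<And>n j. X n j \<in> borel_measurable M" "\<And>n j. Y n j \<in> borel_measurable N"
    and conv: "\<And>F. smooth_test F \<Longrightarrow>
      (\<lambda>n. (\<integral>\<omega>. F (\<lambda>j. X n j \<omega>) \<partial>M) - (\<integral>\<omega>. F (\<lambda>j. Y n j \<omega>) \<partial>N)) \<longlonglongrightarrow> 0"
    and int: "\<And>n j. j \<le> m \<Longrightarrow> integrable M (\<lambda>\<omega>. (norm (X n j \<omega>))\<^sup>2)"
      "\<And>n j. j \<le> m \<Longrightarrow> integrable N (\<lambda>\<omega>. (norm (Y n j \<omega>))\<^sup>2)"
    and D: "\<And>n j. j \<le> m \<Longrightarrow> (\<integral>\<omega>. (norm (X n j \<omega>))\<^sup>2 \<partial>M) \<le> D"
      "\<And>n j. j \<le> m \<Longrightarrow> (\<integral>\<omega>. (norm (Y n j \<omega>))\<^sup>2 \<partial>N) \<le> D"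
    and G: "continuous_on UNIV G" "\<And>x. \<bar>G x\<bar> \<le> B" "\<And>x y. (\<And>j. j \<le> m \<Longrightarrow> x j = y j) \<Longrightarrow> G x = G y"
  shows "(\<lambda>n. (\<integral>\<omega>. G (\<lambda>j. X n j \<omega>) \<partial>M) - (\<integral>\<omega>. G (\<lambda>j. Y n j \<omega>) \<partial>N)) \<longlonglongrightarrow> 0"
proof (rule LIMSEQ_I)
  fix r :: real assume r: "r > 0"
  \<comment> \<open>Budget: \<open>2 * e\<close> for replacing \<open>G\<close> by \<open>F\<close>
    on either side and \<open>e\<close> for the smooth comparison, in total below
    \<open>r\<close>.\<close>
  define e where "e = r / 6"
  have e: "e > 0" using r by (simp add: e_def)
  have B: "0 \<le> B" using G(2) abs_ge_zero order_trans by blast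
  \<comment> \<open>Chosen to make \<open>2 * B / L\<^sup>2 * ((m + 1) * D)\<close>, the Chebyshev
    cost of the truncation, at most \<open>e\<close>; the summand \<open>1\<close> keeps
    \<open>L\<close> positive when the rest vanishes.\<close>
  define L where "L = sqrt (2 * B * (real m + 1) * \<bar>D\<bar> / e + 1)"
  have "0 \<le> 2 * B * (real m + 1) * \<bar>D\<bar> / e" using B e by simp
  then have L: "L > 0" "L\<^sup>2 = 2 * B * (real m + 1) * \<bar>D\<bar> / e + 1" by (simp_all add: L_def)
  have Le: "2 * B / L\<^sup>2 * ((real m + 1) * D) \<le> e"
  proof -
    have "2 * B * (real m + 1) * D \<le> 2 * B * (real m + 1) * \<bar>D\<bar>" using B by (intro mult_left_mono) auto
    also have "\<dots> \<le> e * L\<^sup>2" unfolding L using e by (simp add: field_simps)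
    finally show ?thesis using L(1) by (simp add: field_simps)
  qed
  obtain F where F: "smooth_test F" "\<And>x. \<bar>F x - G (\<lambda>j. \<chi> i. clamp_real L (x j $ i))\<bar> \<le> e"
    using smooth_test_approx_clamped[OF G(1) L(1) e] by blast
  \<comment> \<open>If all norms are at most \<open>L\<close>, truncation changes nothing that
    \<open>G\<close> sees. Otherwise one squared norm exceeds \<open>L\<^sup>2\<close>, and the last
    term is at least the trivial bound \<open>2 * B\<close>.\<close>
  have FG: "\<bar>F x - G x\<bar> \<le> e + 2 * B / L\<^sup>2 * (\<Sum>j\<le>m. (norm (x j))\<^sup>2)" for x
  proof (cases "\<forall>j\<le>m. norm (x j) \<le> L")
    case True
    have "G (\<lambda>j. \<chi> i. clamp_real L (x j $ i)) = G x"
    proof (rule G(3))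
      fix j assume "j \<le> m"
      then have "\<bar>x j $ i\<bar> \<le> L" for i using True component_le_norm_cart[of "x j" i] order_trans by blast
      then have "- L \<le> x j $ i \<and> x j $ i \<le> L" for i by (simp add: abs_le_iff minus_le_iff)
      then have "clamp_real L (x j $ i) = x j $ i" for i
        by (simp add: clamp_real_def)
      then show "(\<chi> i. clamp_real L (x j $ i)) = x j" by (simp add: vec_eq_iff)
    qed
    moreover have "0 \<le> 2 * B / L\<^sup>2 * (\<Sum>j\<le>m. (norm (x j))\<^sup>2)" using B by (simp add: sum_nonneg)
    ultimately show ?thesis using F(2)[of x] by simp
  next
    case False
    then obtain k where k: "k \<le> m" "L < norm (x k)" by force
    have "L\<^sup>2 \<le> (norm (x k))\<^sup>2" using k L by (intro power_mono) auto
    also have "\<dots> \<le> (\<Sum>j\<le>m. (norm (x j))\<^sup>2)" using k by (intro member_le_sum) auto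
    finally have "2 * B / L\<^sup>2 * L\<^sup>2 \<le> 2 * B / L\<^sup>2 * (\<Sum>j\<le>m. (norm (x j))\<^sup>2)"
      using B by (intro mult_left_mono) auto
    then have "2 * B \<le> 2 * B / L\<^sup>2 * (\<Sum>j\<le>m. (norm (x j))\<^sup>2)" using L(1) by simp
    then show ?thesis
      using F(2)[of x] G(2)[of "\<lambda>j. \<chi> i. clamp_real L (x j $ i)"] G(2)[of x] by linarith
  qed
  obtain C where C: "\<And>x. \<bar>F x\<bar> \<le> C" using smooth_test_bounded[OF F(1)] by blast
  have Fc: "continuous_on UNIV F" using F(1) by (simp add: smooth_test_def)
  have step: "\<bar>(\<integral>\<omega>. F (\<lambda>j. Z j \<omega>) \<partial>Q) - (\<integral>\<omega>. G (\<lambda>j. Z j \<omega>) \<partial>Q)\<bar> \<le> 2 * e"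
    if Q: "prob_space Q" and Z: "\<And>j. Z j \<in> borel_measurable Q" "\<And>j. j \<le> m \<Longrightarrow> integrable Q (\<lambda>\<omega>. (norm (Z j \<omega>))\<^sup>2)"
      "\<And>j. j \<le> m \<Longrightarrow> (\<integral>\<omega>. (norm (Z j \<omega>))\<^sup>2 \<partial>Q) \<le> D" for Q :: "'c measure" and Z :: "nat \<Rightarrow> 'c \<Rightarrow> real ^ 'n"
  proof -
    interpret prob_space Q by fact
    note I = bounded_continuous_path_functional_integrable[OF finite_measure_axioms Z(1)]
    have iF: "integrable Q (\<lambda>\<omega>. F (\<lambda>j. Z j \<omega>))" by (rule I[OF Fc C])
    have iG: "integrable Q (\<lambda>\<omega>. G (\<lambda>j. Z j \<omega>))" by (rule I[OF G(1,2)])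
    have iR: "integrable Q (\<lambda>\<omega>. e + 2 * B / L\<^sup>2 * (\<Sum>j\<le>m. (norm (Z j \<omega>))\<^sup>2))"
      using Z(2) by (intro Bochner_Integration.integrable_add integrable_mult_right Bochner_Integration.integrable_sum) auto
    have "\<bar>(\<integral>\<omega>. F (\<lambda>j. Z j \<omega>) \<partial>Q) - (\<integral>\<omega>. G (\<lambda>j. Z j \<omega>) \<partial>Q)\<bar> \<le> (\<integral>\<omega>. \<bar>F (\<lambda>j. Z j \<omega>) - G (\<lambda>j. Z j \<omega>)\<bar> \<partial>Q)"
      using iF iG integral_abs_bound[of Q "\<lambda>\<omega>. F (\<lambda>j. Z j \<omega>) - G (\<lambda>j. Z j \<omega>)"] by simp
    also have "\<dots> \<le> (\<integral>\<omega>. e + 2 * B / L\<^sup>2 * (\<Sum>j\<le>m. (norm (Z j \<omega>))\<^sup>2) \<partial>Q)"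
      using iF iG iR FG by (intro integral_mono) auto
    also have "\<dots> = e + 2 * B / L\<^sup>2 * (\<Sum>j\<le>m. \<integral>\<omega>. (norm (Z j \<omega>))\<^sup>2 \<partial>Q)"
    proof -
      have "integrable Q (\<lambda>\<omega>. \<Sum>j\<le>m. (norm (Z j \<omega>))\<^sup>2)"
        using Z(2) by (intro Bochner_Integration.integrable_sum) auto
      then show ?thesis
        using Z(2) by (simp add: prob_space Bochner_Integration.integral_sum)
    qed
    also have "\<dots> \<le> e + 2 * B / L\<^sup>2 * (\<Sum>j\<le>m. D)"
      using B Z(3) by (intro add_left_mono mult_left_mono sum_mono) auto
    also have "\<dots> \<le> 2 * e" using Le by (simp add: add.commute)
    finally show ?thesis .
  qed
  obtain n0 where n0: "\<And>n. n \<ge> n0 \<Longrightarrow> \<bar>(\<integral>\<omega>. F (\<lambda>j. X n j \<omega>) \<partial>M) - (\<integral>\<omega>. F (\<lambda>j. Y n j \<omega>) \<partial>N)\<bar> < e"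
    using LIMSEQ_D[OF conv[OF F(1)] e] by auto
  have "norm ((\<integral>\<omega>. G (\<lambda>j. X n j \<omega>) \<partial>M) - (\<integral>\<omega>. G (\<lambda>j. Y n j \<omega>) \<partial>N) - 0) < r" if "n \<ge> n0" for n
    using n0[OF that] step[OF P(1), of "X n", OF meas(1) int(1) D(1)] step[OF P(2), of "Y n", OF meas(2) int(2) D(2)]
    unfolding e_def real_norm_def by linarith
  then show "\<exists>n0. \<forall>n\<ge>n0. norm ((\<integral>\<omega>. G (\<lambda>j. X n j \<omega>) \<partial>M) - (\<integral>\<omega>. G (\<lambda>j. Y n j \<omega>) \<partial>N) - 0) < r"
    by blast
qed

section \<open>The walk and the Brownian motion\<close>

locale walk_and_brownian =
  fixes M :: "'a measure" and N :: "'b measure"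
    and \<zeta> :: "nat \<Rightarrow> 'a \<Rightarrow> real ^ 'n::finite" and b :: "real \<Rightarrow> 'b \<Rightarrow> real ^ 'n" and B :: "real ^ 'n ^ 'n"
  assumes M: "prob_space M"
    and indep: "prob_space.indep_vars M (\<lambda>_. borel) \<zeta> UNIV"
    and distr: "\<And>i. distr M borel (\<zeta> i) = distr M borel (\<zeta> 0)"
    and mean: "\<And>p. (\<integral>\<omega>. \<zeta> 0 \<omega> $ p \<partial>M) = 0"
    and int: "integrable M (\<lambda>\<omega>. (norm (\<zeta> 0 \<omega>))\<^sup>2)"
    and cov: "\<And>p q. (\<integral>\<omega>. \<zeta> 0 \<omega> $ p * \<zeta> 0 \<omega> $ q \<partial>M) = (B ** transpose B) $ p $ q"
    and bm: "standard_brownian_motion N b"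
begin

sublocale M: prob_space M by (rule M)
sublocale N: prob_space N using bm by (simp add: standard_brownian_motion_def)

definition V :: "nat \<Rightarrow> nat \<Rightarrow> 'a \<Rightarrow> real ^ 'n" where
  "V n i \<omega> = (1 / sqrt (real n)) *\<^sub>R \<zeta> i \<omega>"

text \<open>The image of the Brownian increment over the \<open>i\<close>-th time step of length
  \<open>1 / n\<close>; for positive \<open>n\<close> it matches \<open>V n i\<close> in mean and
  covariance.\<close>

definition W :: "nat \<Rightarrow> nat \<Rightarrow> 'b \<Rightarrow> real ^ 'n" where
  "W n i \<omega> = B *v (b (real (Suc i) / real n) \<omega> - b (real i / real n) \<omega>)"

definition "var\<zeta> = (\<integral>\<omega>. (norm (\<zeta> 0 \<omega>))\<^sup>2 \<partial>M)"
definition "op_norm = onorm ((*v) B)"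
definition "W_bound2 = op_norm\<^sup>2 * CARD('n)"
definition "W_bound4 = 3 * op_norm ^ 4 * (CARD('n))\<^sup>2"

lemma op_norm: "norm (B *v x) \<le> op_norm * norm x"
  unfolding op_norm_def by (rule onorm[OF matrix_vector_mul_bounded_linear])

lemma constants_nonneg: "0 \<le> var\<zeta>" "0 \<le> W_bound2" "0 \<le> W_bound4"
proof -
  have "0 \<le> op_norm" unfolding op_norm_def by (rule onorm_pos_le[OF matrix_vector_mul_bounded_linear])
  then show "0 \<le> var\<zeta>" "0 \<le> W_bound2" "0 \<le> W_bound4" by (simp_all add: var\<zeta>_def W_bound2_def W_bound4_def)
qed

lemma \<zeta>_measurable[measurable]: "\<zeta> i \<in> borel_measurable M"
  using indep by (simp add: M.indep_vars_def)

lemma \<zeta>_transfer: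
  fixes f :: "real ^ 'n \<Rightarrow> real"
  assumes "f \<in> borel_measurable borel"
  shows "integrable M (\<lambda>\<omega>. f (\<zeta> i \<omega>)) \<longleftrightarrow> integrable M (\<lambda>\<omega>. f (\<zeta> 0 \<omega>))"
    "(\<integral>\<omega>. f (\<zeta> i \<omega>) \<partial>M) = (\<integral>\<omega>. f (\<zeta> 0 \<omega>) \<partial>M)"
  using integrable_distr_eq[OF \<zeta>_measurable assms, of i] integrable_distr_eq[OF \<zeta>_measurable assms, of 0]
    integral_distr[OF \<zeta>_measurable assms, of i] integral_distr[OF \<zeta>_measurable assms, of 0]
  by (simp_all add: distr[of i])

lemma V_measurable[measurable]: "V n i \<in> borel_measurable M"
  unfolding V_def by measurable

lemma V_indep: "M.indep_vars (\<lambda>_. borel) (V n) UNIV"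
proof -
  have "(\<lambda>x :: real ^ 'n. (1 / sqrt (real n)) *\<^sub>R x) \<in> borel_measurable borel" by measurable
  then show ?thesis unfolding V_def by (rule M.indep_vars_compose2[OF indep])
qed

lemma V_norm2: "(norm (V n i \<omega>))\<^sup>2 = (1 / real n) * (norm (\<zeta> i \<omega>))\<^sup>2"
  by (simp add: V_def power_mult_distrib power_divide)

lemma V_moments:
  "(\<integral>\<omega>. V n i \<omega> $ p \<partial>M) = 0"
  "(\<integral>\<omega>. V n i \<omega> $ p * V n i \<omega> $ q \<partial>M) = (1 / real n) * (B ** transpose B) $ p $ q"
  "integrable M (\<lambda>\<omega>. (norm (V n i \<omega>))\<^sup>2)"
  "(\<integral>\<omega>. (norm (V n i \<omega>))\<^sup>2 \<partial>M) = var\<zeta> / real n"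
proof -
  have m1: "(\<lambda>x :: real ^ 'n. x $ p) \<in> borel_measurable borel"
    and m2: "(\<lambda>x :: real ^ 'n. x $ p * x $ q) \<in> borel_measurable borel"
    and m3: "(\<lambda>x :: real ^ 'n. (norm x)\<^sup>2) \<in> borel_measurable borel" by measurable
  show "(\<integral>\<omega>. V n i \<omega> $ p \<partial>M) = 0"
    using \<zeta>_transfer(2)[OF m1, of i] mean[of p] by (simp add: V_def)
  have "V n i \<omega> $ p * V n i \<omega> $ q = (1 / real n) * (\<zeta> i \<omega> $ p * \<zeta> i \<omega> $ q)" for \<omega>
    by (simp add: V_def mult_ac flip: real_sqrt_mult)
  then show "(\<integral>\<omega>. V n i \<omega> $ p * V n i \<omega> $ q \<partial>M) = (1 / real n) * (B ** transpose B) $ p $ q"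
    using \<zeta>_transfer(2)[OF m2, of i] cov[of p q] by simp
  show "integrable M (\<lambda>\<omega>. (norm (V n i \<omega>))\<^sup>2)"
    unfolding V_norm2 using \<zeta>_transfer(1)[OF m3, of i] int by (intro integrable_mult_right) simp
  show "(\<integral>\<omega>. (norm (V n i \<omega>))\<^sup>2 \<partial>M) = var\<zeta> / real n"
    unfolding V_norm2 using \<zeta>_transfer(2)[OF m3, of i] by (simp add: var\<zeta>_def)
qed

lemma b_measurable: "0 \<le> t \<Longrightarrow> b t \<in> borel_measurable N"
  and b_zero: "\<omega> \<in> space N \<Longrightarrow> b 0 \<omega> = 0"
  and b_continuous: "\<omega> \<in> space N \<Longrightarrow> continuous_on {0..} (\<lambda>t. b t \<omega>)"
  and b_gauss: "0 \<le> s \<Longrightarrow> s < t \<Longrightarrow> distributed N lborel (\<lambda>\<omega>. b t \<omega> - b s \<omega>)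
          (\<lambda>x. ennreal (\<Prod>i\<in>UNIV. normal_density 0 (sqrt (t - s)) (x $ i)))"
  using bm by (auto simp: standard_brownian_motion_def)

lemma Bb_measurable: "0 \<le> t \<Longrightarrow> (\<lambda>\<omega>. B *v b t \<omega>) \<in> borel_measurable N"
  using borel_measurable_continuous_on[OF matrix_vector_mult_linear_continuous_on b_measurable] .

lemma W_measurable[measurable]: "W n i \<in> borel_measurable N"
  unfolding W_def matrix_vector_mult_diff_distrib using Bb_measurable by auto

lemma W_indep: "N.indep_vars (\<lambda>_. borel) (W n) {..<k}"
proof -
  have mono: "mono (\<lambda>i. real i / real n)" by (intro monoI divide_right_mono) auto
  have all: "0 \<le> t 0 \<and> mono t \<longrightarrow> (\<forall>k. N.indep_vars (\<lambda>_. borel) (\<lambda>i \<omega>. b (t (Suc i)) \<omega> - b (t i) \<omega>) {..<k})" for t :: "nat \<Rightarrow> real"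
    using bm by (auto simp: standard_brownian_motion_def)
  have ind: "N.indep_vars (\<lambda>_. borel) (\<lambda>i \<omega>. b (real (Suc i) / real n) \<omega> - b (real i / real n) \<omega>) {..<k}"
    using all[of "\<lambda>i. real i / real n"] mono by simp
  have "(\<lambda>x. B *v x) \<in> borel_measurable borel"
    by (intro borel_measurable_continuous_onI matrix_vector_mult_linear_continuous_on)
  then show ?thesis unfolding W_def by (rule N.indep_vars_compose2[OF ind])
qed

lemma W_moments:
  assumes "n > 0"
  shows "(\<integral>\<omega>. W n i \<omega> $ p \<partial>N) = 0"
    "(\<integral>\<omega>. W n i \<omega> $ p * W n i \<omega> $ q \<partial>N) = (1 / real n) * (B ** transpose B) $ p $ q"
    "integrable N (\<lambda>\<omega>. (norm (W n i \<omega>))\<^sup>2)" "(\<integral>\<omega>. (norm (W n i \<omega>))\<^sup>2 \<partial>N) \<le> W_bound2 / real n"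
    "integrable N (\<lambda>\<omega>. norm (W n i \<omega>) ^ 4)" "(\<integral>\<omega>. norm (W n i \<omega>) ^ 4 \<partial>N) \<le> W_bound4 / (real n)\<^sup>2"
proof -
  have lt: "0 \<le> real i / real n" "real i / real n < real (Suc i) / real n" using assms by (auto simp: divide_strict_right_mono)
  have d: "real (Suc i) / real n - real i / real n = 1 / real n" by (simp add: diff_divide_distrib[symmetric])
  have "1 / real n > 0" using assms by simp
  note G = gaussian_image_moments[OF b_gauss[OF lt, unfolded d] this op_norm, folded W_def]
  show "(\<integral>\<omega>. W n i \<omega> $ p \<partial>N) = 0"
    "(\<integral>\<omega>. W n i \<omega> $ p * W n i \<omega> $ q \<partial>N) = (1 / real n) * (B ** transpose B) $ p $ q"
    "integrable N (\<lambda>\<omega>. (norm (W n i \<omega>))\<^sup>2)" "(\<integral>\<omega>. (norm (W n i \<omega>))\<^sup>2 \<partial>N) \<le> W_bound2 / real n"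
    "integrable N (\<lambda>\<omega>. norm (W n i \<omega>) ^ 4)" "(\<integral>\<omega>. norm (W n i \<omega>) ^ 4 \<partial>N) \<le> W_bound4 / (real n)\<^sup>2"
    using G by (simp_all add: W_bound2_def W_bound4_def power_divide)
qed

lemma W_sum: "\<omega> \<in> space N \<Longrightarrow> s \<le> t \<Longrightarrow> (\<Sum>i\<in>{s..<t}. W n i \<omega>) = B *v (b (real t / real n) \<omega> - b (real s / real n) \<omega>)"
  unfolding W_def matrix_vector_mult_diff_distrib
  by (rule sum_Suc_diff')

text \<open>Each swap costs \<open>o(1 / n)\<close> and there are \<open>n\<close> of them. The sets
  \<open>A n j\<close> may vary with \<open>n\<close>, because the error bound depends on the
  increments only and not on how they are grouped into positions.\<close>

lemma lindeberg_convergence: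
  assumes F: "smooth_test F" and A: "\<And>n j. A n j \<subseteq> {..<n}"
  shows "(\<lambda>n. (\<integral>\<omega>. F (\<lambda>j. \<Sum>i\<in>A n j. V n i \<omega>) \<partial>M) - (\<integral>\<omega>. F (\<lambda>j. \<Sum>i\<in>A n j. W n i \<omega>) \<partial>N)) \<longlonglongrightarrow> 0"
proof -
  obtain C where C: "\<And>x J. taylor2 C (\<lambda>h. F (\<lambda>j. x j + (if j \<in> J then h else 0)))" and Fc: "continuous_on UNIV F"
    using F unfolding smooth_test_def by blast
  have C0: "0 \<le> C" using taylor2_nonneg[OF C] .
  \<comment> \<open>\<open>v n / n\<close> is the truncated third moment of one scaled increment;
    \<open>v\<close> tends to zero by dominated convergence with the squared norm as
    majorant.\<close>
  define v where "v n = (\<integral>\<omega>. min ((norm (\<zeta> 0 \<omega>))\<^sup>2) (norm (\<zeta> 0 \<omega>) ^ 3 / sqrt (real n)) \<partial>M)" for n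
  have v: "v \<longlonglongrightarrow> 0"
  proof -
    have "v \<longlonglongrightarrow> (\<integral>\<omega>. 0 \<partial>M)" unfolding v_def
    proof (rule integral_dominated_convergence[OF _ _ int])
      show "AE \<omega> in M. (\<lambda>n. min ((norm (\<zeta> 0 \<omega>))\<^sup>2) (norm (\<zeta> 0 \<omega>) ^ 3 / sqrt (real n))) \<longlonglongrightarrow> 0"
      proof (rule AE_I2)
        fix \<omega>
        have "(\<lambda>n. norm (\<zeta> 0 \<omega>) ^ 3 / sqrt (real n)) \<longlonglongrightarrow> 0"
          by (intro tendsto_divide_0[OF tendsto_const] filterlim_at_top_imp_at_infinity
              filterlim_compose[OF sqrt_at_top filterlim_real_sequentially])
        then have "(\<lambda>n. min ((norm (\<zeta> 0 \<omega>))\<^sup>2) (norm (\<zeta> 0 \<omega>) ^ 3 / sqrt (real n))) \<longlonglongrightarrow> min ((norm (\<zeta> 0 \<omega>))\<^sup>2) 0"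
          by (intro tendsto_min tendsto_const)
        then show "(\<lambda>n. min ((norm (\<zeta> 0 \<omega>))\<^sup>2) (norm (\<zeta> 0 \<omega>) ^ 3 / sqrt (real n))) \<longlonglongrightarrow> 0" by simp
      qed
    qed (auto simp: min_def)
    then show ?thesis by simp
  qed
  have bound: "norm ((\<integral>\<omega>. F (\<lambda>j. \<Sum>i\<in>A n j. V n i \<omega>) \<partial>M) - (\<integral>\<omega>. F (\<lambda>j. \<Sum>i\<in>A n j. W n i \<omega>) \<partial>N))
      \<le> 4 * C * (v n + (W_bound2 + W_bound4) / sqrt (real n))" if n: "n > 0" for n
  proof -
    have Vi: "(\<integral>\<omega>. min ((norm (V n k \<omega>))\<^sup>2) (norm (V n k \<omega>) ^ 3) \<partial>M) = v n / real n" for k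
    proof -
      have "min ((norm (V n k \<omega>))\<^sup>2) (norm (V n k \<omega>) ^ 3) = (1 / real n) * min ((norm (\<zeta> k \<omega>))\<^sup>2) (norm (\<zeta> k \<omega>) ^ 3 / sqrt (real n))" for \<omega>
      proof -
        have "norm (V n k \<omega>) ^ 3 = (1 / real n) * (norm (\<zeta> k \<omega>) ^ 3 / sqrt (real n))"
          by (simp add: V_def power_mult_distrib power_divide power3_eq_cube)
        then show ?thesis unfolding V_norm2 using n by (simp add: min_mult_distrib_left)
      qed
      moreover have "(\<lambda>x :: real ^ 'n. min ((norm x)\<^sup>2) (norm x ^ 3 / sqrt (real n))) \<in> borel_measurable borel" by measurable
      from \<zeta>_transfer(2)[OF this, of k]
      have "(\<integral>\<omega>. min ((norm (\<zeta> k \<omega>))\<^sup>2) (norm (\<zeta> k \<omega>) ^ 3 / sqrt (real n)) \<partial>M) = v n" unfolding v_def .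
      ultimately show ?thesis by simp
    qed
    have Wi: "(\<integral>\<omega>. min ((norm (W n k \<omega>))\<^sup>2) (norm (W n k \<omega>) ^ 3) \<partial>N) \<le> ((W_bound2 + W_bound4) / sqrt (real n)) / real n" for k
    proof -
      define s where "s = sqrt (real n)"
      have s: "s > 0" "s\<^sup>2 = real n" using n by (auto simp: s_def)
      \<comment> \<open>Interpolates the cube between the square and the fourth power. With
        \<open>s = sqrt n\<close> both terms have expectation of order \<open>n powr (-3/2)\<close>,
        which \<open>n\<close> summands turn into \<open>1 / sqrt n\<close>.\<close>
      have le: "min (x\<^sup>2) (x ^ 3) \<le> x\<^sup>2 / s + s * x ^ 4" for x :: real
      proof (cases "s * x \<le> 1")
        case True
        then have "x \<le> 1 / s" using s by (simp add: field_simps)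
        then have "x ^ 3 \<le> x\<^sup>2 / s"
          using mult_left_mono[of x "1 / s" "x\<^sup>2"] by (simp add: power3_eq_cube power2_eq_square)
        moreover have "0 \<le> s * x ^ 4" using s by simp
        ultimately show ?thesis by linarith
      next
        case False
        then have x: "x > 0" using s by (smt (verit) mult_nonneg_nonpos)
        have "x ^ 3 * 1 \<le> x ^ 3 * (s * x)" using False x by (intro mult_left_mono) auto
        then have "x ^ 3 \<le> s * x ^ 4" by (simp add: power4_eq_xxxx power3_eq_cube mult_ac)
        moreover have "0 \<le> x\<^sup>2 / s" using s by simp
        ultimately show ?thesis by linarith
      qed
      note Wm = W_moments[OF n, of k]
      have "(\<integral>\<omega>. min ((norm (W n k \<omega>))\<^sup>2) (norm (W n k \<omega>) ^ 3) \<partial>N) \<le> (\<integral>\<omega>. (norm (W n k \<omega>))\<^sup>2 / s + s * norm (W n k \<omega>) ^ 4 \<partial>N)"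
      proof (rule integral_mono)
        show "integrable N (\<lambda>\<omega>. min ((norm (W n k \<omega>))\<^sup>2) (norm (W n k \<omega>) ^ 3))"
          by (rule Bochner_Integration.integrable_bound[OF Wm(3)]) (auto simp: min_def)
      qed (use Wm le in auto)
      also have "\<dots> \<le> (W_bound2 / real n) / s + s * (W_bound4 / (real n)\<^sup>2)"
      proof -
        have "(\<integral>\<omega>. (norm (W n k \<omega>))\<^sup>2 / s + s * norm (W n k \<omega>) ^ 4 \<partial>N)
          = (\<integral>\<omega>. (norm (W n k \<omega>))\<^sup>2 \<partial>N) / s + s * (\<integral>\<omega>. norm (W n k \<omega>) ^ 4 \<partial>N)"
          using Wm by simp
        also have "\<dots> \<le> (W_bound2 / real n) / s + s * (W_bound4 / (real n)\<^sup>2)"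
          using Wm(4,6) s by (intro add_mono divide_right_mono mult_left_mono) auto
        finally show ?thesis .
      qed
      also have "\<dots> = ((W_bound2 + W_bound4) / s) / real n"
        using n s by (simp add: field_simps power2_eq_square)
      finally show ?thesis unfolding s_def .
    qed
    have "\<bar>(\<integral>\<omega>. F (\<lambda>j. \<Sum>i\<in>A n j. V n i \<omega>) \<partial>M) - (\<integral>\<omega>. F (\<lambda>j. \<Sum>i\<in>A n j. W n i \<omega>) \<partial>N)\<bar>
      \<le> (\<Sum>k<n. 4 * C * ((\<integral>\<omega>. min ((norm (V n k \<omega>))\<^sup>2) (norm (V n k \<omega>) ^ 3) \<partial>M)
        + (\<integral>\<omega>. min ((norm (W n k \<omega>))\<^sup>2) (norm (W n k \<omega>) ^ 3) \<partial>N)))"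
      using V_moments[of n] W_moments[OF n]
      by (intro lindeberg_swap M N.prob_space_axioms M.indep_vars_subset[OF V_indep] W_indep Fc C A) auto
    also have "\<dots> \<le> (\<Sum>k<n. 4 * C * (v n / real n + ((W_bound2 + W_bound4) / sqrt (real n)) / real n))"
      using C0 Wi by (intro sum_mono mult_left_mono add_mono) (auto simp: Vi)
    also have "\<dots> = 4 * C * (v n + (W_bound2 + W_bound4) / sqrt (real n))"
      using n by (simp add: field_simps)
    finally show ?thesis by simp
  qed
  have "(\<lambda>n. 4 * C * (v n + (W_bound2 + W_bound4) / sqrt (real n))) \<longlonglongrightarrow> 4 * C * (0 + 0)"
    by (intro tendsto_intros v tendsto_divide_0[OF tendsto_const] filterlim_at_top_imp_at_infinity
              filterlim_compose[OF sqrt_at_top filterlim_real_sequentially])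
  then have lim: "(\<lambda>n. 4 * C * (v n + (W_bound2 + W_bound4) / sqrt (real n))) \<longlonglongrightarrow> 0" by simp
  show ?thesis
  proof (rule tendsto_0_le[OF lim, where K = 1])
    show "\<forall>\<^sub>F n in sequentially. norm ((\<integral>\<omega>. F (\<lambda>j. \<Sum>i\<in>A n j. V n i \<omega>) \<partial>M) - (\<integral>\<omega>. F (\<lambda>j. \<Sum>i\<in>A n j. W n i \<omega>) \<partial>N))
       \<le> norm (4 * C * (v n + (W_bound2 + W_bound4) / sqrt (real n))) * 1"
      using eventually_gt_at_top[of 0] 
    proof eventually_elim
      case (elim n)
      show ?case using bound[OF elim] by simp
    qed
  qed
qed

lemma V_sum_second_moment:
  assumes "finite A"
  shows "integrable M (\<lambda>\<omega>. (norm (\<Sum>i\<in>A. V n i \<omega>))\<^sup>2)"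
    "(\<integral>\<omega>. (norm (\<Sum>i\<in>A. V n i \<omega>))\<^sup>2 \<partial>M) = real (card A) * var\<zeta> / real n"
  using M.indep_sum_second_moment[OF V_indep assms, of n] V_moments[of n] by auto

lemma W_sum_second_moment:
  assumes "A \<subseteq> {..<n}"
  shows "integrable N (\<lambda>\<omega>. (norm (\<Sum>i\<in>A. W n i \<omega>))\<^sup>2)"
    "(\<integral>\<omega>. (norm (\<Sum>i\<in>A. W n i \<omega>))\<^sup>2 \<partial>N) \<le> W_bound2"
proof -
  have fin: "finite A" using assms finite_subset by blast
  have "integrable N (\<lambda>\<omega>. (norm (\<Sum>i\<in>A. W n i \<omega>))\<^sup>2) \<and> (\<integral>\<omega>. (norm (\<Sum>i\<in>A. W n i \<omega>))\<^sup>2 \<partial>N) \<le> W_bound2"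
  proof (cases "n = 0")
    case True
    then show ?thesis using assms constants_nonneg by auto
  next
    case False
    then have n: "n > 0" by simp
    note * = N.indep_sum_second_moment[OF W_indep fin assms W_moments(3)[OF n] W_moments(1)[OF n]]
    have "(\<Sum>i\<in>A. \<integral>\<omega>. (norm (W n i \<omega>))\<^sup>2 \<partial>N) \<le> (\<Sum>i\<in>{..<n}. W_bound2 / real n)"
      using W_moments(4)[OF n] constants_nonneg n assms
      by (intro order_trans[OF sum_mono sum_mono2]) auto
    also have "\<dots> = W_bound2" using n by simp
    finally show ?thesis using * by simp
  qed
  then show "integrable N (\<lambda>\<omega>. (norm (\<Sum>i\<in>A. W n i \<omega>))\<^sup>2)"
    "(\<integral>\<omega>. (norm (\<Sum>i\<in>A. W n i \<omega>))\<^sup>2 \<partial>N) \<le> W_bound2" by auto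
qed

text \<open>The value beyond \<open>m\<close> is irrelevant; it keeps all grid points in \<open>{0..n}\<close>.\<close>
definition grid :: "nat \<Rightarrow> nat \<Rightarrow> nat \<Rightarrow> nat" where
  "grid m n j = (if j \<le> m then (n * j) div m else n)"

lemma grid_le: "grid m n j \<le> n"
proof (cases "m = 0 \<or> \<not> j \<le> m")
  case False
  then have "(n * j) div m \<le> (n * m) div m" by (intro div_le_mono) auto
  then show ?thesis using False by (simp add: grid_def)
qed (auto simp: grid_def)

text \<open>The integrand is a continuous function of \<open>m + 1\<close> positions, and every
  partial sum has second moment bounded independently of \<open>n\<close>, as the transfer from
  smooth tests requires.\<close>

lemma fdd_convergence:
  fixes f :: "'n body0 \<Rightarrow> real"
  assumes f: "continuous_on UNIV f" "\<And>K. \<bar>f K\<bar> \<le> c"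
  shows "(\<lambda>n. (\<integral>\<omega>. f (vertex_hull m (\<lambda>j. \<Sum>i<grid m n j. V n i \<omega>)) \<partial>M)
     - (\<integral>\<omega>. f (vertex_hull m (\<lambda>j. \<Sum>i<grid m n j. W n i \<omega>)) \<partial>N)) \<longlonglongrightarrow> 0"
proof -
  have G: "continuous_on UNIV (\<lambda>x. f (vertex_hull m x))"
    by (rule continuous_on_compose2[OF f(1) continuous_vertex_hull]) auto
  have sub: "{..<grid m n j} \<subseteq> {..<n}" for n j using grid_le[of m n j] by auto
  show ?thesis
  proof (rule smooth_test_convergence_extend[OF M N.prob_space_axioms _ _ lindeberg_convergence, where D = "max var\<zeta> W_bound2" and G = "\<lambda>x. f (vertex_hull m x)" and B = c and m = m])
    show "(\<integral>\<omega>. (norm (\<Sum>i<grid m n j. V n i \<omega>))\<^sup>2 \<partial>M) \<le> max var\<zeta> W_bound2" for n j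
    proof -
      have "real (grid m n j) * var\<zeta> / real n \<le> real n * var\<zeta> / real n"
        using grid_le[of m n j] constants_nonneg by (intro divide_right_mono mult_right_mono) auto
      also have "\<dots> \<le> var\<zeta>" using constants_nonneg by (cases "n = 0") auto
      finally show ?thesis by (simp add: V_sum_second_moment)
    qed
    show "(\<integral>\<omega>. (norm (\<Sum>i<grid m n j. W n i \<omega>))\<^sup>2 \<partial>N) \<le> max var\<zeta> W_bound2" for n j
      using W_sum_second_moment(2)[OF sub] by (simp add: le_max_iff_disj)
    show "f (vertex_hull m x) = f (vertex_hull m y)" if "\<And>j. j \<le> m \<Longrightarrow> x j = y j" for x y
      using vertex_hull_cong[of m x y] that by simp
  qed (use G f sub W_sum_second_moment(1)[OF sub] in \<open>auto simp: V_sum_second_moment\<close>)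
qed

end

section \<open>Skeletons\<close>

text \<open>The least \<open>j\<close> with \<open>k \<le> g (Suc j)\<close> works: minimality gives
  \<open>g j < k\<close> when \<open>j\<close> is positive, and otherwise
  \<open>g 0 = 0\<close>.\<close>

lemma grid_cell:
  fixes g :: "nat \<Rightarrow> nat"
  assumes "g 0 = 0" "k \<le> g m" "0 < m"
  shows "\<exists>j<m. g j \<le> k \<and> k \<le> g (Suc j)"
proof -
  define j where "j = (LEAST j. k \<le> g (Suc j))"
  have ex: "k \<le> g (Suc (m - 1))" using assms by simp
  have j: "k \<le> g (Suc j)" unfolding j_def using ex by (rule LeastI)
  have "j \<le> m - 1" unfolding j_def using ex by (rule Least_le)
  moreover have "g j \<le> k"
  proof (cases j)
    case (Suc l)
    then have "\<not> k \<le> g (Suc l)" unfolding j_def by (intro not_less_Least) (use Suc j_def in auto)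
    then show ?thesis using Suc by simp
  qed (use assms in simp)
  ultimately show ?thesis using j assms(3) by (intro exI[of _ j]) auto
qed

lemma (in prob_space) borel_measurable_bounded_continuous_integrable:
  fixes f :: "'s :: metric_space \<Rightarrow> real"
  assumes "continuous_on UNIV f" "\<And>x. \<bar>f x\<bar> \<le> c" "X \<in> borel_measurable M"
  shows "integrable M (\<lambda>\<omega>. f (X \<omega>))"
  by (rule integrable_const_bound[of _ c])
    (use assms borel_measurable_continuous_on[OF assms(1,3)] in auto)

lemma (in prob_space) integral_tendsto_pathwise:
  fixes f :: "'s :: metric_space \<Rightarrow> real"
  assumes f: "continuous_on UNIV f" "\<And>x. \<bar>f x\<bar> \<le> c"
    and X: "\<And>n. X n \<in> borel_measurable M" and Y: "Y \<in> borel_measurable M"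
    and lim: "\<And>\<omega>. \<omega> \<in> space M \<Longrightarrow> (\<lambda>n. X n \<omega>) \<longlonglongrightarrow> Y \<omega>"
  shows "(\<lambda>n. \<integral>\<omega>. f (X n \<omega>) \<partial>M) \<longlonglongrightarrow> (\<integral>\<omega>. f (Y \<omega>) \<partial>M)"
proof (rule integral_dominated_convergence[where w = "\<lambda>_. c"])
  show "AE \<omega> in M. (\<lambda>n. f (X n \<omega>)) \<longlonglongrightarrow> f (Y \<omega>)"
    using lim continuous_on_tendsto_compose[OF f(1)] by (intro AE_I2) auto
qed (use f borel_measurable_continuous_on[OF f(1)] X Y in auto)

context walk_and_brownian
begin

text \<open>Rounding down lengthens a block by at most one step, and \<open>m \<le> n\<close> makes
  one step at most \<open>n / m\<close>; hence the factor \<open>2\<close>.\<close>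

lemma grid_step:
  assumes "0 < m" "m \<le> n" "j < m"
  shows "grid m n j \<le> grid m n (Suc j)" "real (grid m n (Suc j)) - real (grid m n j) \<le> 2 * real n / real m"
proof -
  have g: "grid m n j = n * j div m" "grid m n (Suc j) = n * Suc j div m" using assms by (auto simp: grid_def)
  show "grid m n j \<le> grid m n (Suc j)" unfolding g by (intro div_le_mono) auto
  have "real (n * Suc j div m) \<le> real (n * Suc j) / real m" by (rule of_nat_div_le_of_nat)
  moreover have "real (n * j) / real m \<le> real (n * j div m) + 1"
    using divide_nat_diff_div_nat_less_one[of "n * j" m] by linarith
  moreover have "real (n * Suc j) / real m = real (n * j) / real m + real n / real m"
    by (simp add: algebra_simps add_divide_distrib)
  moreover have "1 \<le> real n / real m" using assms by simp
  moreover have "2 * real n / real m = real n / real m + real n / real m" by simp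
  ultimately show "real (grid m n (Suc j)) - real (grid m n j) \<le> 2 * real n / real m"
    unfolding g by linarith
qed

lemma grid_ends: "0 < m \<Longrightarrow> grid m n 0 = 0" "0 < m \<Longrightarrow> grid m n m = n"
  by (auto simp: grid_def)

definition "walk n \<omega> = vertex_hull n (\<lambda>k. \<Sum>i<k. V n i \<omega>)"
definition "walk_skeleton m n \<omega> = vertex_hull m (\<lambda>j. \<Sum>i<grid m n j. V n i \<omega>)"
definition "brownian_skeleton m \<omega> = vertex_hull m (\<lambda>j. B *v b (real j / real m) \<omega>)"
text \<open>\<open>B\<close> is applied to the path before the hull is taken, so that skeletons and
  limit are compared as hulls of point sets; \<open>matrix_image_hull_body\<close> recovers the
  image of the hull.\<close>

definition "brownian_hull \<omega> = hull_body ((\<lambda>t. B *v b t \<omega>) ` {0..1})"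

lemma walk_measurable: "walk n \<in> borel_measurable M" "walk_skeleton m n \<in> borel_measurable M"
  unfolding walk_def walk_skeleton_def by (intro borel_measurable_vertex_hull; measurable)+

lemma brownian_skeleton_measurable: "brownian_skeleton m \<in> borel_measurable N"
  unfolding brownian_skeleton_def by (intro borel_measurable_vertex_hull Bb_measurable) simp

section \<open>Pathwise limits on the Brownian side\<close>

lemma Bb_continuous: "\<omega> \<in> space N \<Longrightarrow> continuous_on {0..} (\<lambda>t. B *v b t \<omega>)"
  by (rule continuous_on_compose2[OF matrix_vector_mult_linear_continuous_on b_continuous]) auto

lemma brownian_skeleton_tendsto:
  assumes \<omega>: "\<omega> \<in> space N"
  shows "(\<lambda>m. brownian_skeleton m \<omega>) \<longlonglongrightarrow> brownian_hull \<omega>"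
proof (rule metric_LIMSEQ_I)
  fix r :: real assume r: "r > 0"
  define \<beta> where "\<beta> t = B *v b t \<omega>" for t
  have c: "continuous_on {0..1} \<beta>"
    unfolding \<beta>_def by (rule continuous_on_subset[OF Bb_continuous[OF \<omega>]]) auto
  have \<beta>0: "\<beta> 0 = 0" using b_zero[OF \<omega>] by (simp add: \<beta>_def)
  have "uniformly_continuous_on {0..1} \<beta>" using c by (rule compact_uniformly_continuous) simp
  then obtain d where d: "d > 0" "\<And>s t. s \<in> {0..1} \<Longrightarrow> t \<in> {0..1} \<Longrightarrow> dist s t < d \<Longrightarrow> dist (\<beta> s) (\<beta> t) < r / 2"
    unfolding uniformly_continuous_on_def using r by (metis half_gt_zero)
  obtain m0 where m0: "m0 > 0" "1 / real m0 < d" using d(1) real_arch_inverse[of d] by (auto simp: inverse_eq_divide)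
  have "dist (brownian_skeleton m \<omega>) (brownian_hull \<omega>) < r" if m: "m \<ge> m0" for m
  proof -
    have mp: "0 < m" "1 / real m < d"
    proof -
      show "0 < m" using m m0 by simp
      have "1 / real m \<le> 1 / real m0" using m m0 by (intro divide_left_mono) auto
      then show "1 / real m < d" using m0 by simp
    qed
    have frac: "real j / real m \<in> {0..1}" if "j \<le> m" for j using that mp by simp
    have "dist (brownian_skeleton m \<omega>) (brownian_hull \<omega>) \<le> r / 2"
      unfolding brownian_skeleton_def brownian_hull_def vertex_hull_def \<beta>_def[symmetric]
    proof (rule dist_hull_body_le)
      show "compact (\<beta> ` {0..1})" using c by (rule compact_continuous_image) simp
      show "0 \<in> \<beta> ` {0..1}" using \<beta>0 by (intro image_eqI[of _ _ 0]) auto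
      fix x assume x: "x \<in> insert 0 ((\<lambda>j. \<beta> (real j / real m)) ` {..m})"
      then have "x \<in> \<beta> ` {0..1}" using \<open>0 \<in> \<beta> ` {0..1}\<close> frac by auto
      then show "\<exists>y\<in>\<beta> ` {0..1}. dist x y \<le> r / 2" using r by (intro bexI[of _ x]) auto
    next
      fix y assume "y \<in> \<beta> ` {0..1}"
      then obtain t where t: "t \<in> {0..1}" "y = \<beta> t" by blast
      \<comment> \<open>Rounding \<open>t\<close> down to the grid moves it by at most
        \<open>1 / m\<close>, below the threshold \<open>d\<close> from uniform continuity.\<close>
      define j where "j = nat \<lfloor>t * real m\<rfloor>"
      have j: "real j \<le> t * real m" "t * real m < real j + 1" using t mp by (auto simp: j_def)
      have "t * real m \<le> 1 * real m" using t by (intro mult_right_mono) auto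
      then have jm: "j \<le> m" using j by linarith
      have "\<bar>t - real j / real m\<bar> \<le> 1 / real m" 
      proof -
        have "t - real j / real m = (t * real m - real j) / real m" using mp by (simp add: field_simps)
        moreover have "\<bar>t * real m - real j\<bar> \<le> 1" using j by linarith
        ultimately show ?thesis using mp by (simp add: divide_right_mono)
      qed
      then have "dist t (real j / real m) < d" using mp by (simp add: dist_real_def)
      then have "dist y (\<beta> (real j / real m)) < r / 2" unfolding t(2) by (intro d(2) t frac jm)
      then show "\<exists>x\<in>insert 0 ((\<lambda>j. \<beta> (real j / real m)) ` {..m}). dist y x \<le> r / 2"
        using jm by (intro bexI[of _ "\<beta> (real j / real m)"]) auto
    qed (auto intro: finite_imp_compact)
    then show ?thesis using r by simp
  qed
  then show "\<exists>m0. \<forall>m\<ge>m0. dist (brownian_skeleton m \<omega>) (brownian_hull \<omega>) < r" by blast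
qed

text \<open>The generating set is uncountable, so measurability is inherited from the finitely
  generated skeletons through their pointwise limit.\<close>

lemma brownian_hull_measurable: "brownian_hull \<in> borel_measurable N"
  using borel_measurable_LIMSEQ_metric[OF brownian_skeleton_measurable brownian_skeleton_tendsto] .

lemma brownian_grid_tendsto:
  assumes m: "0 < m" and \<omega>: "\<omega> \<in> space N"
  shows "(\<lambda>n. vertex_hull m (\<lambda>j. \<Sum>i<grid m n j. W n i \<omega>)) \<longlonglongrightarrow> brownian_skeleton m \<omega>"
proof (rule metric_LIMSEQ_I)
  fix r :: real assume r: "r > 0"
  have each: "\<forall>\<^sub>F n in sequentially. dist (\<Sum>i<grid m n j. W n i \<omega>) (B *v b (real j / real m) \<omega>) < r / 2" if j: "j \<le> m" for j
  proof -
    have "(\<lambda>n. real (grid m n j) / real n) \<longlonglongrightarrow> real j / real m"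
    \<comment> \<open>The grid time is rounded down by at most one of the \<open>n\<close> steps,
      that is by \<open>1 / n\<close> in Brownian time.\<close>
    proof (rule tendsto_sandwich[of "\<lambda>n. real j / real m - 1 / real n" _ _ "\<lambda>n. real j / real m"])
      show "\<forall>\<^sub>F n in sequentially. real j / real m - 1 / real n \<le> real (grid m n j) / real n"
        using eventually_gt_at_top[of 0]
      proof eventually_elim
        case (elim n)
        have "real (n * j) / real m \<le> real (grid m n j) + 1"
          using divide_nat_diff_div_nat_less_one[of "n * j" m] j by (simp add: grid_def)
        then have "real (n * j) / real m / real n \<le> (real (grid m n j) + 1) / real n" by (intro divide_right_mono) auto
        then show ?case using elim by (simp add: add_divide_distrib)
      qed
      show "\<forall>\<^sub>F n in sequentially. real (grid m n j) / real n \<le> real j / real m"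
        using eventually_gt_at_top[of 0]
      proof eventually_elim
        case (elim n)
        have "real (grid m n j) \<le> real (n * j) / real m" using of_nat_div_le_of_nat[of "n * j" m] j by (simp add: grid_def)
        then have "real (grid m n j) / real n \<le> real (n * j) / real m / real n" by (intro divide_right_mono) auto
        then show ?case using elim by simp
      qed
      show "(\<lambda>n. real j / real m - 1 / real n) \<longlonglongrightarrow> real j / real m"
        using tendsto_diff[OF tendsto_const lim_1_over_n, of "real j / real m"] by simp
    qed simp
    then have "(\<lambda>n. B *v b (real (grid m n j) / real n) \<omega>) \<longlonglongrightarrow> B *v b (real j / real m) \<omega>"
      by (rule continuous_on_tendsto_compose[OF Bb_continuous[OF \<omega>]]) auto
    moreover have "(\<Sum>i<grid m n j. W n i \<omega>) = B *v b (real (grid m n j) / real n) \<omega>" for n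
      using W_sum[OF \<omega>, of 0 "grid m n j" n] b_zero[OF \<omega>] by (simp add: lessThan_atLeast0)
    ultimately show ?thesis using tendstoD[of _ _ _ "r / 2"] r by simp
  qed
  have "\<forall>\<^sub>F n in sequentially. \<forall>j\<in>{..m}. dist (\<Sum>i<grid m n j. W n i \<omega>) (B *v b (real j / real m) \<omega>) < r / 2"
    using each by (intro eventually_ball_finite) auto
  then have "\<forall>\<^sub>F n in sequentially. dist (vertex_hull m (\<lambda>j. \<Sum>i<grid m n j. W n i \<omega>)) (brownian_skeleton m \<omega>) < r"
  proof eventually_elim
    case (elim n)
    then have "dist (vertex_hull m (\<lambda>j. \<Sum>i<grid m n j. W n i \<omega>)) (brownian_skeleton m \<omega>) \<le> r / 2"
      unfolding brownian_skeleton_def by (intro dist_vertex_hull_le) (auto intro: less_imp_le)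
    then show ?case using r by simp
  qed
  then show "\<exists>n0. \<forall>n\<ge>n0. dist (vertex_hull m (\<lambda>j. \<Sum>i<grid m n j. W n i \<omega>)) (brownian_skeleton m \<omega>) < r"
    by (simp add: eventually_sequentially)
qed

text \<open>For fixed \<open>m\<close> the walk is compared with Brownian motion at the same rounded
  times; as \<open>n\<close> grows these times tend to \<open>j / m\<close>, and path continuity
  removes the rounding.\<close>

lemma walk_skeleton_convergence:
  fixes f :: "'n body0 \<Rightarrow> real"
  assumes f: "continuous_on UNIV f" "\<And>K. \<bar>f K\<bar> \<le> c" and m: "0 < m"
  shows "(\<lambda>n. \<integral>\<omega>. f (walk_skeleton m n \<omega>) \<partial>M) \<longlonglongrightarrow> (\<integral>\<omega>. f (brownian_skeleton m \<omega>) \<partial>N)"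
proof -
  have "(\<lambda>n. \<integral>\<omega>. f (vertex_hull m (\<lambda>j. \<Sum>i<grid m n j. W n i \<omega>)) \<partial>N) \<longlonglongrightarrow> (\<integral>\<omega>. f (brownian_skeleton m \<omega>) \<partial>N)"
    by (rule N.integral_tendsto_pathwise[OF f _ brownian_skeleton_measurable brownian_grid_tendsto[OF m]])
      (auto intro!: borel_measurable_vertex_hull)
  from tendsto_add[OF fdd_convergence[OF f, of m] this] show ?thesis
    by (simp add: walk_skeleton_def)
qed

section \<open>Distance between the walk and its skeleton\<close>

lemma dist_walk_skeleton_le:
  assumes m: "0 < m" and e: "\<And>j k. j < m \<Longrightarrow> k \<in> {grid m n j..grid m n (Suc j)} \<Longrightarrow> norm (\<Sum>i\<in>{grid m n j..<k}. V n i \<omega>) \<le> e"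
  shows "dist (walk n \<omega>) (walk_skeleton m n \<omega>) \<le> e"
  unfolding walk_def walk_skeleton_def vertex_hull_def
proof (rule dist_hull_body_le)
  have e0: "0 \<le> e" using e[of 0 "grid m n 0"] m by (auto simp: grid_def)
  fix x assume x: "x \<in> insert 0 ((\<lambda>k. \<Sum>i<k. V n i \<omega>) ` {..n})"
  show "\<exists>y\<in>insert 0 ((\<lambda>j. \<Sum>i<grid m n j. V n i \<omega>) ` {..m}). dist x y \<le> e"
  proof (cases "x = 0")
    case False
    then obtain k where k: "k \<le> n" "x = (\<Sum>i<k. V n i \<omega>)" using x by auto
    \<comment> \<open>The left end of the block containing time \<open>k\<close> gives a skeleton
      vertex within \<open>e\<close> of the walk at \<open>k\<close>. Conversely, skeleton vertices
      are themselves walk vertices.\<close>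
    obtain j where j: "j < m" "grid m n j \<le> k" "k \<le> grid m n (Suc j)"
      using grid_cell[of "grid m n" k m] grid_ends[OF m] k m by auto
    have "(\<Sum>i<k. V n i \<omega>) = (\<Sum>i<grid m n j. V n i \<omega>) + (\<Sum>i\<in>{grid m n j..<k}. V n i \<omega>)"
      using j by (simp add: lessThan_atLeast0 sum.atLeastLessThan_concat)
    then have "dist x (\<Sum>i<grid m n j. V n i \<omega>) \<le> e" using e[of j k] j by (simp add: k(2) dist_norm)
    then show ?thesis using j by (intro bexI[of _ "\<Sum>i<grid m n j. V n i \<omega>"]) auto
  qed (use e0 in auto)
next
  have e0: "0 \<le> e" using e[of 0 "grid m n 0"] m by (auto simp: grid_def)
  fix y assume "y \<in> insert 0 ((\<lambda>j. \<Sum>i<grid m n j. V n i \<omega>) ` {..m})"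
  then have "y \<in> insert 0 ((\<lambda>k. \<Sum>i<k. V n i \<omega>) ` {..n})" using grid_le by auto
  then show "\<exists>x\<in>insert 0 ((\<lambda>k. \<Sum>i<k. V n i \<omega>) ` {..n}). dist y x \<le> e" using e0 by (intro bexI[of _ y]) auto
qed (auto intro: finite_imp_compact)

text \<open>Second moments serve to verify the hypothesis of Ottaviani's inequality. The endpoint
  probability is then bounded through \<open>tanh_quartic\<close>, which is bounded and so has an
  expectation that can be compared with the Gaussian one.\<close>

lemma block_maximal_inequality:
  assumes \<alpha>: "\<alpha> > 0" and m: "0 < m" "m \<le> n" "4 * var\<zeta> / \<alpha>\<^sup>2 \<le> real m" and j: "j < m"
  shows "M.prob {\<omega>\<in>space M. \<exists>k\<in>{grid m n j..grid m n (Suc j)}. 2 * \<alpha> \<le> norm (\<Sum>i\<in>{grid m n j..<k}. V n i \<omega>)}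
    \<le> 2 / tanh (1 / real CARD('n)) ^ 4 * (\<integral>\<omega>. tanh_quartic (1 / \<alpha>) (\<Sum>i\<in>{grid m n j..<grid m n (Suc j)}. V n i \<omega>) \<partial>M)"
proof -
  let ?a = "grid m n j" and ?b = "grid m n (Suc j)"
  define \<kappa> where "\<kappa> = tanh (1 / real CARD('n)) ^ 4"
  have \<kappa>: "\<kappa> > 0" by (simp add: \<kappa>_def)
  have Sm[measurable]: "(\<lambda>\<omega>. \<Sum>i\<in>A. V n i \<omega>) \<in> borel_measurable M" for A by measurable
  \<comment> \<open>Chebyshev: a block has at most \<open>2 * n / m\<close> steps, so its tail sums
    have second moment at most \<open>2 * var\<zeta> / m\<close>, and the lower bound on
    \<open>m\<close> brings the quotient by \<open>\<alpha>\<^sup>2\<close> down to one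
    half.\<close>
  have half: "M.prob {\<omega>\<in>space M. \<alpha> \<le> norm (\<Sum>i\<in>{k..<?b}. V n i \<omega>)} \<le> 1/2" if k: "k \<in> {?a..?b}" for k
  proof -
    have "M.prob {\<omega>\<in>space M. \<alpha> \<le> norm (\<Sum>i\<in>{k..<?b}. V n i \<omega>)} \<le> (\<integral>\<omega>. (norm (\<Sum>i\<in>{k..<?b}. V n i \<omega>))\<^sup>2 / \<alpha>\<^sup>2 \<partial>M)"
    proof (rule M.prob_le_expectation)
      show "1 \<le> (norm (\<Sum>i\<in>{k..<?b}. V n i \<omega>))\<^sup>2 / \<alpha>\<^sup>2"
        if "\<omega> \<in> {\<omega>\<in>space M. \<alpha> \<le> norm (\<Sum>i\<in>{k..<?b}. V n i \<omega>)}" for \<omega>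
        using that \<alpha> power_mono[of \<alpha> _ 2] by (simp add: le_divide_eq)
    qed (use V_sum_second_moment in auto)
    also have "\<dots> = real (?b - k) * var\<zeta> / real n / \<alpha>\<^sup>2" using V_sum_second_moment by simp
    also have "\<dots> \<le> (2 * real n / real m) * var\<zeta> / real n / \<alpha>\<^sup>2"
      using grid_step[OF m(1,2) j] k constants_nonneg by (intro divide_right_mono mult_right_mono) auto
    also have "\<dots> = (2 * var\<zeta> / \<alpha>\<^sup>2) / real m" using m by simp
    also have "\<dots> \<le> 1/2"
    proof -
      have "4 * var\<zeta> \<le> real m * \<alpha>\<^sup>2" using m(3) \<alpha> by (simp add: divide_le_eq)
      then show ?thesis using m(1) \<alpha> by (simp add: divide_le_eq mult.commute)
    qed
    finally show ?thesis .
  qed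
  have "M.prob {\<omega>\<in>space M. \<exists>k\<in>{?a..?b}. 2 * \<alpha> \<le> norm (\<Sum>i\<in>{?a..<k}. V n i \<omega>)}
    \<le> 2 * M.prob {\<omega>\<in>space M. \<alpha> \<le> norm (\<Sum>i\<in>{?a..<?b}. V n i \<omega>)}"
    by (rule M.ottaviani[OF M.indep_vars_subset[OF V_indep] half]) auto
  also have "M.prob {\<omega>\<in>space M. \<alpha> \<le> norm (\<Sum>i\<in>{?a..<?b}. V n i \<omega>)}
     \<le> (\<integral>\<omega>. tanh_quartic (1 / \<alpha>) (\<Sum>i\<in>{?a..<?b}. V n i \<omega>) / \<kappa> \<partial>M)"
  proof (rule M.prob_le_expectation)
    show "integrable M (\<lambda>\<omega>. tanh_quartic (1 / \<alpha>) (\<Sum>i\<in>{?a..<?b}. V n i \<omega>) / \<kappa>)"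
      by (intro integrable_divide M.borel_measurable_bounded_continuous_integrable[OF continuous_tanh_quartic _ Sm, where c = "real CARD('n)"])
        (simp add: tanh_quartic_bounds abs_of_nonneg)
    show "1 \<le> tanh_quartic (1 / \<alpha>) (\<Sum>i\<in>{?a..<?b}. V n i \<omega>) / \<kappa>"
      if "\<omega> \<in> {\<omega>\<in>space M. \<alpha> \<le> norm (\<Sum>i\<in>{?a..<?b}. V n i \<omega>)}" for \<omega>
      using that \<alpha> \<kappa> tanh_quartic_ge[of "1 / \<alpha>" "\<Sum>i\<in>{?a..<?b}. V n i \<omega>"] by (simp add: \<kappa>_def le_divide_eq)
    show "0 \<le> tanh_quartic (1 / \<alpha>) (\<Sum>i\<in>{?a..<?b}. V n i \<omega>) / \<kappa>" for \<omega>
      by (intro divide_nonneg_nonneg tanh_quartic_bounds(1)) (use \<kappa> in simp)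
  qed measurable
  finally show ?thesis by (simp add: \<kappa>_def)
qed

text \<open>A block lasts at most \<open>2 / m\<close>, and the Gaussian fourth moment is quadratic
  in the duration; the factor \<open>4\<close> is the square of \<open>2\<close>.\<close>

lemma brownian_block_quartic:
  assumes m: "0 < m" "m \<le> n" and j: "j < m"
  shows "(\<integral>\<omega>. tanh_quartic c (\<Sum>i\<in>{grid m n j..<grid m n (Suc j)}. W n i \<omega>) \<partial>N)
     \<le> c ^ 4 * real CARD('n) * (4 * W_bound4) / (real m)\<^sup>2"
proof -
  let ?a = "grid m n j" and ?b = "grid m n (Suc j)"
  have n: "n > 0" using m by simp
  have eq: "(\<integral>\<omega>. tanh_quartic c (\<Sum>i\<in>{?a..<?b}. W n i \<omega>) \<partial>N)
      = (\<integral>\<omega>. tanh_quartic c (B *v (b (real ?b / real n) \<omega> - b (real ?a / real n) \<omega>)) \<partial>N)"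
    using W_sum grid_step[OF m j] by (intro Bochner_Integration.integral_cong) auto
  show ?thesis
  proof (cases "?a = ?b")
    case True
    then show ?thesis unfolding eq using constants_nonneg by (simp add: tanh_quartic_def)
  next
    case False
    then have lt: "real ?a / real n < real ?b / real n" using grid_step[OF m j] n by (simp add: divide_strict_right_mono)
    let ?t = "real ?b / real n - real ?a / real n"
    have t: "0 < ?t" "0 \<le> real ?a / real n" using lt by auto
    note G = gaussian_image_moments[OF b_gauss[OF t(2) lt] t(1) op_norm]
    have t2: "?t \<le> 2 / real m"
    proof -
      have "?t = (real ?b - real ?a) / real n" by (simp add: diff_divide_distrib)
      also have "\<dots> \<le> (2 * real n / real m) / real n" using grid_step[OF m j] by (intro divide_right_mono) auto
      finally show ?thesis using n by simp
    qed
    have "(\<integral>\<omega>. tanh_quartic c (B *v (b (real ?b / real n) \<omega> - b (real ?a / real n) \<omega>)) \<partial>N)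
      \<le> (\<integral>\<omega>. c ^ 4 * real CARD('n) * norm (B *v (b (real ?b / real n) \<omega> - b (real ?a / real n) \<omega>)) ^ 4 \<partial>N)"
    proof (rule integral_mono)
      show "integrable N (\<lambda>\<omega>. tanh_quartic c (B *v (b (real ?b / real n) \<omega> - b (real ?a / real n) \<omega>)))"
      proof (rule N.borel_measurable_bounded_continuous_integrable[OF continuous_tanh_quartic])
        show "\<bar>tanh_quartic c x\<bar> \<le> real CARD('n)" for x :: "real ^ 'n" using tanh_quartic_bounds[of c x] by simp
        show "(\<lambda>\<omega>. B *v (b (real ?b / real n) \<omega> - b (real ?a / real n) \<omega>)) \<in> borel_measurable N"
          unfolding matrix_vector_mult_diff_distrib using Bb_measurable by auto
      qed
    qed (use G tanh_quartic_le in auto)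
    also have "\<dots> \<le> c ^ 4 * real CARD('n) * (W_bound4 * ?t\<^sup>2)"
      using G(6) unfolding W_bound4_def[symmetric] by (simp add: mult_left_mono)
    also have "\<dots> \<le> c ^ 4 * real CARD('n) * (W_bound4 * (2 / real m)\<^sup>2)"
      using t t2 constants_nonneg by (intro mult_left_mono power_mono) auto
    finally show ?thesis unfolding eq by (simp add: power_divide mult_ac)
  qed
qed

text \<open>\<open>K\<close> does not depend on \<open>m\<close>, whereas the threshold for
  \<open>n\<close> may. Each of the \<open>m\<close> blocks contributes order
  \<open>1 / m\<^sup>2\<close>: in \<open>D + 1\<close> the term \<open>D\<close> stands for the
  Brownian part and \<open>1\<close> for the Lindeberg error.\<close>

lemma walk_skeleton_close:
  assumes \<alpha>: "\<alpha> > 0"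
  shows "\<exists>K\<ge>0. \<forall>m>0. 4 * var\<zeta> / \<alpha>\<^sup>2 \<le> real m \<longrightarrow>
    (\<forall>\<^sub>F n in sequentially. M.prob {\<omega>\<in>space M. 2 * \<alpha> < dist (walk n \<omega>) (walk_skeleton m n \<omega>)} \<le> K / real m)"
proof -
  define \<kappa> where "\<kappa> = tanh (1 / real CARD('n)) ^ 4"
  have \<kappa>: "\<kappa> > 0" by (simp add: \<kappa>_def)
  define D where "D = (1 / \<alpha>) ^ 4 * real CARD('n) * (4 * W_bound4)"
  have D: "D \<ge> 0" using \<alpha> constants_nonneg by (simp add: D_def)
  show ?thesis
  proof (intro exI[of _ "2 / \<kappa> * (D + 1)"] conjI allI impI)
    show "0 \<le> 2 / \<kappa> * (D + 1)" using \<kappa> D by simp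
    fix m :: nat assume m: "0 < m" and mv: "4 * var\<zeta> / \<alpha>\<^sup>2 \<le> real m"
    let ?v = "\<lambda>n j. \<integral>\<omega>. tanh_quartic (1 / \<alpha>) (\<Sum>i\<in>{grid m n j..<grid m n (Suc j)}. V n i \<omega>) \<partial>M"
    let ?w = "\<lambda>n j. \<integral>\<omega>. tanh_quartic (1 / \<alpha>) (\<Sum>i\<in>{grid m n j..<grid m n (Suc j)}. W n i \<omega>) \<partial>N"
    have "\<forall>\<^sub>F n in sequentially. ?v n j - ?w n j < 1 / (real m)\<^sup>2" if "j < m" for j
    proof -
      have "(\<lambda>n. ?v n j - ?w n j) \<longlonglongrightarrow> 0"
      \<comment> \<open>The index sets ignore the position, so the path is constant and its entry
        \<open>0\<close> is the block sum.\<close>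
      proof (rule lindeberg_convergence[OF smooth_test_tanh_quartic, of "\<lambda>n _. {grid m n j..<grid m n (Suc j)}" "1 / \<alpha>" 0])
        show "{grid m n j..<grid m n (Suc j)} \<subseteq> {..<n}" for n using grid_le[of m n "Suc j"] by auto
      qed
      then show ?thesis by (rule order_tendstoD(2)) (use m in simp)
    qed
    then have "\<forall>\<^sub>F n in sequentially. \<forall>j\<in>{..<m}. ?v n j - ?w n j < 1 / (real m)\<^sup>2"
      by (intro eventually_ball_finite) auto
    then show "\<forall>\<^sub>F n in sequentially. M.prob {\<omega>\<in>space M. 2 * \<alpha> < dist (walk n \<omega>) (walk_skeleton m n \<omega>)} \<le> 2 / \<kappa> * (D + 1) / real m"
      using eventually_ge_at_top[of m]
    proof eventually_elim
      case (elim n)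
      define Q where "Q j = {\<omega>\<in>space M. \<exists>k\<in>{grid m n j..grid m n (Suc j)}. 2 * \<alpha> \<le> norm (\<Sum>i\<in>{grid m n j..<k}. V n i \<omega>)}" for j
      have Qm: "Q j \<in> M.events" for j
        unfolding Q_def by (intro sets.sets_Collect_finite_Ex) measurable
      have "{\<omega>\<in>space M. 2 * \<alpha> < dist (walk n \<omega>) (walk_skeleton m n \<omega>)} \<subseteq> (\<Union>j\<in>{..<m}. Q j)"
      proof
        fix \<omega> assume \<omega>: "\<omega> \<in> {\<omega>\<in>space M. 2 * \<alpha> < dist (walk n \<omega>) (walk_skeleton m n \<omega>)}"
        then obtain j k where "j < m" "k \<in> {grid m n j..grid m n (Suc j)}"
            "\<not> norm (\<Sum>i\<in>{grid m n j..<k}. V n i \<omega>) \<le> 2 * \<alpha>"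
          using dist_walk_skeleton_le[OF m, of n \<omega> "2 * \<alpha>"] by force
        then show "\<omega> \<in> (\<Union>j\<in>{..<m}. Q j)" using \<omega> by (force simp: Q_def)
      qed
      then have "M.prob {\<omega>\<in>space M. 2 * \<alpha> < dist (walk n \<omega>) (walk_skeleton m n \<omega>)} \<le> M.prob (\<Union>j\<in>{..<m}. Q j)"
        using Qm by (intro M.finite_measure_mono) auto
      also have "\<dots> \<le> (\<Sum>j<m. M.prob (Q j))"
        using Qm by (intro M.finite_measure_subadditive_finite) auto
      also have "\<dots> \<le> (\<Sum>j<m. 2 / \<kappa> * ((D + 1) / (real m)\<^sup>2))"
      proof (rule sum_mono)
        fix j assume "j \<in> {..<m}"
        then have j: "j < m" by simp
        have "M.prob (Q j) \<le> 2 / \<kappa> * ?v n j"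
          unfolding Q_def \<kappa>_def by (rule block_maximal_inequality[OF \<alpha> m elim(2) mv j])
        also have "?v n j \<le> D / (real m)\<^sup>2 + 1 / (real m)\<^sup>2"
          using elim(1) j brownian_block_quartic[OF m elim(2) j, of "1 / \<alpha>"] unfolding D_def[symmetric] by force
        then have "2 / \<kappa> * ?v n j \<le> 2 / \<kappa> * ((D + 1) / (real m)\<^sup>2)"
          using \<kappa> by (intro mult_left_mono) (auto simp: add_divide_distrib)
        finally show "M.prob (Q j) \<le> 2 / \<kappa> * ((D + 1) / (real m)\<^sup>2)" .
      qed
      also have "\<dots> = 2 / \<kappa> * (D + 1) / real m" using m by (simp add: power2_eq_square)
      finally show ?case .
    qed
  qed
qed

lemma walk_convergence_lipschitz:
  fixes f :: "'n body0 \<Rightarrow> real"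
  assumes lip: "\<And>K L. \<bar>f K - f L\<bar> \<le> l * dist K L" and c: "\<And>K. \<bar>f K\<bar> \<le> c"
  shows "(\<lambda>n. \<integral>\<omega>. f (walk n \<omega>) \<partial>M) \<longlonglongrightarrow> (\<integral>\<omega>. f (brownian_hull \<omega>) \<partial>N)"
proof (rule LIMSEQ_I)
  fix r :: real assume r: "r > 0"
  have c0: "0 \<le> c" using c abs_ge_zero order_trans by blast
  have lip': "\<bar>f K - f L\<bar> \<le> \<bar>l\<bar> * dist K L" for K L
    using lip[of K L] mult_right_mono[OF abs_ge_self[of l] zero_le_dist[of K L]] by linarith
  have f: "continuous_on UNIV f"
  proof (rule lipschitz_on_continuous_on[of "\<bar>l\<bar>"], rule lipschitz_onI)
    show "dist (f K) (f L) \<le> \<bar>l\<bar> * dist K L" for K L using lip'[of K L] by (simp add: dist_real_def)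
  qed simp
  \<comment> \<open>Keeps the Lipschitz error on the good event at most \<open>r / 4\<close>; adding
    \<open>1\<close> covers \<open>l = 0\<close>. The order of choices is \<alpha>, then
    \<open>m\<close>, then \<open>n\<close>.\<close>
  define \<alpha> where "\<alpha> = r / (8 * (\<bar>l\<bar> + 1))"
  have \<alpha>: "\<alpha> > 0" using r by (simp add: \<alpha>_def)
  have l\<alpha>: "\<bar>l\<bar> * (2 * \<alpha>) \<le> r / 4"
    using r by (simp add: \<alpha>_def divide_le_eq)
  obtain K where K: "K \<ge> 0" "\<And>m. m > 0 \<Longrightarrow> 4 * var\<zeta> / \<alpha>\<^sup>2 \<le> real m \<Longrightarrow>
    (\<forall>\<^sub>F n in sequentially. M.prob {\<omega>\<in>space M. 2 * \<alpha> < dist (walk n \<omega>) (walk_skeleton m n \<omega>)} \<le> K / real m)"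
    using walk_skeleton_close[OF \<alpha>] by blast
  have "(\<lambda>m. \<integral>\<omega>. f (brownian_skeleton m \<omega>) \<partial>N) \<longlonglongrightarrow> (\<integral>\<omega>. f (brownian_hull \<omega>) \<partial>N)"
    by (rule N.integral_tendsto_pathwise[OF f c brownian_skeleton_measurable brownian_hull_measurable brownian_skeleton_tendsto])
  then have "\<forall>\<^sub>F m in sequentially. dist (\<integral>\<omega>. f (brownian_skeleton m \<omega>) \<partial>N) (\<integral>\<omega>. f (brownian_hull \<omega>) \<partial>N) < r / 4"
    using r by (intro tendstoD) auto
  moreover have "\<forall>\<^sub>F m in sequentially. 4 * var\<zeta> / \<alpha>\<^sup>2 \<le> real m"
    using filterlim_real_sequentially by (simp add: filterlim_at_top)
  moreover have "\<forall>\<^sub>F m in sequentially. 2 * c * K * 4 / r \<le> real m"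
    using filterlim_real_sequentially by (simp add: filterlim_at_top)
  ultimately have "\<forall>\<^sub>F m in sequentially. m > 0 \<and> dist (\<integral>\<omega>. f (brownian_skeleton m \<omega>) \<partial>N) (\<integral>\<omega>. f (brownian_hull \<omega>) \<partial>N) < r / 4
     \<and> 4 * var\<zeta> / \<alpha>\<^sup>2 \<le> real m \<and> 2 * c * K * 4 / r \<le> real m"
    using eventually_gt_at_top[of "0::nat"] by eventually_elim auto
  then obtain m where m: "m > 0" "dist (\<integral>\<omega>. f (brownian_skeleton m \<omega>) \<partial>N) (\<integral>\<omega>. f (brownian_hull \<omega>) \<partial>N) < r / 4"
     "4 * var\<zeta> / \<alpha>\<^sup>2 \<le> real m" "2 * c * K * 4 / r \<le> real m"
    using eventually_happens'[OF sequentially_bot] by blast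
  have cK: "2 * c * (K / real m) \<le> r / 4" using m(1,4) r by (simp add: field_simps)
  have "\<forall>\<^sub>F n in sequentially. dist (\<integral>\<omega>. f (walk_skeleton m n \<omega>) \<partial>M) (\<integral>\<omega>. f (brownian_skeleton m \<omega>) \<partial>N) < r / 4"
    using walk_skeleton_convergence[OF f c m(1)] r by (intro tendstoD) auto
  then have "\<forall>\<^sub>F n in sequentially. norm ((\<integral>\<omega>. f (walk n \<omega>) \<partial>M) - (\<integral>\<omega>. f (brownian_hull \<omega>) \<partial>N)) < r"
    using K(2)[OF m(1,3)]
  proof eventually_elim
    case (elim n)
    define E where "E = {\<omega>\<in>space M. 2 * \<alpha> < dist (walk n \<omega>) (walk_skeleton m n \<omega>)}"
    have Em: "E \<in> M.events"
    proof -
      \<comment> \<open>Both hulls are read off one path, so their distance is a continuous function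
        of that path; this avoids any appeal to separability of the space of bodies.\<close>
      have "(\<lambda>\<omega>. dist (walk n \<omega>) (walk_skeleton m n \<omega>)) \<in> borel_measurable M"
      proof -
        let ?D = "\<lambda>x :: nat \<Rightarrow> real ^ 'n. dist (vertex_hull n x) (vertex_hull m (\<lambda>j. x (grid m n j)))"
        have "continuous_on UNIV ?D"
          by (intro continuous_on_dist continuous_vertex_hull continuous_on_compose2[OF continuous_vertex_hull]
              continuous_on_coordinatewise_then_product continuous_on_product_coordinates) auto
        moreover have "(\<lambda>\<omega> k. \<Sum>i<k. V n i \<omega>) \<in> borel_measurable M"
          by (rule measurable_coordinatewise_then_product) measurable
        ultimately show ?thesis
          using borel_measurable_continuous_on unfolding walk_def walk_skeleton_def by blast
      qed
      then show ?thesis unfolding E_def by measurable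
    qed
    note I = M.borel_measurable_bounded_continuous_integrable[OF f c]
    have i1: "integrable M (\<lambda>\<omega>. f (walk n \<omega>))" and i2: "integrable M (\<lambda>\<omega>. f (walk_skeleton m n \<omega>))"
      by (intro I walk_measurable)+
    have iE: "integrable M (\<lambda>\<omega>. \<bar>l\<bar> * (2 * \<alpha>) + 2 * c * indicator E \<omega>)"
      using Em by (intro M.integrable_const_bound[of _ "\<bar>l\<bar> * (2 * \<alpha>) + 2 * c"])
        (use \<alpha> c0 in \<open>auto split: split_indicator\<close>)
    have "\<bar>(\<integral>\<omega>. f (walk n \<omega>) \<partial>M) - (\<integral>\<omega>. f (walk_skeleton m n \<omega>) \<partial>M)\<bar> \<le> (\<integral>\<omega>. \<bar>f (walk n \<omega>) - f (walk_skeleton m n \<omega>)\<bar> \<partial>M)"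
      using i1 i2 integral_abs_bound[of M "\<lambda>\<omega>. f (walk n \<omega>) - f (walk_skeleton m n \<omega>)"] by simp
    also have "\<dots> \<le> (\<integral>\<omega>. \<bar>l\<bar> * (2 * \<alpha>) + 2 * c * indicator E \<omega> \<partial>M)"
    proof (rule integral_mono[OF _ iE])
      fix \<omega> assume \<omega>: "\<omega> \<in> space M"
      show "\<bar>f (walk n \<omega>) - f (walk_skeleton m n \<omega>)\<bar> \<le> \<bar>l\<bar> * (2 * \<alpha>) + 2 * c * indicator E \<omega>"
      proof (cases "\<omega> \<in> E")
        case True
        have "0 \<le> \<bar>l\<bar> * (2 * \<alpha>)" using \<alpha> by (intro mult_nonneg_nonneg) auto
        moreover have "\<bar>f (walk n \<omega>) - f (walk_skeleton m n \<omega>)\<bar> \<le> 2 * c"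
          using c[of "walk n \<omega>"] c[of "walk_skeleton m n \<omega>"] by linarith
        moreover have ind: "indicator E \<omega> = (1 :: real)" using True by simp
        ultimately show ?thesis unfolding ind by linarith
      next
        case False
        then have "dist (walk n \<omega>) (walk_skeleton m n \<omega>) \<le> 2 * \<alpha>" using \<omega> by (simp add: E_def)
        then have "\<bar>l\<bar> * dist (walk n \<omega>) (walk_skeleton m n \<omega>) \<le> \<bar>l\<bar> * (2 * \<alpha>)" by (rule mult_left_mono) simp
        then show ?thesis using lip'[of "walk n \<omega>" "walk_skeleton m n \<omega>"] False by simp
      qed
    qed (use i1 i2 in auto)
    also have "\<dots> = \<bar>l\<bar> * (2 * \<alpha>) + 2 * c * M.prob E"
    proof -
      have "integrable M (indicator E :: 'a \<Rightarrow> real)"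
        using Em by (intro M.integrable_const_bound[of _ 1]) (auto split: split_indicator)
      then show ?thesis using Em by (simp add: M.prob_space)
    qed
    also have "\<dots> \<le> r / 4 + r / 4"
    proof -
      have "2 * c * M.prob E \<le> 2 * c * (K / real m)" using elim c0 unfolding E_def by (intro mult_left_mono) auto
      then show ?thesis using l\<alpha> cK by linarith
    qed
    \<comment> \<open>Four quarters of \<open>r\<close>: the Lipschitz error and the exceptional
      event for walk against skeleton, the limit in \<open>n\<close> at fixed \<open>m\<close>, and
      the Brownian skeleton against its hull.\<close>
    finally show ?case using elim(1) m(2) unfolding dist_real_def real_norm_def by linarith
  qed
  then show "\<exists>n0. \<forall>n\<ge>n0. norm ((\<integral>\<omega>. f (walk n \<omega>) \<partial>M) - (\<integral>\<omega>. f (brownian_hull \<omega>) \<partial>N)) < r"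
    by (simp add: eventually_sequentially)
qed

end

section \<open>Weak convergence\<close>

lemma lipschitz_minorant:
  fixes f :: "'s :: metric_space \<Rightarrow> real"
  assumes f: "continuous_on UNIV f" "\<And>x. \<bar>f x\<bar> \<le> c"
  obtains g :: "nat \<Rightarrow> 's \<Rightarrow> real"
  where "\<And>k x y. \<bar>g k x - g k y\<bar> \<le> real k * dist x y" "\<And>k x. \<bar>g k x\<bar> \<le> c"
    "\<And>k x. g k x \<le> f x" "\<And>x. (\<lambda>k. g k x) \<longlonglongrightarrow> f x"
proof -
  \<comment> \<open>inf-convolution with \<open>k * dist\<close>\<close>
  define g where "g k x = (INF y. f y + real k * dist x y)" for k x
  have f': "- c \<le> f x" "f x \<le> c" for x using f(2)[of x] by auto
  have lower: "- c \<le> f y + real k * dist x y" for k x y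
    using f'(1)[of y] by (intro order_trans[OF f'(1)[of y]]) simp
  have bdd: "bdd_below (range (\<lambda>y. f y + real k * dist x y))" for k x
    using lower by (intro bdd_belowI2) auto
  have le: "g k x \<le> f y + real k * dist x y" for k x y
    unfolding g_def using bdd by (rule cINF_lower) simp
  have le_f: "g k x \<le> f x" for k x using le[of k x x] by simp
  have ge: "- c \<le> g k x" for k x unfolding g_def using lower by (intro cINF_greatest) auto
  have lip: "g k x - real k * dist x z \<le> g k z" for k x z
    unfolding g_def[of k z]
  proof (rule cINF_greatest)
    fix y
    have "real k * dist x y \<le> real k * (dist z y + dist x z)"
      using dist_triangle[of x y z] by (intro mult_left_mono) (auto simp: add.commute)
    then show "g k x - real k * dist x z \<le> f y + real k * dist z y"
      using le[of k x y] by (simp add: algebra_simps)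
  qed simp
  show thesis
  proof (rule that[of g])
    show "\<bar>g k x - g k y\<bar> \<le> real k * dist x y" for k x y
      using lip[of k x y] lip[of k y x] by (simp add: abs_le_iff dist_commute)
    show "\<bar>g k x\<bar> \<le> c" for k x using ge[of k x] le_f[of k x] f'(2)[of x] by (simp add: abs_le_iff)
    show "g k x \<le> f x" for k x by (rule le_f)
    show "(\<lambda>k. g k x) \<longlonglongrightarrow> f x" for x
    proof (rule LIMSEQ_I)
      fix r :: real assume r: "r > 0"
      obtain d where d: "d > 0" "\<And>y. dist y x < d \<Longrightarrow> dist (f y) (f x) < r / 2"
        using f(1) r unfolding continuous_on_iff by (metis UNIV_I half_gt_zero)
      \<comment> \<open>From distance \<open>d\<close> on the penalty is at least
        \<open>2 * c\<close>, which bounds the oscillation of \<open>f\<close>, so such points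
        cannot push the infimum below \<open>f x\<close>.\<close>
      obtain k0 where k0: "2 * c / d \<le> real k0" using real_arch_simple by blast
      have "norm (g k x - f x) < r" if k: "k \<ge> k0" for k
      proof -
        have "f x - r / 2 \<le> g k x"
          unfolding g_def
        proof (rule cINF_greatest)
          fix y
          show "f x - r / 2 \<le> f y + real k * dist x y"
          proof (cases "dist y x < d")
            case True
            have "f x - r / 2 \<le> f y" using d(2)[OF True] unfolding dist_real_def by linarith
            then show ?thesis by (rule order_trans) simp
          next
            case False
            have "2 * c \<le> real k0 * d" using k0 d(1) by (simp add: divide_le_eq)
            also have "\<dots> \<le> real k * dist x y" using k False d(1) by (intro mult_mono) (auto simp: dist_commute)
            finally show ?thesis using f'(2)[of x] f'(1)[of y] r by linarith
          qed
        qed simp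
        then show ?thesis using le_f[of k x] r by simp
      qed
      then show "\<exists>k0. \<forall>k\<ge>k0. norm (g k x - f x) < r" by blast
    qed
  qed
qed

text \<open>Lipschitz minorants give the lower bound: for large \<open>k\<close> the integral of
  \<open>g k\<close> under the limit law comes within \<open>e\<close> of that of \<open>h\<close>,
  and \<open>g k \<le> h\<close>. Applying this to \<open>f\<close> and to \<open>- f\<close> gives
  both inequalities.\<close>

lemma integral_convergence_of_lipschitz:
  fixes X :: "nat \<Rightarrow> 'a \<Rightarrow> 's :: metric_space" and Y :: "'b \<Rightarrow> 's" and f :: "'s \<Rightarrow> real"
  assumes M: "prob_space M" and N: "prob_space N"
    and X: "\<And>n. X n \<in> borel_measurable M" and Y: "Y \<in> borel_measurable N"
    and lip: "\<And>(g :: 's \<Rightarrow> real) l c. (\<And>x y. \<bar>g x - g y\<bar> \<le> l * dist x y) \<Longrightarrow> (\<And>x. \<bar>g x\<bar> \<le> c) \<Longrightarrow>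
      (\<lambda>n. \<integral>\<omega>. g (X n \<omega>) \<partial>M) \<longlonglongrightarrow> (\<integral>\<omega>. g (Y \<omega>) \<partial>N)"
    and f: "continuous_on UNIV f" "\<And>x. \<bar>f x\<bar> \<le> c"
  shows "(\<lambda>n. \<integral>\<omega>. f (X n \<omega>) \<partial>M) \<longlonglongrightarrow> (\<integral>\<omega>. f (Y \<omega>) \<partial>N)"
proof -
  interpret M: prob_space M by fact
  interpret N: prob_space N by fact
  have lower: "\<forall>\<^sub>F n in sequentially. (\<integral>\<omega>. h (Y \<omega>) \<partial>N) - e < (\<integral>\<omega>. h (X n \<omega>) \<partial>M)"
    if h: "continuous_on UNIV h" "\<And>x. \<bar>h x\<bar> \<le> c" and e: "e > 0" for h :: "'s \<Rightarrow> real" and e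
  proof -
    obtain g where g: "\<And>k x y. \<bar>g k x - g k y\<bar> \<le> real k * dist x y" "\<And>k x. \<bar>g k x\<bar> \<le> c"
      "\<And>k x. g k x \<le> h x" "\<And>x. (\<lambda>k. g k x) \<longlonglongrightarrow> h x"
      using lipschitz_minorant[OF h] by metis
    have gc: "continuous_on UNIV (g k)" for k
    proof (rule lipschitz_on_continuous_on[of "real k"], rule lipschitz_onI)
      show "dist (g k x) (g k y) \<le> real k * dist x y" for x y using g(1)[of k x y] by (simp add: dist_real_def)
    qed simp
    have "(\<lambda>k. \<integral>\<omega>. g k (Y \<omega>) \<partial>N) \<longlonglongrightarrow> (\<integral>\<omega>. h (Y \<omega>) \<partial>N)"
    proof (rule integral_dominated_convergence[where w = "\<lambda>_. c"])
      show "(\<lambda>\<omega>. g k (Y \<omega>)) \<in> borel_measurable N" for k by (rule borel_measurable_continuous_on[OF gc Y])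
      show "(\<lambda>\<omega>. h (Y \<omega>)) \<in> borel_measurable N" by (rule borel_measurable_continuous_on[OF h(1) Y])
    qed (use g in auto)
    then have "\<forall>\<^sub>F k in sequentially. (\<integral>\<omega>. h (Y \<omega>) \<partial>N) - e < (\<integral>\<omega>. g k (Y \<omega>) \<partial>N)"
      using e by (intro order_tendstoD(1)) auto
    then obtain k where k: "(\<integral>\<omega>. h (Y \<omega>) \<partial>N) - e < (\<integral>\<omega>. g k (Y \<omega>) \<partial>N)"
      using eventually_happens'[OF sequentially_bot] by blast
    have "\<forall>\<^sub>F n in sequentially. (\<integral>\<omega>. h (Y \<omega>) \<partial>N) - e < (\<integral>\<omega>. g k (X n \<omega>) \<partial>M)"
      by (rule order_tendstoD(1)[OF lip[OF g(1,2)] k])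
    then show ?thesis
    proof eventually_elim
      case (elim n)
      have "(\<integral>\<omega>. g k (X n \<omega>) \<partial>M) \<le> (\<integral>\<omega>. h (X n \<omega>) \<partial>M)"
        by (intro integral_mono M.borel_measurable_bounded_continuous_integrable[OF gc g(2) X]
            M.borel_measurable_bounded_continuous_integrable[OF h X] g(3))
      then show ?case using elim by linarith
    qed
  qed
  show ?thesis
  proof (rule order_tendstoI)
    fix a assume a: "a < (\<integral>\<omega>. f (Y \<omega>) \<partial>N)"
    show "\<forall>\<^sub>F n in sequentially. a < (\<integral>\<omega>. f (X n \<omega>) \<partial>M)"
      using lower[OF f, of "(\<integral>\<omega>. f (Y \<omega>) \<partial>N) - a"] a by simp
  next
    fix a assume a: "(\<integral>\<omega>. f (Y \<omega>) \<partial>N) < a"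
    have "continuous_on UNIV (\<lambda>x. - f x)" "\<And>x. \<bar>- f x\<bar> \<le> c" using f by (auto intro: continuous_on_minus)
    from lower[OF this, of "a - (\<integral>\<omega>. f (Y \<omega>) \<partial>N)"] a
    show "\<forall>\<^sub>F n in sequentially. (\<integral>\<omega>. f (X n \<omega>) \<partial>M) < a" by simp
  qed
qed

section \<open>Independence after an index shift, and the covariance matrix\<close>

lemma (in prob_space) indep_vars_Suc:
  assumes "indep_vars (\<lambda>_. S) X UNIV"
  shows "indep_vars (\<lambda>_. S) (\<lambda>i. X (Suc i)) UNIV"
proof -
  \<comment> \<open>The shift is treated as a grouping into the disjoint singletons
    \<open>{Suc j}\<close>, followed by projection to the only coordinate.\<close>
  have "indep_vars (\<lambda>j. Pi\<^sub>M {Suc j} (\<lambda>_. S)) (\<lambda>j \<omega>. restrict (\<lambda>i. X i \<omega>) {Suc j}) UNIV"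
    by (rule indep_vars_restrict[OF assms]) (auto simp: disjoint_family_on_def)
  from indep_vars_compose2[OF this, of "\<lambda>j x. x (Suc j)" "\<lambda>_. S"]
  show ?thesis by (simp add: measurable_component_singleton)
qed

lemma second_moment_matrix_symmetric: "transpose (second_moment_matrix M X) = second_moment_matrix M X"
  by (simp add: second_moment_matrix_def transpose_def vec_eq_iff mult.commute)

text \<open>The form at \<open>x\<close> is the expectation of
  \<open>(x \<bullet> X \<omega>)\<^sup>2\<close>.\<close>

lemma second_moment_matrix_psd:
  fixes X :: "'a \<Rightarrow> real ^ 'n::finite"
  assumes "\<And>i j. integrable M (\<lambda>\<omega>. X \<omega> $ i * X \<omega> $ j)"
  shows "0 \<le> x \<bullet> (second_moment_matrix M X *v x)"
proof -
  have "x \<bullet> (second_moment_matrix M X *v x) = (\<Sum>i\<in>UNIV. \<Sum>j\<in>UNIV. (x $ i * x $ j) * (\<integral>\<omega>. X \<omega> $ i * X \<omega> $ j \<partial>M))"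
    by (simp add: inner_vec_def matrix_vector_mult_def second_moment_matrix_def sum_distrib_left mult_ac)
  also have "\<dots> = (\<integral>\<omega>. (\<Sum>i\<in>UNIV. \<Sum>j\<in>UNIV. (x $ i * x $ j) * (X \<omega> $ i * X \<omega> $ j)) \<partial>M)"
    using assms by simp
  also have "\<dots> = (\<integral>\<omega>. (x \<bullet> X \<omega>)\<^sup>2 \<partial>M)"
    by (simp add: inner_vec_def power2_eq_square sum_product mult_ac)
  finally show ?thesis by simp
qed

theorem theorem6p4:
  fixes M :: "'a measure" and N :: "'b measure"
    and \<xi> :: "'a \<Rightarrow> real ^ 'n::finite" and \<xi>s :: "nat \<Rightarrow> 'a \<Rightarrow> real ^ 'n"
    and S :: "nat \<Rightarrow> 'a \<Rightarrow> real ^ 'n" and b :: "real \<Rightarrow> 'b \<Rightarrow> real ^ 'n"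
  assumes "prob_space M"
    and "prob_space.indep_vars M (\<lambda>_. borel) (\<lambda>i. if i = 0 then \<xi> else \<xi>s i) UNIV"
    and "\<And>i. i \<ge> 1 \<Longrightarrow> distr M borel (\<xi>s i) = distr M borel \<xi>"
    and "(\<integral>\<omega>. \<xi> \<omega> \<partial>M) = 0"
    and "integrable M (\<lambda>\<omega>. (norm (\<xi> \<omega>))\<^sup>2)"
    and "\<And>n \<omega>. S n \<omega> = (\<Sum>i=1..n. \<xi>s i \<omega>)"
    and "standard_brownian_motion N b"
  shows "weakly_converges
           M (\<lambda>n \<omega>. scale_body (real n powr (-1/2)) (hull_body ((\<lambda>k. S k \<omega>) ` {0..n})))
           N (\<lambda>\<omega>. matrix_image_body (psd_sqrt (second_moment_matrix M \<xi>))
                     (hull_body ((\<lambda>t. b t \<omega>) ` {0..1})))"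
proof -
  interpret M: prob_space M by fact
  define B where "B = psd_sqrt (second_moment_matrix M \<xi>)"
  have meas: "\<xi> \<in> borel_measurable M" "\<And>i. i \<ge> 1 \<Longrightarrow> \<xi>s i \<in> borel_measurable M"
  proof -
    have *: "(if i = 0 then \<xi> else \<xi>s i) \<in> borel_measurable M" for i
      using assms(2) by (auto simp: M.indep_vars_def)
    show "\<xi> \<in> borel_measurable M" using *[of 0] by simp
    show "\<xi>s i \<in> borel_measurable M" if "i \<ge> 1" for i using *[of i] that by simp
  qed
  have "integrable (distr M borel \<xi>) (\<lambda>y. (norm y)\<^sup>2)"
    using assms(5) meas(1) by (simp add: integrable_distr_eq)
  from integrable_component_products[OF _ _ this]
  have comp: "integrable M (\<lambda>\<omega>. \<xi> \<omega>)" "\<And>p q. integrable M (\<lambda>\<omega>. \<xi> \<omega> $ p * \<xi> \<omega> $ q)"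
    using meas(1) M.finite_measure_distr[OF meas(1)] by (simp_all add: integrable_distr_eq)
  have B: "transpose B = B" "B ** B = second_moment_matrix M \<xi>"
    unfolding B_def by (intro psd_sqrt second_moment_matrix_symmetric second_moment_matrix_psd comp)+
  have transfer: "(\<integral>\<omega>. f (\<xi>s 1 \<omega>) \<partial>M) = (\<integral>\<omega>. f (\<xi> \<omega>) \<partial>M)"
    "integrable M (\<lambda>\<omega>. f (\<xi>s 1 \<omega>)) \<longleftrightarrow> integrable M (\<lambda>\<omega>. f (\<xi> \<omega>))"
    if "f \<in> borel_measurable borel" for f :: "real ^ 'n \<Rightarrow> real"
    using integral_distr[OF meas(2) that, of 1] integral_distr[OF meas(1) that]
      integrable_distr_eq[OF meas(2) that, of 1] integrable_distr_eq[OF meas(1) that] assms(3)[of 1] by simp_all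
  \<comment> \<open>Index \<open>0\<close> of the independent family is the generic \<xi>, so the
    walk increment numbered \<open>i\<close> is \<open>\<xi>s (Suc i)\<close>.\<close>
  interpret W: walk_and_brownian M N "\<lambda>i. \<xi>s (Suc i)" b B
  proof
    show "M.indep_vars (\<lambda>_. borel) (\<lambda>i. \<xi>s (Suc i)) UNIV"
      using M.indep_vars_Suc[OF assms(2)] by simp
    show "distr M borel (\<xi>s (Suc i)) = distr M borel (\<xi>s (Suc 0))" for i using assms(3) by simp
    show "(\<integral>\<omega>. \<xi>s (Suc 0) \<omega> $ p \<partial>M) = 0" for p
    proof -
      have "(\<integral>\<omega>. \<xi> \<omega> $ p \<partial>M) = (\<integral>\<omega>. \<xi> \<omega> \<partial>M) $ p"
        by (rule integral_bounded_linear[OF bounded_linear_vec_nth comp(1)])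
      then show ?thesis using transfer(1)[of "\<lambda>x. x $ p"] assms(4) by (simp add: borel_measurable_nth)
    qed
    show "integrable M (\<lambda>\<omega>. (norm (\<xi>s (Suc 0) \<omega>))\<^sup>2)"
      using transfer(2)[of "\<lambda>x. (norm x)\<^sup>2"] assms(5) by simp
    show "(\<integral>\<omega>. \<xi>s (Suc 0) \<omega> $ p * \<xi>s (Suc 0) \<omega> $ q \<partial>M) = (B ** transpose B) $ p $ q" for p q
      using transfer(1)[of "\<lambda>x. x $ p * x $ q"] unfolding B by (simp add: second_moment_matrix_def)
  qed (use assms in auto)
  have walk: "W.walk n \<omega> = scale_body (real n powr (-1/2)) (hull_body ((\<lambda>k. S k \<omega>) ` {0..n}))" for n \<omega>
  proof -
    have S: "S k \<omega> = (\<Sum>i<k. \<xi>s (Suc i) \<omega>)" for k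
      unfolding assms(6) by (simp add: sum.atLeast1_atMost_eq)
    \<comment> \<open>Holds for \<open>n = 0\<close> as well, both sides being \<open>0\<close> by
      the conventions for \<open>powr\<close> and division.\<close>
    have h: "real n powr (-1/2) = 1 / sqrt (real n)"
      using powr_minus_divide[of "real n" "1/2"] by (simp add: powr_half_sqrt)
    have x: "(\<Sum>i<k. W.V n i \<omega>) = real n powr (-1/2) *\<^sub>R S k \<omega>" for k
      unfolding S h W.V_def by (simp add: scaleR_right.sum)
    have 0: "0 = S 0 \<omega>" by (simp add: S)
    \<comment> \<open>The origin is already a vertex, since \<open>S 0 \<omega> = 0\<close>.\<close>
    have "insert 0 ((\<lambda>k. \<Sum>i<k. W.V n i \<omega>) ` {..n}) = (\<lambda>x. real n powr (-1/2) *\<^sub>R x) ` (\<lambda>k. S k \<omega>) ` {0..n}"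
      unfolding x image_image atLeast0AtMost
      by (rule insert_absorb) (use 0 in \<open>auto intro: image_eqI[of _ _ 0]\<close>)
    then show ?thesis
      unfolding W.walk_def vertex_hull_def
      by (subst scale_hull_body) (use 0 in \<open>auto intro: finite_imp_compact image_eqI[of _ _ 0]\<close>)
  qed
  \<comment> \<open>Paths are known to be continuous on \<open>space N\<close>; there the image is
    compact, as the meaning of \<open>hull_body\<close> requires.\<close>
  have brownian: "W.brownian_hull \<omega> = matrix_image_body B (hull_body ((\<lambda>t. b t \<omega>) ` {0..1}))"
    if \<omega>: "\<omega> \<in> space N" for \<omega>
  proof -
    have "compact ((\<lambda>t. b t \<omega>) ` {0..1})"
      by (intro compact_continuous_image continuous_on_subset[OF W.b_continuous[OF \<omega>]]) auto
    moreover have "0 \<in> (\<lambda>t. b t \<omega>) ` {0..1}" using W.b_zero[OF \<omega>] by (intro image_eqI[of _ _ 0]) auto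
    ultimately show ?thesis
      unfolding W.brownian_hull_def by (simp add: matrix_image_hull_body image_image)
  qed
  have Ym: "(\<lambda>\<omega>. matrix_image_body B (hull_body ((\<lambda>t. b t \<omega>) ` {0..1}))) \<in> borel_measurable N"
    using W.brownian_hull_measurable brownian by (simp cong: measurable_cong)
  have Xm: "(\<lambda>\<omega>. scale_body (real n powr (-1/2)) (hull_body ((\<lambda>k. S k \<omega>) ` {0..n}))) \<in> borel_measurable M" for n
    using W.walk_measurable(1)[of n] unfolding walk[abs_def] .
  show ?thesis
    unfolding weakly_converges_def B_def[symmetric]
  proof (intro conjI allI impI Xm Ym)
    fix f :: "'n body0 \<Rightarrow> real" assume f: "continuous_on UNIV f \<and> bounded (range f)"
    then obtain c where c: "\<And>x. \<bar>f x\<bar> \<le> c" by (auto simp: bounded_iff)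
    have "(\<lambda>n. \<integral>\<omega>. f (W.walk n \<omega>) \<partial>M) \<longlonglongrightarrow> (\<integral>\<omega>. f (W.brownian_hull \<omega>) \<partial>N)"
    proof (rule integral_convergence_of_lipschitz[OF assms(1) W.N.prob_space_axioms W.walk_measurable(1)
          W.brownian_hull_measurable])
      show "(\<lambda>n. \<integral>\<omega>. g (W.walk n \<omega>) \<partial>M) \<longlonglongrightarrow> (\<integral>\<omega>. g (W.brownian_hull \<omega>) \<partial>N)"
        if "\<And>x y. \<bar>g x - g y\<bar> \<le> l * dist x y" "\<And>x. \<bar>g x\<bar> \<le> c" for g l c
        using that by (rule W.walk_convergence_lipschitz)
    qed (use f c in auto)
    moreover have "(\<integral>\<omega>. f (W.brownian_hull \<omega>) \<partial>N) = (\<integral>\<omega>. f (matrix_image_body B (hull_body ((\<lambda>t. b t \<omega>) ` {0..1}))) \<partial>N)"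
      using brownian by (intro Bochner_Integration.integral_cong) auto
    ultimately show "(\<lambda>n. \<integral>\<omega>. f (scale_body (real n powr (-1/2)) (hull_body ((\<lambda>k. S k \<omega>) ` {0..n}))) \<partial>M)
        \<longlonglongrightarrow> (\<integral>\<omega>. f (matrix_image_body B (hull_body ((\<lambda>t. b t \<omega>) ` {0..1}))) \<partial>N)"
      unfolding walk by simp
  qed
qed

end
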